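(* Let $D \subset \mathbb{C}$ be a bounded simply connected domain, let $\Gamma \subset \mathbb{C}$ be a bounded set disjoint from $D$, and let $N \in \mathbb{N}$, $N \geq 1$. The following statements are equivalent: (i) $\Gamma$ is a polynomial approximation set relative to $D$; (ii) for every $\zeta \in \Gamma$, the function $z \mapsto \frac{1}{(\zeta - z)^N}$ can be approximated by $\Gamma$-polynomials in $D$; (iii) $\Gamma$ contains an $N$-asymptotically neutral family relative to $D$; (iv) $\overline{\Gamma}$ divides the plane and $D$ lies in a bounded connected component of $\mathbb{C} \setminus \overline{\Gamma}$.
   Context: For a set $E \subset \mathbb{C}$, an $E$-polynomial is a complex polynomial all of whose zeros lie in $E$. Approximation in a domain $G$ means uniform approximation on compact subsets of $G$. A set $E$ is a polynomial approximation set relative to a domain $G$ if every zero-free holomorphic function on $G$ can be approximated, uniformly on compact subsets of $G$, by $E$-polynomials. A family of finite sequences $\zeta_{n,0}, \ldots, \zeta_{n,n-1}$ of points of $E$ (repetitions allowed), with $n = n_j \to \infty$, is called $N$-asymptotically neutral relative to $G$ if $\sum_{0 \leq k < n} \frac{1}{(\zeta_{n,k} - z)^N} \to 0$ as $n \to \infty$, uniformly on all compact subsets of $G$. A closed set divides the plane if its complement in $\mathbb{C}$ is not connected.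
   Formalization: Γ is assumed nonempty: for empty Γ statement (ii) holds vacuously while (i), (iii) and (iv) fail, so the equivalence is false in that case. *)

theory Defs
  imports "HOL-Complex_Analysis.Complex_Analysis" "HOL-Computational_Algebra.Polynomial"
begin

text \<open>For \<open>E \<noteq> UNIV\<close> the zero polynomial is not an \<open>E\<close>-polynomial; nonzero constants
  are \<open>E\<close>-polynomials for every \<open>E\<close>.\<close>

definition E_polynomial :: "complex set \<Rightarrow> complex poly \<Rightarrow> bool" where
  "E_polynomial E p \<longleftrightarrow> (\<forall>z. poly p z = 0 \<longrightarrow> z \<in> E)"

definition approximable_by_E_polynomials ::
    "complex set \<Rightarrow> complex set \<Rightarrow> (complex \<Rightarrow> complex) \<Rightarrow> bool" where
  "approximable_by_E_polynomials E G f \<longleftrightarrow>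
     (\<forall>K \<epsilon>. compact K \<and> K \<subseteq> G \<and> \<epsilon> > 0 \<longrightarrow>
        (\<exists>p. E_polynomial E p \<and> (\<forall>z\<in>K. norm (f z - poly p z) < \<epsilon>)))"

definition polynomial_approximation_set :: "complex set \<Rightarrow> complex set \<Rightarrow> bool" where
  "polynomial_approximation_set E G \<longleftrightarrow>
     (\<forall>f. f holomorphic_on G \<and> (\<forall>z\<in>G. f z \<noteq> 0) \<longrightarrow> approximable_by_E_polynomials E G f)"

text \<open>The family consists of the finite sequences \<open>\<zeta> n 0, \<dots>, \<zeta> n (n - 1)\<close> for
  \<open>n = n\<^sub>j = nn j\<close>; the values of \<open>\<zeta> n k\<close> for \<open>n\<close> outside the range of \<open>nn\<close> or for
  \<open>k \<ge> n\<close> are irrelevant.\<close>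

definition asymptotically_neutral ::
    "nat \<Rightarrow> complex set \<Rightarrow> (nat \<Rightarrow> nat) \<Rightarrow> (nat \<Rightarrow> nat \<Rightarrow> complex) \<Rightarrow> bool" where
  "asymptotically_neutral N G nn \<zeta> \<longleftrightarrow>
     filterlim nn at_top sequentially \<and>
     (\<forall>K. compact K \<and> K \<subseteq> G \<longrightarrow>
        uniform_limit K (\<lambda>j z. \<Sum>k<nn j. 1 / (\<zeta> (nn j) k - z) ^ N) (\<lambda>z. 0) sequentially)"

definition contains_asymptotically_neutral_family ::
    "nat \<Rightarrow> complex set \<Rightarrow> complex set \<Rightarrow> bool" where
  "contains_asymptotically_neutral_family N E G \<longleftrightarrow>
     (\<exists>nn \<zeta>. (\<forall>j. \<forall>k<nn j. \<zeta> (nn j) k \<in> E) \<and> asymptotically_neutral N G nn \<zeta>)"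

definition divides_plane :: "complex set \<Rightarrow> bool" where
  "divides_plane F \<longleftrightarrow> \<not> connected (- F)"

end

theory Submission
  imports Defs "HOL-Computational_Algebra.Fundamental_Theorem_Algebra"
begin

text \<open>
  The main step is (iv) \<open>\<Longrightarrow>\<close> (i). Taking logarithmic derivatives, it suffices to approximate a polynomial
  \<open>q\<close> on a compact \<open>K \<subseteq> C\<close> by sums of kernels \<open>1 / (x - z)\<close> with \<open>x\<close> in the outer frontier \<open>E\<close> of the component
  \<open>C\<close>, a connected compact subset of the closure of \<open>\<Gamma>\<close>. Positive real multiples of kernels suffice by the
  minimum principle: a pole sum \<open>\<Sum> r\<^sub>i / (x - z\<^sub>i)\<close> vanishes at infinity, so its real part is not positive throughout
  \<open>E\<close>, and a greedy choice of points converges. The real weights are then rounded to integers. Kernels are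
  approximated with error \<open>O(2\<^sup>-\<^sup>d)\<close> by a space of dimension \<open>O(d)\<close>, so linear dependence allows the fractional
  weights to be removed one at a time, with summable total error, until a number remains that does not depend on
  the configuration. Since \<open>E\<close> is connected, a fine walk through \<open>E\<close> absorbs these: the cumulative weights along
  the walk multiply differences of kernels at adjacent points, which are small, and can be rounded again.
  The points of the walk receive weight 3 beforehand, so no final weight is negative.

  For (ii) \<open>\<Longrightarrow>\<close> (iii), a polynomial \<open>p\<close> close to \<open>1 / (\<zeta> - z)\<^sup>N\<close> makes \<open>Ln (p (z) (\<zeta> - z)\<^sup>N)\<close> small, and so is its \<open>N\<close>-th
  derivative. For (iii) \<open>\<Longrightarrow>\<close> (iv), a locally uniform limit of the averaged sums vanishes on \<open>D\<close>, hence on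
  the component containing it, but behaves like \<open>(-z)\<^sup>-\<^sup>N\<close> at infinity.
\<close>

lemma compact_finite_net:
  fixes K :: "'a :: metric_space set"
  assumes "compact K" "e > 0"
  obtains T where "finite T" "T \<subseteq> K" "K \<subseteq> (\<Union>t\<in>T. ball t e)"
proof -
  have "K \<subseteq> (\<Union>t\<in>K. ball t e)" using assms(2) by auto
  then obtain T where "T \<subseteq> K" "finite T" "K \<subseteq> (\<Union>t\<in>T. ball t e)"
    using compactE_image[OF assms(1), of K "\<lambda>t. ball t e"] by blast
  then show ?thesis using that by blast
qed

section \<open>Rounding of linear combinations\<close>

text \<open>Gaussian elimination on the equations: one with a nonzero coefficient at a pivot
  \<open>j\<close> determines \<open>x j\<close>, and what remains is a system with one equation and
  one unknown fewer.\<close>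

lemma real_kernel_vector:
  fixes c :: "'l \<Rightarrow> 'i \<Rightarrow> real"
  assumes "finite L" "finite Q" "card L < card Q"
  shows "\<exists>x. (\<exists>i\<in>Q. x i \<noteq> 0) \<and> (\<forall>l\<in>L. (\<Sum>i\<in>Q. x i * c l i) = 0)"
  using assms
proof (induction L arbitrary: Q c rule: finite_induct)
  case empty
  then have "Q \<noteq> {}" by auto
  then show ?case by (intro exI[of _ "\<lambda>_. 1"]) auto
next
  case (insert k L)
  show ?case
  proof (cases "\<forall>i\<in>Q. c k i = 0")
    case True
    have "card L < card Q" using insert.hyps insert.prems by simp
    from insert.IH[OF insert.prems(1) this, of c] obtain x
      where "\<exists>i\<in>Q. x i \<noteq> 0" "\<forall>l\<in>L. (\<Sum>i\<in>Q. x i * c l i) = 0" by blast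
    then show ?thesis using True by (intro exI[of _ x]) auto
  next
    case False
    then obtain j where j: "j \<in> Q" "c k j \<noteq> 0" by auto
    define c' where "c' = (\<lambda>l i. c l i - c l j * c k i / c k j)"
    have "card L < card (Q - {j})"
      using insert j by auto
    then obtain x where x: "\<exists>i\<in>Q-{j}. x i \<noteq> 0" "\<forall>l\<in>L. (\<Sum>i\<in>Q-{j}. x i * c' l i) = 0"
      using insert.IH[of "Q - {j}" c'] insert.prems by auto
    define y where "y = x(j := - (\<Sum>i\<in>Q-{j}. x i * c k i) / c k j)"
    have yj: "y j = - (\<Sum>i\<in>Q-{j}. x i * c k i) / c k j" by (simp add: y_def)
    have split: "(\<Sum>i\<in>Q. y i * c l i) = y j * c l j + (\<Sum>i\<in>Q-{j}. x i * c l i)" for l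
    proof -
      have "(\<Sum>i\<in>Q. y i * c l i) = y j * c l j + (\<Sum>i\<in>Q-{j}. y i * c l i)"
        using j insert.prems by (simp add: sum.remove)
      moreover have "(\<Sum>i\<in>Q-{j}. y i * c l i) = (\<Sum>i\<in>Q-{j}. x i * c l i)"
        by (rule sum.cong) (auto simp: y_def)
      ultimately show ?thesis by simp
    qed
    have "(\<Sum>i\<in>Q. y i * c l i) = 0" if "l \<in> L" for l
    proof -
      have "0 = (\<Sum>i\<in>Q-{j}. x i * c l i - c l j / c k j * (x i * c k i))"
        using x(2) that by (auto simp: c'_def algebra_simps)
      also have "\<dots> = (\<Sum>i\<in>Q-{j}. x i * c l i) - c l j / c k j * (\<Sum>i\<in>Q-{j}. x i * c k i)"
        by (simp add: sum_subtractf sum_distrib_left)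
      finally show ?thesis unfolding split by (simp add: yj)
    qed
    moreover have "(\<Sum>i\<in>Q. y i * c k i) = 0"
      unfolding split using j by (simp add: yj)
    moreover have "\<exists>i\<in>Q. y i \<noteq> 0" using x(1) by (auto simp: y_def)
    ultimately show ?thesis by (intro exI[of _ y]) auto
  qed
qed

lemma complex_kernel_vector:
  fixes a :: "'l \<Rightarrow> 'i \<Rightarrow> complex"
  assumes "finite L" "finite Q" "2 * card L + 1 < card Q"
  obtains x :: "'i \<Rightarrow> real" where "\<exists>i\<in>Q. x i \<noteq> 0" "(\<Sum>i\<in>Q. x i) = 0"
    "\<And>l. l \<in> L \<Longrightarrow> (\<Sum>i\<in>Q. of_real (x i) * a l i) = 0"
proof -
  \<comment> \<open>Each complex equation splits into its real and imaginary part, and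
    \<open>None\<close> stands for the equation that keeps the total weight fixed; hence
    \<open>2 * card L + 1\<close> real equations.\<close>
  define L' where "L' = insert None (Some ` (L \<times> (UNIV :: bool set)))"
  define c where "c = (\<lambda>k i. case k of None \<Rightarrow> 1 | Some (l, b) \<Rightarrow> if b then Re (a l i) else Im (a l i))"
  have "card L' = 2 * card L + 1"
    using assms(1) by (simp add: L'_def card_image card_cartesian_product card_insert_if image_iff)
  then obtain x where x: "\<exists>i\<in>Q. x i \<noteq> 0" "\<forall>k\<in>L'. (\<Sum>i\<in>Q. x i * c k i) = 0"
    using real_kernel_vector[of L' Q c] assms by (auto simp: L'_def)
  have "(\<Sum>i\<in>Q. x i) = 0"
    using x(2)[rule_format, of None] by (simp add: L'_def c_def)
  moreover have "(\<Sum>i\<in>Q. of_real (x i) * a l i) = 0" if "l \<in> L" for l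
    using x(2)[rule_format, of "Some (l, True)"] x(2)[rule_format, of "Some (l, False)"] that
    by (simp add: L'_def c_def complex_eq_iff)
  ultimately show ?thesis using that x(1) by blast
qed

text \<open>On the way from an interior point of the unit cube in direction \<open>x\<close> there
  is a first parameter \<open>s\<close> at which a face is met; up to it the point stays in the
  cube.\<close>

lemma move_to_boundary:
  fixes t x :: "'i \<Rightarrow> real"
  assumes "finite Q" and t: "\<And>i. i \<in> Q \<Longrightarrow> 0 < t i \<and> t i < 1" and x: "\<exists>i\<in>Q. x i \<noteq> 0"
  obtains s where "\<And>i. i \<in> Q \<Longrightarrow> 0 \<le> t i + s * x i \<and> t i + s * x i \<le> 1"
    "\<exists>i\<in>Q. t i + s * x i = 0 \<or> t i + s * x i = 1"
proof -
  \<comment> \<open>\<open>b i\<close> is the parameter at which coordinate \<open>i\<close> reaches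
    \<open>1\<close> or \<open>0\<close>, according to the sign of \<open>x i\<close>; coordinates
    that do not move are excluded by \<open>N\<close>.\<close>
  define b where "b = (\<lambda>i. if x i > 0 then (1 - t i) / x i else - t i / x i)"
  define N where "N = {i\<in>Q. x i \<noteq> 0}"
  define s where "s = Min (b ` N)"
  have fin: "finite (b ` N)" "b ` N \<noteq> {}" using assms by (auto simp: N_def)
  have pos: "b i > 0" if "i \<in> N" for i
    using that t[of i] by (auto simp: N_def b_def divide_neg_neg field_simps)
  have "s \<in> b ` N" unfolding s_def using fin by (rule Min_in)
  then obtain j where j: "j \<in> N" "s = b j" by auto
  have s0: "s > 0" using j pos by simp
  have le: "s \<le> b i" if "i \<in> N" for i
    unfolding s_def using fin that by (intro Min_le) auto
  have "0 \<le> t i + s * x i \<and> t i + s * x i \<le> 1" if i: "i \<in> Q" for i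
  proof (cases "x i" "0::real" rule: linorder_cases)
    case less
    then have "s \<le> - t i / x i" using le[of i] i by (auto simp: N_def b_def)
    then have "s * x i \<ge> - t i" using less by (simp add: field_simps)
    moreover have "s * x i \<le> 0" using less s0 by (simp add: mult_nonneg_nonpos)
    ultimately show ?thesis using t[OF i] by auto
  next
    case equal
    then show ?thesis using t[OF i] by auto
  next
    case greater
    then have "s \<le> (1 - t i) / x i" using le[of i] i by (auto simp: N_def b_def)
    then have "s * x i \<le> 1 - t i" using greater by (simp add: field_simps)
    moreover have "s * x i \<ge> 0" using greater s0 by simp
    ultimately show ?thesis using t[OF i] by auto
  qed
  moreover have "t j + s * x j = 0 \<or> t j + s * x j = 1"
    using j by (auto simp: N_def b_def)
  ultimately show ?thesis using that j by (auto simp: N_def)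
qed

text \<open>Each summand of the error bound is the cost of removing one of \<open>m\<close> fractional weights: the
  approximating space may have as many as \<open>(m - 2) / 2\<close> dimensions before a kernel vector ceases to exist.\<close>

lemma rounding_error_bound:
  fixes a :: "'l \<Rightarrow> 'i \<Rightarrow> complex" and L :: "nat \<Rightarrow> 'l set" and t :: "'i \<Rightarrow> real"
  assumes L: "\<And>d. finite (L d)" "\<And>d. card (L d) \<le> q * d" and q: "q > 0"
    and G: "\<And>g d. g \<in> G \<Longrightarrow> \<exists>\<nu>. \<forall>i\<in>I. cmod (g i - (\<Sum>l\<in>L d. \<nu> l * a l i)) \<le> B * (1/2)^d"
    and I: "finite I" and p: "p \<ge> 1"
    and "\<And>i. i \<in> I \<Longrightarrow> 0 \<le> t i \<and> t i \<le> 1"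
  shows "\<exists>t'. (\<forall>i\<in>I. 0 \<le> t' i \<and> t' i \<le> 1) \<and> card {i\<in>I. t' i \<noteq> 0 \<and> t' i \<noteq> 1} \<le> p
     \<and> (\<Sum>i\<in>I. t' i) = (\<Sum>i\<in>I. t i)
     \<and> (\<forall>g\<in>G. cmod (\<Sum>i\<in>I. of_real (t' i - t i) * g i)
           \<le> (\<Sum>m\<in>{p<..card {i\<in>I. t i \<noteq> 0 \<and> t i \<noteq> 1}}. real m * B * (1/2)^((m - 2) div (2 * q))))"
  using assms(7)
proof (induction "card {i\<in>I. t i \<noteq> 0 \<and> t i \<noteq> 1}" arbitrary: t rule: less_induct)
  case (less t)
  define Q where "Q = {i\<in>I. t i \<noteq> 0 \<and> t i \<noteq> 1}"
  define m where "m = card Q"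
  define e where "e = (\<lambda>m. real m * B * (1/2)^((m - 2) div (2 * q)))"
  show ?case
  proof (cases "m \<le> p")
    case True
    then show ?thesis using less.prems
      by (intro exI[of _ t]) (auto simp: m_def Q_def)
  next
    case False
    have finQ: "finite Q" using I by (simp add: Q_def)
    have QI: "Q \<subseteq> I" by (auto simp: Q_def)
    \<comment> \<open>The largest order for which the dimension bound \<open>q * d\<close>
      guarantees \<open>2 * card (L d) + 1 < m\<close>. As \<open>m > p \<ge> 1\<close>, the
      subtraction \<open>m - 2\<close> is not truncated.\<close>
    define d where "d = (m - 2) div (2 * q)"
    have "2 * q * d \<le> m - 2" unfolding d_def by simp
    moreover have "2 * card (L d) \<le> 2 * q * d" using L(2)[of d] by simp
    ultimately have "2 * card (L d) + 1 < card Q" using False p m_def by linarith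
    then obtain x where x: "\<exists>i\<in>Q. x i \<noteq> 0" "(\<Sum>i\<in>Q. x i) = 0"
        "\<And>l. l \<in> L d \<Longrightarrow> (\<Sum>i\<in>Q. of_real (x i) * a l i) = 0"
      using complex_kernel_vector[OF L(1)[of d] finQ, of a] by blast
    have tQ: "0 < t i \<and> t i < 1" if "i \<in> Q" for i
      using that less.prems[of i] by (auto simp: Q_def)
    obtain s where s: "\<And>i. i \<in> Q \<Longrightarrow> 0 \<le> t i + s * x i \<and> t i + s * x i \<le> 1"
        "\<exists>i\<in>Q. t i + s * x i = 0 \<or> t i + s * x i = 1"
      using move_to_boundary[of Q t x] finQ tQ x(1) by blast
    define t1 where "t1 = (\<lambda>i. if i \<in> Q then t i + s * x i else t i)"
    define Q1 where "Q1 = {i\<in>I. t1 i \<noteq> 0 \<and> t1 i \<noteq> 1}"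
    have t1: "0 \<le> t1 i \<and> t1 i \<le> 1" if "i \<in> I" for i
      using s(1)[of i] less.prems[OF that] by (auto simp: t1_def)
    have "Q1 \<subset> Q" using s(2) by (auto simp: t1_def Q1_def Q_def)
    then have lt: "card Q1 < m" unfolding m_def by (rule psubset_card_mono[OF finQ])
    have sumQ: "(\<Sum>i\<in>I. of_real (t1 i - t i) * g i) = (\<Sum>i\<in>Q. of_real (s * x i) * g i)" for g :: "'i \<Rightarrow> complex"
      using I QI by (intro sum.mono_neutral_cong_right) (auto simp: t1_def)
    have "(\<Sum>i\<in>I. t1 i - t i) = (\<Sum>i\<in>Q. s * x i)"
      using I QI by (intro sum.mono_neutral_cong_right) (auto simp: t1_def)
    also have "\<dots> = 0" using x(2) by (simp flip: sum_distrib_left)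
    finally have sum1: "(\<Sum>i\<in>I. t1 i) = (\<Sum>i\<in>I. t i)" by (simp add: sum_subtractf)
    have err1: "cmod (\<Sum>i\<in>I. of_real (t1 i - t i) * g i) \<le> e m" if g: "g \<in> G" for g
    proof -
      obtain \<mu> where \<mu>: "\<And>i. i \<in> I \<Longrightarrow> cmod (g i - (\<Sum>l\<in>L d. \<mu> l * a l i)) \<le> B * (1/2)^d"
        using G[OF g, of d] by blast
      have "(\<Sum>i\<in>Q. of_real (s * x i) * (\<Sum>l\<in>L d. \<mu> l * a l i))
          = (\<Sum>l\<in>L d. of_real s * \<mu> l * (\<Sum>i\<in>Q. of_real (x i) * a l i))"
        unfolding sum_distrib_left by (subst sum.swap) (simp add: algebra_simps)
      also have "\<dots> = 0" using x(3) by simp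
      finally have z: "(\<Sum>i\<in>Q. of_real (s * x i) * (\<Sum>l\<in>L d. \<mu> l * a l i)) = 0" .
      have "(\<Sum>i\<in>Q. of_real (s * x i) * g i)
          = (\<Sum>i\<in>Q. of_real (s * x i) * (g i - (\<Sum>l\<in>L d. \<mu> l * a l i)))"
        using z by (simp add: right_diff_distrib sum_subtractf)
      also have "cmod \<dots> \<le> (\<Sum>i\<in>Q. B * (1/2)^d)"
      proof (rule sum_norm_le)
        fix i assume i: "i \<in> Q"
        \<comment> \<open>Both \<open>t i\<close> and \<open>t i + s * x i\<close> lie in
          \<open>[0, 1]\<close>, so no weight moves by more than \<open>1\<close>.\<close>
        have "\<bar>s * x i\<bar> \<le> 1" using s(1)[OF i] tQ[OF i] by auto
        then show "cmod (of_real (s * x i) * (g i - (\<Sum>l\<in>L d. \<mu> l * a l i))) \<le> B * (1/2)^d"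
          unfolding norm_mult norm_of_real
          using mult_mono[of "\<bar>s * x i\<bar>" 1] \<mu>[of i] i QI by fastforce
      qed
      also have "\<dots> = e m" by (simp add: m_def d_def e_def)
      finally show ?thesis by (simp only: sumQ)
    qed
    obtain t' where t': "\<forall>i\<in>I. 0 \<le> t' i \<and> t' i \<le> 1" "card {i\<in>I. t' i \<noteq> 0 \<and> t' i \<noteq> 1} \<le> p"
       "(\<Sum>i\<in>I. t' i) = (\<Sum>i\<in>I. t1 i)"
       "\<And>g. g \<in> G \<Longrightarrow> cmod (\<Sum>i\<in>I. of_real (t' i - t1 i) * g i) \<le> (\<Sum>m\<in>{p<..card Q1}. e m)"
      using less.hyps[of t1] t1 lt unfolding Q1_def Q_def m_def e_def by blast
    have "cmod (\<Sum>i\<in>I. of_real (t' i - t i) * g i) \<le> (\<Sum>m\<in>{p<..m}. e m)" if g: "g \<in> G" for g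
    proof -
      \<comment> \<open>The sign of \<open>B\<close> is known only when there is an index to
        evaluate at; the nonzero entry of \<open>x\<close> supplies one.\<close>
      have B: "B \<ge> 0" if "i \<in> I" for i
      proof -
        have "\<exists>\<mu>. cmod (g i - (\<Sum>l\<in>L 0. \<mu> l * a l i)) \<le> B" using G[OF g, of 0] \<open>i \<in> I\<close> by auto
        then show ?thesis using norm_ge_zero order_trans by blast
      qed
      then have e0: "e k \<ge> 0" for k
        using x(1) QI by (auto simp: e_def)
      have eq: "(\<Sum>i\<in>I. of_real (t' i - t i) * g i)
          = (\<Sum>i\<in>I. of_real (t' i - t1 i) * g i) + (\<Sum>i\<in>I. of_real (t1 i - t i) * g i)"
        unfolding sum.distrib[symmetric] by (rule sum.cong) (auto simp: algebra_simps)
      have "cmod (\<Sum>i\<in>I. of_real (t' i - t i) * g i) \<le> (\<Sum>m\<in>{p<..card Q1}. e m) + e m"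
        unfolding eq by (rule norm_triangle_mono[OF t'(4)[OF g] err1[OF g]])
      \<comment> \<open>At least one weight has become integral, so the costs of successive steps
        are distinct terms of the series.\<close>
      also have "\<dots> \<le> (\<Sum>m\<in>{p<..m-1}. e m) + e m"
        using lt e0 by (intro add_right_mono sum_mono2) auto
      also have "\<dots> = (\<Sum>m\<in>{p<..m}. e m)"
      proof -
        have "{p<..m} = insert m {p<..m-1}" using False by auto
        moreover have "sum e (insert m {p<..m-1}) = e m + sum e {p<..m-1}"
          using False by (intro sum.insert) auto
        ultimately show ?thesis by simp
      qed
      finally show ?thesis .
    qed
    then show ?thesis using t' sum1 unfolding m_def Q_def e_def
      by (intro exI[of _ t']) auto
  qed
qed

lemma summable_rounding_error:
  assumes "q > 0"
  shows "summable (\<lambda>m. real m * B * (1/2)^((m - 2) div q))"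
proof -
  \<comment> \<open>With this root the floor in the exponent costs only the constant factor
    \<open>1 / \<theta> ^ (q + 2)\<close>, and the series of \<open>m * \<theta> ^ m\<close>
    converges, coming from the derivative of the geometric series.\<close>
  define \<theta> where "\<theta> = root q (1/2)"
  have \<theta>: "0 < \<theta>" "\<theta> < 1" "\<theta> ^ q = 1/2"
    using assms by (auto simp: \<theta>_def)
  have "summable (\<lambda>m. real m * \<theta> ^ m)"
  proof -
    have "summable (\<lambda>m. diffs (\<lambda>_. 1::real) m * \<theta> ^ m)"
      by (rule termdiff_converges[of _ 1]) (use \<theta> in \<open>auto intro: summable_geometric\<close>)
    then have "summable (\<lambda>m. \<theta> * (real (Suc m) * \<theta> ^ m))"
      by (intro summable_mult) (simp add: diffs_def)
    then have "summable (\<lambda>m. real (Suc m) * \<theta> ^ Suc m)" by (simp add: algebra_simps)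
    then show ?thesis by (subst (asm) summable_Suc_iff)
  qed
  then have "summable (\<lambda>m. \<bar>B\<bar> / \<theta> ^ (q + 2) * (real m * \<theta> ^ m))" by (rule summable_mult)
  then show ?thesis
  proof (rule summable_comparison_test')
    fix m
    have "m \<le> q + 2 + q * ((m - 2) div q)"
      using assms mult_div_mod_eq[of q "m - 2"] mod_less_divisor[of q "m - 2"] by linarith
    then have "\<theta> ^ (q + 2 + q * ((m - 2) div q)) \<le> \<theta> ^ m"
      using \<theta> by (intro power_decreasing) auto
    then have "\<theta> ^ (q + 2) * (1/2)^((m - 2) div q) \<le> \<theta> ^ m"
      by (simp only: power_add[of \<theta> "q + 2"] power_mult \<theta>(3))
    then have "(1/2)^((m - 2) div q) \<le> \<theta> ^ m / \<theta> ^ (q + 2)"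
      using \<theta>(1) by (intro mult_imp_le_div_pos) (simp_all only: mult.commute zero_less_power)
    then have "real m * \<bar>B\<bar> * (1/2)^((m - 2) div q) \<le> real m * \<bar>B\<bar> * (\<theta> ^ m / \<theta> ^ (q + 2))"
      by (rule mult_left_mono) auto
    then show "norm (real m * B * (1/2)^((m - 2) div q)) \<le> \<bar>B\<bar> / \<theta> ^ (q + 2) * (real m * \<theta> ^ m)"
      by (simp add: abs_mult algebra_simps)
  qed
qed

text \<open>The order of quantifiers is the point: \<open>p\<close> depends on \<open>q\<close>,
  \<open>B\<close> and \<open>\<epsilon>\<close> only, because the tail of the convergent series of
  removal costs is small however many fractional weights there are at the start.\<close>

lemma rounding:
  fixes B \<epsilon> :: real and q :: nat
  assumes q: "q > 0" and B: "B \<ge> 0" and \<epsilon>: "\<epsilon> > 0"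
  obtains p where "\<And>(I :: 'i set) (a :: 'l \<Rightarrow> 'i \<Rightarrow> complex) L G t.
    \<lbrakk>\<And>d. finite (L d); \<And>d. card (L d) \<le> q * d;
     \<And>g d. g \<in> G \<Longrightarrow> \<exists>\<nu>. \<forall>i\<in>I. cmod (g i - (\<Sum>l\<in>L d. \<nu> l * a l i)) \<le> B * (1/2)^d;
     finite I; \<And>i. i \<in> I \<Longrightarrow> 0 \<le> t i \<and> t i \<le> 1\<rbrakk>
    \<Longrightarrow> \<exists>t'. (\<forall>i\<in>I. 0 \<le> t' i \<and> t' i \<le> 1) \<and> card {i\<in>I. t' i \<noteq> 0 \<and> t' i \<noteq> 1} \<le> p
     \<and> (\<Sum>i\<in>I. t' i) = (\<Sum>i\<in>I. t i)
     \<and> (\<forall>g\<in>G. cmod (\<Sum>i\<in>I. of_real (t' i - t i) * g i) \<le> \<epsilon>)"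
proof -
  define e where "e = (\<lambda>m. real m * B * (1/2)^((m - 2) div (2 * q)))"
  have e0: "e m \<ge> 0" for m using B by (simp add: e_def)
  have "summable e" unfolding e_def using q by (intro summable_rounding_error) auto
  then obtain p0 where p0: "\<And>m n. m \<ge> p0 \<Longrightarrow> norm (sum e {m..<n}) < \<epsilon>"
    using \<epsilon> unfolding summable_Cauchy by blast
  define p where "p = Suc p0"
  have small: "(\<Sum>m\<in>{p<..n}. e m) \<le> \<epsilon>" for n
  proof -
    have "{p<..n} = {Suc p..<Suc n}" by auto
    then show ?thesis using p0[of "Suc p" "Suc n"] e0 by (simp add: p_def)
  qed
  show ?thesis
  proof (rule that[of p])
    fix I :: "'i set" and a :: "'l \<Rightarrow> 'i \<Rightarrow> complex" and L G and t :: "'i \<Rightarrow> real"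
    assume A: "\<And>d. finite (L d)" "\<And>d. card (L d) \<le> q * d"
     "\<And>g d. g \<in> G \<Longrightarrow> \<exists>\<nu>. \<forall>i\<in>I. cmod (g i - (\<Sum>l\<in>L d. \<nu> l * a l i)) \<le> B * (1/2)^d"
     "finite I" "\<And>i. i \<in> I \<Longrightarrow> 0 \<le> t i \<and> t i \<le> 1"
    have "p \<ge> 1" by (simp add: p_def)
    from rounding_error_bound[of L q G I a B p t, OF A(1,2) q A(3,4) this A(5)]
    show "\<exists>t'. (\<forall>i\<in>I. 0 \<le> t' i \<and> t' i \<le> 1) \<and> card {i\<in>I. t' i \<noteq> 0 \<and> t' i \<noteq> 1} \<le> p
     \<and> (\<Sum>i\<in>I. t' i) = (\<Sum>i\<in>I. t i)
     \<and> (\<forall>g\<in>G. cmod (\<Sum>i\<in>I. of_real (t' i - t i) * g i) \<le> \<epsilon>)"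
      using small unfolding e_def by (meson order_trans)
  qed
qed

section \<open>Uniform approximation by polynomials on compact sets\<close>

definition poly_approximable :: "complex set \<Rightarrow> (complex \<Rightarrow> complex) \<Rightarrow> bool" where
  "poly_approximable K h \<longleftrightarrow> (\<forall>\<epsilon>>0. \<exists>q. \<forall>z\<in>K. cmod (h z - poly q z) < \<epsilon>)"

lemma poly_approximable_poly [intro]: "poly_approximable K (poly q)"
  unfolding poly_approximable_def by (auto intro!: exI[of _ q])

lemma poly_approximable_const [intro]: "poly_approximable K (\<lambda>z. c)"
  using poly_approximable_poly[of K "[:c:]"] by (simp add: fun_eq_iff poly_approximable_def)

lemma poly_approximable_ident [intro]: "poly_approximable K (\<lambda>z. z)"
  using poly_approximable_poly[of K "[:0, 1:]"] by (simp add: poly_approximable_def)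

lemma poly_approximable_cong:
  "(\<And>z. z \<in> K \<Longrightarrow> f z = g z) \<Longrightarrow> poly_approximable K f \<longleftrightarrow> poly_approximable K g"
  unfolding poly_approximable_def by (intro all_cong1 imp_cong refl ex_cong1 ball_cong) auto

lemma poly_approximable_subset:
  "poly_approximable K f \<Longrightarrow> K' \<subseteq> K \<Longrightarrow> poly_approximable K' f"
  unfolding poly_approximable_def by blast

lemma poly_approximable_limit:
  assumes "\<And>\<epsilon>. \<epsilon> > 0 \<Longrightarrow> \<exists>g. poly_approximable K g \<and> (\<forall>z\<in>K. cmod (f z - g z) < \<epsilon>)"
  shows "poly_approximable K f"
  unfolding poly_approximable_def
proof (intro allI impI)
  fix \<epsilon> :: real assume e: "\<epsilon> > 0"
  obtain g where g: "poly_approximable K g" "\<And>z. z \<in> K \<Longrightarrow> cmod (f z - g z) < \<epsilon>/2"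
    using assms[of "\<epsilon>/2"] e by auto
  obtain q where q: "\<And>z. z \<in> K \<Longrightarrow> cmod (g z - poly q z) < \<epsilon>/2"
    using g(1) e unfolding poly_approximable_def by (meson half_gt_zero)
  show "\<exists>q. \<forall>z\<in>K. cmod (f z - poly q z) < \<epsilon>"
    using norm_diff_triangle_less[OF g(2) q] by auto
qed

lemma poly_approximable_bounded:
  assumes "poly_approximable K f" "compact K"
  obtains B where "B > 0" "\<And>z. z \<in> K \<Longrightarrow> cmod (f z) \<le> B"
proof -
  obtain q where q: "\<And>z. z \<in> K \<Longrightarrow> cmod (f z - poly q z) < 1"
    using assms(1) unfolding poly_approximable_def by (meson zero_less_one)
  have "bounded (poly q ` K)"
    by (intro compact_imp_bounded compact_continuous_image continuous_intros assms)
  then obtain B where B: "B > 0" "\<And>z. z \<in> K \<Longrightarrow> cmod (poly q z) \<le> B"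
    by (auto simp: bounded_pos)
  have "cmod (f z) \<le> B + 1" if "z \<in> K" for z
    using q[OF that] B(2)[OF that] norm_triangle_sub[of "f z" "poly q z"] by linarith
  then show ?thesis using that[of "B + 1"] B(1) by auto
qed

lemma poly_approximable_add [intro]:
  assumes "poly_approximable K f" "poly_approximable K g"
  shows "poly_approximable K (\<lambda>z. f z + g z)"
  unfolding poly_approximable_def
proof (intro allI impI)
  fix \<epsilon> :: real assume e: "\<epsilon> > 0"
  obtain p where p: "\<And>z. z \<in> K \<Longrightarrow> cmod (f z - poly p z) < \<epsilon>/2"
    using assms(1) e unfolding poly_approximable_def by (meson half_gt_zero)
  obtain q where q: "\<And>z. z \<in> K \<Longrightarrow> cmod (g z - poly q z) < \<epsilon>/2"
    using assms(2) e unfolding poly_approximable_def by (meson half_gt_zero)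
  show "\<exists>q. \<forall>z\<in>K. cmod (f z + g z - poly q z) < \<epsilon>"
  proof (intro exI[of _ "p + q"] ballI)
    fix z assume z: "z \<in> K"
    have "cmod (f z + g z - poly (p + q) z) \<le> cmod (f z - poly p z) + cmod (g z - poly q z)"
      by (simp add: norm_diff_triangle_ineq)
    then show "cmod (f z + g z - poly (p + q) z) < \<epsilon>" using p[OF z] q[OF z] by linarith
  qed
qed

lemma poly_approximable_mult [intro]:
  assumes f: "poly_approximable K f" and g: "poly_approximable K g" and K: "compact K"
  shows "poly_approximable K (\<lambda>z. f z * g z)"
proof (rule poly_approximable_limit)
  fix \<epsilon> :: real assume e: "\<epsilon> > 0"
  obtain A where A: "A > 0" "\<And>z. z \<in> K \<Longrightarrow> cmod (f z) \<le> A"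
    using poly_approximable_bounded[OF f K] by blast
  obtain q where q: "\<And>z. z \<in> K \<Longrightarrow> cmod (g z - poly q z) < \<epsilon>/(2*A)"
    using g e A(1) unfolding poly_approximable_def by (meson divide_pos_pos mult_pos_pos zero_less_numeral)
  obtain B where B: "B > 0" "\<And>z. z \<in> K \<Longrightarrow> cmod (poly q z) \<le> B"
    using poly_approximable_bounded[OF poly_approximable_poly K] by blast
  obtain p where p: "\<And>z. z \<in> K \<Longrightarrow> cmod (f z - poly p z) < \<epsilon>/(2*B)"
    using f e B(1) unfolding poly_approximable_def by (meson divide_pos_pos mult_pos_pos zero_less_numeral)
  show "\<exists>h. poly_approximable K h \<and> (\<forall>z\<in>K. cmod (f z * g z - h z) < \<epsilon>)"
  proof (intro exI[of _ "poly (p * q)"] conjI ballI poly_approximable_poly)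
    fix z assume z: "z \<in> K"
    have "f z * g z - poly (p * q) z = f z * (g z - poly q z) + (f z - poly p z) * poly q z"
      by (simp add: algebra_simps)
    then have "cmod (f z * g z - poly (p * q) z) \<le> cmod (f z) * cmod (g z - poly q z) + cmod (f z - poly p z) * cmod (poly q z)"
      by (metis norm_mult norm_triangle_ineq)
    moreover have "cmod (f z) * cmod (g z - poly q z) \<le> A * cmod (g z - poly q z)"
      using A(2)[OF z] by (intro mult_right_mono) auto
    moreover have "A * cmod (g z - poly q z) < \<epsilon>/2"
      using q[OF z] A(1) by (simp add: field_simps)
    moreover have "cmod (f z - poly p z) * cmod (poly q z) \<le> cmod (f z - poly p z) * B"
      using B(2)[OF z] by (intro mult_left_mono) auto
    moreover have "cmod (f z - poly p z) * B < \<epsilon>/2"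
      using p[OF z] B(1) by (simp add: field_simps)
    ultimately show "cmod (f z * g z - poly (p * q) z) < \<epsilon>" by linarith
  qed
qed

lemma poly_approximable_power:
  assumes "poly_approximable K f" "compact K"
  shows "poly_approximable K (\<lambda>z. f z ^ n)"
  by (induction n) (use assms in auto)

lemma poly_approximable_sum:
  assumes "\<And>i. i \<in> I \<Longrightarrow> poly_approximable K (f i)"
  shows "poly_approximable K (\<lambda>z. \<Sum>i\<in>I. f i z)"
  using assms by (induction I rule: infinite_finite_induct) auto

lemma poly_approximable_geometric:
  assumes f: "poly_approximable K f" and K: "compact K" and le: "\<And>z. z \<in> K \<Longrightarrow> cmod (f z) \<le> 1/2"
  shows "poly_approximable K (\<lambda>z. 1 / (1 - f z))"
proof (rule poly_approximable_limit)
  fix \<epsilon> :: real assume e: "\<epsilon> > 0"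
  obtain n where n: "(1/2::real)^n < \<epsilon>/2"
    using real_arch_pow_inv[of "\<epsilon>/2" "1/2"] e by auto
  show "\<exists>h. poly_approximable K h \<and> (\<forall>z\<in>K. cmod (1 / (1 - f z) - h z) < \<epsilon>)"
  proof (intro exI[of _ "\<lambda>z. \<Sum>k<n. f z ^ k"] conjI ballI poly_approximable_sum poly_approximable_power f K)
    fix z assume z: "z \<in> K"
    have ne: "f z \<noteq> 1" using le[OF z] by auto
    have "1 - cmod (f z) \<le> cmod (1 - f z)" using norm_triangle_ineq2[of 1 "f z"] by simp
    then have d: "cmod (1 - f z) \<ge> 1/2" using le[OF z] by linarith
    have "1 / (1 - f z) - (\<Sum>k<n. f z ^ k) = f z ^ n / (1 - f z)"
      using ne by (simp add: sum_gp_strict diff_divide_distrib)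
    then have "cmod (1 / (1 - f z) - (\<Sum>k<n. f z ^ k)) = cmod (f z) ^ n / cmod (1 - f z)"
      by (simp add: norm_divide norm_power)
    also have "\<dots> \<le> (1/2)^n / (1/2)"
      using d le[OF z] by (intro frac_le power_mono) auto
    finally show "cmod (1 / (1 - f z) - (\<Sum>k<n. f z ^ k)) < \<epsilon>" using n by simp
  qed
qed

text \<open>Pole pushing: \<open>1 / (w' - z)\<close> is \<open>1 / (w - z)\<close> times a
  geometric series in \<open>(w - w') / (w - z)\<close>, which has modulus at most
  \<open>1/2\<close> on \<open>K\<close>.\<close>

lemma poly_approximable_pole_step:
  assumes w: "poly_approximable K (\<lambda>z. 1 / (w - z))" and K: "compact K"
    and notin: "w \<notin> K" "w' \<notin> K" and le: "\<And>z. z \<in> K \<Longrightarrow> cmod (w - w') \<le> cmod (w - z) / 2"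
  shows "poly_approximable K (\<lambda>z. 1 / (w' - z))"
proof -
  have "poly_approximable K (\<lambda>z. (w - w') * (1 / (w - z)))"
    by (intro poly_approximable_mult poly_approximable_const w K)
  moreover have "cmod ((w - w') * (1 / (w - z))) \<le> 1/2" if "z \<in> K" for z
    using le[OF that] that notin(1) by (auto simp: norm_divide norm_mult divide_simps)
  ultimately have "poly_approximable K (\<lambda>z. 1 / (1 - (w - w') * (1 / (w - z))))"
    by (rule poly_approximable_geometric[OF _ K])
  then have "poly_approximable K (\<lambda>z. 1 / (w - z) * (1 / (1 - (w - w') * (1 / (w - z)))))"
    by (intro poly_approximable_mult w K)
  moreover have "1 / (w - z) * (1 / (1 - (w - w') * (1 / (w - z)))) = 1 / (w' - z)" if z: "z \<in> K" for z
  proof -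
    have "w - z \<noteq> 0" using z notin by auto
    then have "1 - (w - w') * (1 / (w - z)) = (w' - z) / (w - z)" by (simp add: field_simps)
    then show ?thesis using \<open>w - z \<noteq> 0\<close> by simp
  qed
  ultimately show ?thesis by (simp cong: poly_approximable_cong)
qed

lemma poly_approximable_far_pole:
  assumes K: "compact K" "K \<subseteq> cball 0 B" and w: "cmod w > 2 * B" "B > 0"
  shows "poly_approximable K (\<lambda>z. 1 / (w - z))"
proof -
  have w0: "w \<noteq> 0" using w by auto
  have "poly_approximable K (\<lambda>z. 1 / w * z)"
    by (intro poly_approximable_mult poly_approximable_const poly_approximable_ident K)
  moreover have "cmod (1 / w * z) \<le> 1/2" if "z \<in> K" for z
    using that K(2) w w0 by (auto simp: norm_divide divide_simps subset_iff)
  ultimately have "poly_approximable K (\<lambda>z. 1 / (1 - 1 / w * z))"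
    by (rule poly_approximable_geometric[OF _ K(1)])
  then have "poly_approximable K (\<lambda>z. 1 / w * (1 / (1 - 1 / w * z)))"
    by (intro poly_approximable_mult poly_approximable_const K)
  moreover have "1 / w * (1 / (1 - 1 / w * z)) = 1 / (w - z)" for z
    using w0 by (simp add: field_simps)
  ultimately show ?thesis by simp
qed

text \<open>Approximability is unaffected by short moves of the pole, so it is constant on the
  component of the complement, which is unbounded and hence contains poles far from
  \<open>K\<close>.\<close>

lemma poly_approximable_pole:
  assumes K: "compact K" and w: "w \<in> outside K"
  shows "poly_approximable K (\<lambda>z. 1 / (w - z))"
proof -
  define V where "V = connected_component_set (- K) w"
  define P where "P = (\<lambda>w. poly_approximable K (\<lambda>z. 1 / (w - z)))"
  obtain B where B: "B > 0" "K \<subseteq> cball 0 B"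
    using compact_imp_bounded[OF K] by (auto simp: bounded_pos subset_iff)
  have V: "connected V" "V \<subseteq> - K" "\<not> bounded V" "w \<in> V"
    using w outside_no_overlap[of K] connected_component_subset[of "- K" w]
    by (auto simp: V_def outside)
  have "\<exists>v\<in>V. cmod v > 2 * B"
    using V(3) by (auto simp: bounded_iff not_le)
  then obtain v where v: "v \<in> V" "cmod v > 2 * B" by blast
  have "P w \<longleftrightarrow> P v"
  proof (rule connected_equivalence_relation[OF V(1) V(4) v(1), of "\<lambda>a b. P a \<longleftrightarrow> P b"])
    fix a assume a: "a \<in> V"
    have "open (- K)" using K by (simp add: compact_imp_closed open_Compl)
    then obtain d where d: "d > 0" "ball a d \<subseteq> - K" using a V(2) open_contains_ball by blast
    have far: "cmod (a - z) \<ge> d" if "z \<in> K" for z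
      using d(2) that by (force simp: dist_norm)
    \<comment> \<open>Radius \<open>d/3\<close> makes the step condition hold in both directions:
      \<open>a\<close> and \<open>x\<close> differ by less than \<open>d/3\<close>, while both have
      distance at least \<open>2 * d / 3\<close> from \<open>K\<close>.\<close>
    show "\<exists>T. openin (top_of_set V) T \<and> a \<in> T \<and> (\<forall>x\<in>T. P a \<longleftrightarrow> P x)"
    proof (intro exI[of _ "V \<inter> ball a (d/3)"] conjI ballI)
      fix x assume x: "x \<in> V \<inter> ball a (d/3)"
      then have ax: "cmod (a - x) < d/3" by (simp add: dist_norm)
      show "P a \<longleftrightarrow> P x"
      proof
        assume "P a"
        then show "P x" unfolding P_def
          by (rule poly_approximable_pole_step[OF _ K]) (use a x V(2) ax far d(1) in \<open>force+\<close>)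
      next
        assume "P x"
        then show "P a" unfolding P_def
        proof (rule poly_approximable_pole_step[OF _ K])
          fix z assume "z \<in> K"
          then show "cmod (x - a) \<le> cmod (x - z) / 2"
            using far[of z] ax norm_triangle_ineq[of "a - x" "x - z"] by (simp add: norm_minus_commute)
        qed (use a x V(2) in auto)
      qed
    qed (use a d in auto)
  qed auto
  then show ?thesis using poly_approximable_far_pole[OF K B(2) v(2) B(1)] by (simp add: P_def)
qed

text \<open>Riemann sums converge uniformly in \<open>z\<close> by uniform continuity of the
  integrand, and each of them is a finite combination of approximable functions.\<close>

lemma poly_approximable_integral:
  fixes \<Psi> :: "real \<Rightarrow> complex \<Rightarrow> complex"
  assumes K: "compact K" and cont: "continuous_on ({0..1} \<times> K) (\<lambda>(x, z). \<Psi> x z)"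
    and approx: "\<And>x. x \<in> {0..1} \<Longrightarrow> poly_approximable K (\<Psi> x)"
  shows "poly_approximable K (\<lambda>z. integral {0..1} (\<lambda>x. \<Psi> x z))"
proof (rule poly_approximable_limit)
  fix \<epsilon> :: real assume e: "\<epsilon> > 0"
  have "uniformly_continuous_on ({0..1} \<times> K) (\<lambda>(x, z). \<Psi> x z)"
    by (intro compact_uniformly_continuous cont compact_Times K compact_Icc)
  then obtain d where d0: "d > 0" and d': "\<And>a b. \<lbrakk>a \<in> {0..1} \<times> K; b \<in> {0..1} \<times> K; dist b a < d\<rbrakk>
      \<Longrightarrow> dist (case b of (x, z) \<Rightarrow> \<Psi> x z) (case a of (x, z) \<Rightarrow> \<Psi> x z) < \<epsilon>/2"
    unfolding uniformly_continuous_on_def using e by (meson half_gt_zero)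
  have d: "d > 0" "\<And>x y z. \<lbrakk>x \<in> {0..1}; y \<in> {0..1}; z \<in> K; dist x y < d\<rbrakk> \<Longrightarrow> dist (\<Psi> x z) (\<Psi> y z) < \<epsilon>/2"
    using d0 d'[of "(y, z)" "(x, z)" for x y z] by (auto simp: dist_Pair_Pair)
  obtain n :: nat where n: "1 / d < n" using reals_Archimedean2 by blast
  have n0: "n > 0" using n d(1) by (cases n) (auto simp: field_simps dest: order.strict_trans)
  have nd: "1 / n < d" using n d(1) n0 by (simp add: field_simps)
  have cz: "continuous_on {0..1} (\<lambda>x. \<Psi> x z)" if "z \<in> K" for z
    using that by (intro continuous_on_compose2[OF cont, of _ "\<lambda>x. (x, z)", simplified] continuous_intros) auto
  \<comment> \<open>Left-endpoint sums: each subinterval has length \<open>1 / n < d\<close> and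
    contributes at most \<open>\<epsilon>/2 / n\<close> to the error.\<close>
  have step: "cmod (integral {0..m/n} (\<lambda>x. \<Psi> x z) - (\<Sum>k<m. of_real (1/n) * \<Psi> (real k / n) z)) \<le> m * (\<epsilon>/2 / n)"
    if z: "z \<in> K" and "m \<le> n" for z m
    using \<open>m \<le> n\<close>
  proof (induction m)
    case (Suc m)
    have sub: "{0..Suc m/n} \<subseteq> {0..1}" "{m/n..Suc m/n} \<subseteq> {0..1}" using Suc n0 by (auto simp: field_simps)
    have le: "m/n \<le> Suc m/n" using n0 by (auto simp: field_simps)
    have int: "(\<lambda>x. \<Psi> x z) integrable_on {0..Suc m/n}" "(\<lambda>x. \<Psi> x z) integrable_on {m/n..Suc m/n}"
      by (intro integrable_continuous_real continuous_on_subset[OF cz[OF z]] sub)+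
    have "integral {0..m/n} (\<lambda>x. \<Psi> x z) + integral {m/n..Suc m/n} (\<lambda>x. \<Psi> x z) = integral {0..Suc m/n} (\<lambda>x. \<Psi> x z)"
      using n0 le int by (intro Henstock_Kurzweil_Integration.integral_combine) auto
    moreover have bnd: "cmod (integral {m/n..Suc m/n} (\<lambda>x. \<Psi> x z - \<Psi> (m/n) z)) \<le> (\<epsilon>/2) * (Suc m/n - m/n)"
    proof (rule integral_bound)
      show "continuous_on {real m / real n..real (Suc m) / real n} (\<lambda>x. \<Psi> x z - \<Psi> (real m / real n) z)"
        using sub by (intro continuous_intros continuous_on_subset[OF cz[OF z]])
      fix t assume t: "t \<in> {real m / real n..real (Suc m) / real n}"
      then have "dist t (m/n) \<le> 1/n" by (auto simp: dist_real_def add_divide_distrib)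
      then show "cmod (\<Psi> t z - \<Psi> (real m / real n) z) \<le> \<epsilon> / 2"
      proof -
        have "t \<in> {0..1}" by (rule subsetD[OF sub(2) t])
        moreover have "m/n \<in> {0..1}" by (rule subsetD[OF sub(2)]) (use le in simp)
        moreover have "dist t (m/n) < d" using \<open>dist t (m/n) \<le> 1/n\<close> nd by linarith
        ultimately show ?thesis using d(2)[of t "m/n" z] z by (simp add: dist_norm)
      qed
    qed (use le in auto)
    moreover have "integral {m/n..Suc m/n} (\<lambda>x. \<Psi> x z - \<Psi> (m/n) z)
        = integral {m/n..Suc m/n} (\<lambda>x. \<Psi> x z) - of_real (1/n) * \<Psi> (m/n) z"
      using int(2) le by (subst Henstock_Kurzweil_Integration.integral_diff) (auto simp: add_divide_distrib scaleR_conv_of_real)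
    ultimately have eq: "integral {0..Suc m/n} (\<lambda>x. \<Psi> x z) - (\<Sum>k<Suc m. of_real (1/n) * \<Psi> (real k / n) z)
       = (integral {0..m/n} (\<lambda>x. \<Psi> x z) - (\<Sum>k<m. of_real (1/n) * \<Psi> (real k / n) z))
         + integral {m/n..Suc m/n} (\<lambda>x. \<Psi> x z - \<Psi> (m/n) z)"
      by (simp only: sum.lessThan_Suc) (metis (no_types, lifting) add_diff_add)
    have *: "cmod (integral {m/n..Suc m/n} (\<lambda>x. \<Psi> x z - \<Psi> (m/n) z)) \<le> \<epsilon>/2/n"
      using bnd by (simp add: add_divide_distrib)
    have "m \<le> n" using Suc.prems by simp
    have "cmod (integral {0..Suc m/n} (\<lambda>x. \<Psi> x z) - (\<Sum>k<Suc m. of_real (1/n) * \<Psi> (real k / n) z))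
      \<le> m * (\<epsilon>/2 / n) + \<epsilon>/2/n"
      unfolding eq by (rule norm_triangle_mono[OF Suc.IH[OF \<open>m \<le> n\<close>] *])
    then show ?case by (simp add: algebra_simps add_divide_distrib)
  qed simp
  show "\<exists>g. poly_approximable K g \<and> (\<forall>z\<in>K. cmod (integral {0..1} (\<lambda>x. \<Psi> x z) - g z) < \<epsilon>)"
  proof (intro exI[of _ "\<lambda>z. \<Sum>k<n. of_real (1/n) * \<Psi> (real k / n) z"] conjI ballI poly_approximable_sum
         poly_approximable_mult poly_approximable_const approx K)
    fix z assume z: "z \<in> K"
    show "cmod (integral {0..1} (\<lambda>x. \<Psi> x z) - (\<Sum>k<n. of_real (1/n) * \<Psi> (real k / n) z)) < \<epsilon>"
      using step[OF z order_refl] n0 e by simp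
  qed auto
qed

section \<open>Runge approximation on simply connected domains\<close>

lemma compact_subset_unit_ball:
  fixes S :: "complex set"
  assumes S: "compact S" "S \<subseteq> ball 0 1"
  obtains r where "0 < r" "r < 1" "S \<subseteq> cball 0 r"
proof (cases "S = {}")
  case True
  then show ?thesis using that[of "1/2"] by auto
next
  case False
  then obtain x where x: "x \<in> S" "\<And>y. y \<in> S \<Longrightarrow> norm y \<le> norm x"
    using continuous_attains_sup[OF S(1), of norm] by (auto intro: continuous_intros)
  then have "norm x < 1" using S(2) by auto
  then have "0 < (1 + cmod x) / 2" "(1 + cmod x) / 2 < 1"
    by (auto intro: add_pos_nonneg)
  moreover have "S \<subseteq> cball 0 ((1 + cmod x) / 2)"
    using x(2) \<open>norm x < 1\<close> by (fastforce simp: field_simps)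
  ultimately show ?thesis by (rule that)
qed

text \<open>The Riemann map \<open>g\<close> carries a circle in the disc to a curve around a
  compact \<open>M\<close> containing \<open>K\<close>, and Cauchy's formula writes \<open>h\<close>
  on \<open>M\<close> as an integral of kernels with poles on that curve. The complement of
  \<open>M\<close> is connected, so these poles can be pushed to infinity.\<close>

lemma runge_simply_connected:
  assumes D: "open D" "simply_connected D" "D \<noteq> {}" "D \<noteq> UNIV"
    and h: "h holomorphic_on D" and K: "compact K" "K \<subseteq> D"
  shows "poly_approximable K h"
proof -
  obtain f g where f: "f holomorphic_on D" and g: "g holomorphic_on ball 0 1"
    and fg: "\<And>z. z \<in> D \<Longrightarrow> f z \<in> ball 0 1 \<and> g (f z) = z"
    and gf: "\<And>z. z \<in> ball 0 1 \<Longrightarrow> g z \<in> D \<and> f (g z) = z"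
    using simply_connected_eq_biholomorphic_to_disc[OF D(1)] D(2-4) by metis
  have inj: "inj_on g (ball 0 1)" by (metis gf inj_onI)
  have contg: "continuous_on (ball 0 1) g" and contf: "continuous_on D f"
    using f g by (auto intro: holomorphic_on_imp_continuous_on)
  have "compact (f ` K)" using K contf continuous_on_subset compact_continuous_image by blast
  moreover have "f ` K \<subseteq> ball 0 1" using fg K by auto
  ultimately obtain r where r: "0 < r" "r < 1" "f ` K \<subseteq> cball 0 r"
    by (rule compact_subset_unit_ball)
  define \<rho> where "\<rho> = (1 + r) / 2"
  have \<rho>: "r < \<rho>" "\<rho> < 1" "0 < \<rho>" using r by (auto simp: \<rho>_def)
  define M where "M = g ` cball 0 r"
  have cb: "cball 0 r \<subseteq> (ball 0 1 :: complex set)" using r by auto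
  have cM: "compact M" unfolding M_def
    using cb contg by (intro compact_continuous_image continuous_on_subset[OF contg]) auto
  have KM: "K \<subseteq> M"
  proof
    fix z assume "z \<in> K"
    then have "z = g (f z)" "f z \<in> cball 0 r" using fg K r by auto
    then show "z \<in> M" unfolding M_def by blast
  qed
  have hom: "(cball 0 r :: complex set) homeomorphic M" unfolding M_def
    by (rule homeomorphic_compact[OF compact_cball continuous_on_subset[OF contg cb] refl inj_on_subset[OF inj cb]])
  \<comment> \<open>\<open>M\<close> is homeomorphic to a closed disc and hence does not separate
    the plane; its complement is therefore a single unbounded component.\<close>
  have "connected (- M)"
    by (rule connected_complement_homeomorphic_convex_compact[OF homeomorphic_sym[THEN iffD1, OF hom]]) auto
  then have outside: "outside M = - M"
    using cM cobounded_imp_unbounded[of "- M"] compact_imp_bounded[OF cM] outside_no_overlap[of M]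
    by (auto simp: outside connected_component_eq_self)
  define c where "c = circlepath 0 \<rho>"
  \<comment> \<open>The integrand of Cauchy's formula for \<open>h\<close> along the image curve
    \<open>g (c x)\<close>, written in the parameter of the circle \<open>c\<close>.\<close>
  define \<Psi> where "\<Psi> = (\<lambda>x z. 1 / (2 * of_real pi * \<i>) * (h (g (c x)) * deriv g (c x) * vector_derivative c (at x)) * (1 / (g (c x) - z)))"
  have c: "c x \<in> ball 0 1" "c x \<notin> cball 0 r" for x
    using \<rho> by (auto simp: c_def circlepath norm_mult)
  have gc: "g (c x) \<in> D" "g (c x) \<notin> M" for x
  proof -
    show "g (c x) \<in> D" using gf c(1) by blast
    show "g (c x) \<notin> M"
    proof
      assume "g (c x) \<in> M"
      then obtain \<xi> where "\<xi> \<in> cball 0 r" "g (c x) = g \<xi>" by (auto simp: M_def)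
      then show False using c[of x] cb inj_onD[OF inj, of "c x" \<xi>] by auto
    qed
  qed
  have contc: "continuous_on S c" for S
    unfolding c_def circlepath by (intro continuous_intros)
  have contgc: "continuous_on S (\<lambda>x. g (c x))" for S
    using c(1) by (intro continuous_on_compose2[OF contg contc]) auto
  have contdg: "continuous_on S (\<lambda>x. deriv g (c x))" for S
    using c(1) by (intro continuous_on_compose2[OF holomorphic_on_imp_continuous_on[OF holomorphic_deriv[OF g]] contc]) auto
  have conth: "continuous_on S (\<lambda>x. h (g (c x)))" for S
    using gc(1) by (intro continuous_on_compose2[OF holomorphic_on_imp_continuous_on[OF h] contgc]) auto
  have contv: "continuous_on S (\<lambda>x. vector_derivative c (at x))" for S
    unfolding c_def vector_derivative_circlepath by (intro continuous_intros)
  have "continuous_on ({0..1} \<times> M) (\<lambda>p. \<Psi> (fst p) (snd p))"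
    unfolding \<Psi>_def
    using gc(2)
    by (intro continuous_intros continuous_on_compose2[OF conth continuous_on_fst[OF continuous_on_id]]
          continuous_on_compose2[OF contgc continuous_on_fst[OF continuous_on_id]]
          continuous_on_compose2[OF contdg continuous_on_fst[OF continuous_on_id]]
          continuous_on_compose2[OF contv continuous_on_fst[OF continuous_on_id]]) auto
  then have contPsi: "continuous_on ({0..1} \<times> M) (\<lambda>(x, z). \<Psi> x z)"
    by (simp add: case_prod_unfold)
  have "poly_approximable M (\<lambda>z. integral {0..1} (\<lambda>x. \<Psi> x z))"
  proof (rule poly_approximable_integral[OF cM contPsi])
    fix x :: real
    show "poly_approximable M (\<Psi> x)"
      unfolding \<Psi>_def using gc(2)[of x] outside
      by (intro poly_approximable_mult poly_approximable_const poly_approximable_pole cM) auto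
  qed
  moreover have "integral {0..1} (\<lambda>x. \<Psi> x z) = h z" if z: "z \<in> M" for z
  proof -
    obtain \<omega> where \<omega>: "\<omega> \<in> cball 0 r" "z = g \<omega>" using z by (auto simp: M_def)
    then have \<omega>1: "\<omega> \<in> ball 0 1" and \<omega>\<rho>: "\<omega> \<in> ball 0 \<rho>" using cb \<rho> by auto
    \<comment> \<open>As \<open>g \<xi> - g \<omega> = (\<xi> - \<omega>) * G \<xi>\<close> with
      \<open>G\<close> zero-free, the integrand becomes a holomorphic function divided by
      \<open>\<xi> - \<omega>\<close>, and Cauchy's formula in the disc applies. At
      \<open>\<omega>\<close> the factors \<open>deriv g \<omega>\<close> and
      \<open>G \<omega>\<close> cancel.\<close>
    define G where "G = (\<lambda>\<xi>. if \<xi> = \<omega> then deriv g \<omega> else (g \<xi> - g \<omega>) / (\<xi> - \<omega>))"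
    have "G holomorphic_on ball 0 1"
      unfolding G_def by (rule pole_lemma_open[OF g open_ball])
    moreover have dg: "deriv g \<omega> \<noteq> 0"
      using holomorphic_injective_imp_regular[OF g open_ball inj \<omega>1] .
    then have G0: "G \<xi> \<noteq> 0" if "\<xi> \<in> ball 0 1" for \<xi>
      using inj_onD[OF inj _ that \<omega>1] by (auto simp: G_def)
    moreover have "(\<lambda>\<xi>. h (g \<xi>)) holomorphic_on ball 0 1"
      using holomorphic_on_compose_gen[OF g h] gf by (auto simp: o_def image_subset_iff)
    ultimately have F: "(\<lambda>\<xi>. h (g \<xi>) * deriv g \<xi> / G \<xi>) holomorphic_on ball 0 1"
      using g by (intro holomorphic_intros holomorphic_deriv) auto
    have "cball 0 \<rho> \<subseteq> (ball 0 1 :: complex set)" using \<rho> by auto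
    then have "((\<lambda>u. (h (g u) * deriv g u / G u) / (u - \<omega>)) has_contour_integral
        2 * of_real pi * \<i> * (h (g \<omega>) * deriv g \<omega> / G \<omega>)) c"
      unfolding c_def using \<omega>\<rho>
      by (intro Cauchy_integral_circlepath holomorphic_on_imp_continuous_on holomorphic_on_subset[OF F])
         (auto simp: dist_norm)
    then have "((\<lambda>x. ((h (g (c x)) * deriv g (c x) / G (c x)) / (c x - \<omega>)) * vector_derivative c (at x)) has_integral
        2 * of_real pi * \<i> * h z) {0..1}"
      using dg by (simp add: has_contour_integral G_def \<omega>(2))
    then have "((\<lambda>x. 1 / (2 * of_real pi * \<i>) * (((h (g (c x)) * deriv g (c x) / G (c x)) / (c x - \<omega>)) * vector_derivative c (at x))) has_integral
        1 / (2 * of_real pi * \<i>) * (2 * of_real pi * \<i> * h z)) {0..1}"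
      by (rule has_integral_mult_right)
    moreover have "1 / (2 * of_real pi * \<i>) * (((h (g (c x)) * deriv g (c x) / G (c x)) / (c x - \<omega>)) * vector_derivative c (at x)) = \<Psi> x z" for x
    proof -
      have "c x \<noteq> \<omega>" using c(2)[of x] \<omega>(1) by auto
      then show ?thesis by (simp add: \<Psi>_def G_def \<omega>(2))
    qed
    ultimately show ?thesis by (simp add: integral_unique)
  qed
  ultimately have "poly_approximable M h" by (simp cong: poly_approximable_cong)
  then show ?thesis using KM by (rule poly_approximable_subset)
qed

section \<open>Balayage onto the frontier of an exterior domain\<close>

lemma sum_list_norm_le:
  fixes B :: real
  assumes "\<And>x. x \<in> set xs \<Longrightarrow> norm (f x) \<le> B"
  shows "norm (\<Sum>x\<leftarrow>xs. f x) \<le> real (length xs) * B"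
  using assms
proof (induction xs)
  case (Cons a xs)
  then have "norm (f a + (\<Sum>x\<leftarrow>xs. f x)) \<le> B + real (length xs) * B"
    by (intro norm_triangle_mono) auto
  then show ?case by (simp add: algebra_simps)
qed simp

lemma cauchy_kernel_diff_le:
  fixes x z z' :: complex
  assumes "d > 0" "cmod (x - z) \<ge> d" "cmod (x' - z') \<ge> d"
  shows "cmod (1 / (x - z) - 1 / (x' - z')) \<le> (cmod (x - x') + cmod (z - z')) / d\<^sup>2"
proof -
  have ne: "x - z \<noteq> 0" "x' - z' \<noteq> 0" using assms by auto
  then have "1 / (x - z) - 1 / (x' - z') = ((z - z') - (x - x')) / ((x - z) * (x' - z'))"
    by (simp add: field_simps)
  then have "cmod (1 / (x - z) - 1 / (x' - z')) = cmod ((z - z') - (x - x')) / (cmod (x - z) * cmod (x' - z'))"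
    by (simp add: norm_divide norm_mult)
  also have "\<dots> \<le> (cmod (x - x') + cmod (z - z')) / (d * d)"
    using assms norm_triangle_ineq4[of "z - z'" "x - x'"] by (intro frac_le mult_mono) auto
  finally show ?thesis by (simp add: power2_eq_square)
qed

text \<open>\<open>U\<close> is a neighbourhood of infinity whose frontier lies in the set
  \<open>E\<close> of admissible poles. Under inversion about \<open>c\<close>, the radius
  \<open>R\<close> gives the image of infinity a neighbourhood inside the new domain, and
  \<open>\<rho>\<close> makes that domain bounded.\<close>

locale exterior_domain =
  fixes U E :: "complex set" and c :: complex and R \<rho> :: real
  assumes open_U: "open U" and frontier_U: "frontier U \<subseteq> E" and compact_E: "compact E" and E_ne: "E \<noteq> {}"
    and R: "R > 0" "\<And>x. cmod (x - c) > R \<Longrightarrow> x \<in> U"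
    and \<rho>: "\<rho> > 0" "ball c \<rho> \<inter> (U \<union> E) = {}"
begin

text \<open>The inversion \<open>w = 1 / (x - c)\<close> turns \<open>U\<close> with the point at infinity into a bounded open set.\<close>

lemma inversion_domain:
  defines "W \<equiv> {w. w = 0 \<or> c + 1 / w \<in> U}"
  shows "open W" "bounded W" "ball 0 (1 / R) \<subseteq> W"
    "\<And>w. w \<in> frontier W \<Longrightarrow> w \<noteq> 0 \<and> c + 1 / w \<in> E"
proof -
  have cont: "continuous_on (- {0}) (\<lambda>w. c + 1 / w)"
    by (intro continuous_intros) auto
  have pre: "open ((- {0}) \<inter> (\<lambda>w. c + 1 / w) -` V)" if "open V" for V
    by (rule continuous_open_preimage[OF cont _ that]) auto
  show ball: "ball 0 (1 / R) \<subseteq> W"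
  proof
    fix w :: complex assume w: "w \<in> ball 0 (1 / R)"
    show "w \<in> W"
    proof (cases "w = 0")
      case False
      then have "R < 1 / cmod w" using w R(1) by (simp add: field_simps)
      then have "c + 1 / w \<in> U" by (intro R(2)) (simp add: norm_divide)
      then show ?thesis by (simp add: W_def)
    qed (simp add: W_def)
  qed
  have "W = ((- {0}) \<inter> (\<lambda>w. c + 1 / w) -` U) \<union> ball 0 (1 / R)"
    using ball R(1) by (auto simp: W_def)
  then show "open W" using pre[OF open_U] by (metis open_Un open_ball)
  show "bounded W"
    unfolding bounded_iff
  proof (intro exI[of _ "1 / \<rho>"] ballI)
    fix w assume "w \<in> W"
    show "cmod w \<le> 1 / \<rho>"
    proof (cases "w = 0")
      case False
      then have "c + 1 / w \<notin> ball c \<rho>" using \<open>w \<in> W\<close> \<rho>(2) by (auto simp: W_def)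
      then have "1 / cmod w \<ge> \<rho>" by (simp add: dist_norm norm_divide not_less)
      then show ?thesis using False \<rho>(1) by (simp add: field_simps)
    qed (use \<rho> in auto)
  qed
  fix w assume w: "w \<in> frontier W"
  have nW: "w \<notin> W" using w \<open>open W\<close> by (simp add: frontier_def interior_open)
  then have w0: "w \<noteq> 0" by (auto simp: W_def)
  have "c + 1 / w \<in> closure U"
  proof (rule ccontr)
    assume "c + 1 / w \<notin> closure U"
    define N where "N = (- {0}) \<inter> (\<lambda>w. c + 1 / w) -` (- closure U)"
    have "open N" unfolding N_def by (rule pre) auto
    moreover have "w \<in> N" using w0 \<open>c + 1 / w \<notin> closure U\<close> by (simp add: N_def)
    moreover have "w \<in> closure W" using w by (simp add: frontier_def)
    ultimately obtain v where "v \<in> N" "v \<in> W" using open_Int_closure_eq_empty[of N W] by auto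
    then show False using closure_subset[of U] by (auto simp: N_def W_def)
  qed
  moreover have "c + 1 / w \<notin> U" using nW by (simp add: W_def)
  ultimately have "c + 1 / w \<in> frontier U" using open_U by (simp add: frontier_def interior_open)
  then show "w \<noteq> 0 \<and> c + 1 / w \<in> E" using frontier_U w0 by auto
qed

section \<open>Pole sums on the exterior domain\<close>

context
  fixes I :: "'i set" and r z :: "'i \<Rightarrow> complex"
  assumes I: "finite I" and z: "\<And>i. i \<in> I \<Longrightarrow> z i \<notin> U \<union> E"
begin

text \<open>The functional that takes \<open>h\<close> to
  \<open>\<Sum>i\<in>I. r i * h (z i)\<close>, applied to the kernel with pole \<open>x\<close>.
  Bounds on it are the dual form of approximation by kernels at the points
  \<open>z i\<close>.\<close>

abbreviation "pole_sum x \<equiv> (\<Sum>i\<in>I. r i / (x - z i))"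

lemma pole_sum_inverted:
  assumes "w \<noteq> 0"
  shows "(\<Sum>i\<in>I. r i * w / (1 - (z i - c) * w)) = pole_sum (c + 1 / w)"
proof (rule sum.cong)
  fix i
  have "c + 1 / w - z i = (1 - (z i - c) * w) / w" using assms by (simp add: field_simps)
  then show "r i * w / (1 - (z i - c) * w) = r i / (c + 1 / w - z i)" by simp
qed simp

text \<open>In the inverted coordinate the pole sum is holomorphic up to the frontier and vanishes
  at \<open>0\<close>, the image of infinity. The maximum modulus principle for
  \<open>exp (- v)\<close> is the minimum principle for \<open>Re v\<close>; at \<open>0\<close> it
  yields \<open>a \<le> 0\<close>.\<close>

lemma pole_sum_min_principle:
  assumes a: "\<And>x. x \<in> E \<Longrightarrow> a \<le> Re (pole_sum x)"
  shows "a \<le> 0" and "\<And>x. x \<in> U \<Longrightarrow> a \<le> Re (pole_sum x)"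
proof -
  define W where "W = {w. w = 0 \<or> c + 1 / w \<in> U}"
  note W = inversion_domain[folded W_def]
  define v where "v = (\<lambda>w. \<Sum>i\<in>I. r i * w / (1 - (z i - c) * w))"
  have den: "1 - (z i - c) * w \<noteq> 0" if "w \<in> closure W" "i \<in> I" for w i
  proof
    assume eq: "1 - (z i - c) * w = 0"
    then have "w \<noteq> 0" by auto
    then have "z i = c + 1 / w" using eq by (simp add: field_simps)
    moreover have "c + 1 / w \<in> U \<union> E"
      using that(1) W(4)[of w] \<open>w \<noteq> 0\<close> by (auto simp: closure_Un_frontier W_def)
    ultimately show False using z[OF that(2)] by simp
  qed
  have hol: "v holomorphic_on closure W" unfolding v_def
    by (intro holomorphic_intros) (use den in auto)
  have bound: "a \<le> Re (v w)" if "w \<in> W" for w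
  proof -
    have "cmod (exp (- v w)) \<le> exp (- a)"
    proof (rule maximum_modulus_frontier[of "\<lambda>w. exp (- v w)" W "exp (- a)" w])
      show "(\<lambda>w. exp (- v w)) holomorphic_on interior W"
        using closure_subset interior_subset
        by (intro holomorphic_intros holomorphic_on_subset[OF hol]) blast
      show "continuous_on (closure W) (\<lambda>w. exp (- v w))"
        by (intro continuous_intros holomorphic_on_imp_continuous_on hol)
      fix w assume "w \<in> frontier W"
      then show "cmod (exp (- v w)) \<le> exp (- a)"
        using W(4)[of w] a[of "c + 1 / w"] pole_sum_inverted[of w] by (simp add: v_def)
    qed (use W(2) that in auto)
    then show ?thesis by simp
  qed
  show "a \<le> 0" using bound[of 0] by (simp add: W_def v_def)
  fix x assume x: "x \<in> U"
  then have "x \<noteq> c" using \<rho> centre_in_ball[of c \<rho>] by blast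
  then have "v (1 / (x - c)) = pole_sum x" "1 / (x - c) \<in> W"
    using pole_sum_inverted[of "1 / (x - c)"] x by (auto simp: v_def W_def)
  then show "a \<le> Re (pole_sum x)" using bound[of "1 / (x - c)"] by simp
qed

text \<open>Schwarz's lemma applied to \<open>v / (v + 3\<mu>)\<close>, where \<open>v\<close> is the pole sum in the inverted coordinate.\<close>

lemma pole_sum_bound:
  assumes \<mu>: "\<mu> > 0" "\<And>x. x \<in> E \<Longrightarrow> - \<mu> \<le> Re (pole_sum x)" and x: "cmod (x - c) = 3 * R"
  shows "cmod (pole_sum x) \<le> 2 * \<mu>"
proof -
  define v where "v = (\<lambda>w. \<Sum>i\<in>I. r i * w / (1 - (z i - c) * w))"
  have zR: "cmod (z i - c) \<le> R" if "i \<in> I" for i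
    using z[OF that] R(2)[of "z i"] by force
  have den: "1 - (z i - c) * (\<omega> / R) \<noteq> 0" if "cmod \<omega> < 1" "i \<in> I" for \<omega> :: complex and i
  proof
    assume "1 - (z i - c) * (\<omega> / R) = 0"
    then have "cmod ((z i - c) * (\<omega> / R)) = 1" by simp
    then have "cmod (z i - c) * cmod \<omega> = R" using R(1) unfolding norm_mult norm_divide by (simp add: field_simps)
    moreover have "cmod (z i - c) * cmod \<omega> \<le> R * cmod \<omega>" using zR[OF that(2)] by (intro mult_right_mono) auto
    moreover have "R * cmod \<omega> < R" using R(1) that(1) by simp
    ultimately show False by simp
  qed
  have Re: "- \<mu> \<le> Re (v (\<omega> / R))" if "cmod \<omega> < 1" for \<omega> :: complex
  proof (cases "\<omega> = 0")
    case False
    have "R < cmod (1 / (\<omega> / R))" using that False R(1) by (simp add: norm_divide field_simps)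
    then have "c + 1 / (\<omega> / R) \<in> U" by (intro R(2)) simp
    then have "- \<mu> \<le> Re (pole_sum (c + 1 / (\<omega> / R)))"
      using pole_sum_min_principle(2)[of "- \<mu>"] \<mu>(2) by blast
    then show ?thesis using pole_sum_inverted[of "\<omega> / R"] False R(1) by (simp add: v_def)
  qed (use \<mu> in \<open>simp add: v_def\<close>)
  \<comment> \<open>From \<open>Re v \<ge> - \<mu>\<close> it follows that \<open>v\<close> is
    closer to \<open>0\<close> than to \<open>- 3 * \<mu>\<close>, so \<open>s\<close> maps the unit
    disc into itself and fixes \<open>0\<close>.\<close>
  define s where "s = (\<lambda>\<omega>::complex. v (\<omega> / R) / (v (\<omega> / R) + 3 * \<mu>))"
  have ne: "v (\<omega> / R) + 3 * \<mu> \<noteq> 0" if "cmod \<omega> < 1" for \<omega> :: complex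
    using Re[OF that] \<mu>(1) by (auto simp: complex_eq_iff)
  have "s holomorphic_on ball 0 1" unfolding s_def
    using ne den R(1) unfolding v_def by (intro holomorphic_intros) auto
  moreover have "s 0 = 0" by (simp add: s_def v_def)
  moreover have "cmod (s \<omega>) < 1" if "cmod \<omega> < 1" for \<omega> :: complex
  proof -
    have "(cmod (v (\<omega> / R)))\<^sup>2 < (cmod (v (\<omega> / R) + 3 * \<mu>))\<^sup>2"
      using Re[OF that] \<mu>(1) mult_pos_pos[of \<mu> "2 * Re (v (\<omega> / R)) + 3 * \<mu>"] unfolding cmod_power2 by (simp add: power2_eq_square algebra_simps)
    then have "cmod (v (\<omega> / R)) < cmod (v (\<omega> / R) + 3 * \<mu>)"
      by (rule power_less_imp_less_base) simp
    then show ?thesis by (simp add: s_def norm_divide divide_simps)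
  qed
  ultimately have schwarz: "cmod (s \<omega>) \<le> cmod \<omega>" if "cmod \<omega> < 1" for \<omega> :: complex
    using Schwarz_Lemma(1) that by blast
  \<comment> \<open>Distance \<open>3 * R\<close> from \<open>c\<close> corresponds to modulus
    \<open>1/3\<close>, so Schwarz's lemma gives
    \<open>3 * cmod v \<le> cmod (v + 3 * \<mu>)\<close>, which bounds \<open>cmod v\<close> by
    \<open>3 * \<mu> / 2\<close>.\<close>
  define \<omega> where "\<omega> = R / (x - c)"
  have xc: "x - c \<noteq> 0" using x R(1) by auto
  have \<omega>: "cmod \<omega> = 1 / 3" using x R(1) by (simp add: \<omega>_def norm_divide)
  have vx: "v (\<omega> / R) = pole_sum x"
    using pole_sum_inverted[of "\<omega> / R"] xc R(1) by (simp add: \<omega>_def v_def)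
  have "cmod (v (\<omega> / R)) / cmod (v (\<omega> / R) + 3 * \<mu>) \<le> 1 / 3"
    using schwarz[of \<omega>] \<omega> by (simp add: s_def norm_divide)
  then have "3 * cmod (v (\<omega> / R)) \<le> cmod (v (\<omega> / R) + 3 * \<mu>)"
    using ne[of \<omega>] \<omega> by (simp add: divide_simps)
  also have "\<dots> \<le> cmod (v (\<omega> / R)) + 3 * \<mu>"
    using norm_triangle_ineq[of "v (\<omega> / R)" "3 * \<mu>"] \<mu>(1) by (simp add: norm_mult)
  finally show ?thesis using vx \<mu>(1) by simp
qed

text \<open>Cauchy's formula on the circle of radius \<open>3 * R\<close> expresses the values of
  \<open>q\<close> at the points \<open>z i\<close> through the pole sum, which is at most
  \<open>2 * \<mu>\<close> there. The constant is \<open>A * 2\<close> times the circumference over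
  \<open>2 * pi\<close>.\<close>

lemma weighted_values_bound:
  assumes \<mu>: "\<mu> > 0" "\<And>x. x \<in> E \<Longrightarrow> - \<mu> \<le> Re (pole_sum x)"
    and A: "\<And>x. cmod (x - c) = 3 * R \<Longrightarrow> cmod (poly q x) \<le> A"
  shows "cmod (\<Sum>i\<in>I. r i * poly q (z i)) \<le> 6 * R * A * \<mu>"
proof -
  have zR: "cmod (z i - c) < 3 * R" if "i \<in> I" for i
    using z[OF that] R(1) R(2)[of "z i"] by force
  have "cmod (poly q (c + 3 * R)) \<le> A" using R(1) by (intro A) simp
  then have A0: "A \<ge> 0" using norm_ge_zero order_trans by blast
  have "((\<lambda>w. \<Sum>i\<in>I. r i * (poly q w / (w - z i))) has_contour_integral
      (\<Sum>i\<in>I. r i * (2 * of_real pi * \<i> * poly q (z i)))) (circlepath c (3 * R))"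
    using zR by (intro has_contour_integral_sum I has_contour_integral_lmul Cauchy_integral_circlepath_simple
        holomorphic_intros) (auto simp: dist_norm norm_minus_commute)
  then have "cmod (\<Sum>i\<in>I. r i * (2 * of_real pi * \<i> * poly q (z i))) \<le> (A * (2 * \<mu>)) * (2 * pi * (3 * R))"
  proof (rule has_contour_integral_bound_circlepath)
    fix x assume x: "cmod (x - c) = 3 * R"
    have "(\<Sum>i\<in>I. r i * (poly q x / (x - z i))) = poly q x * pole_sum x"
      by (simp add: sum_distrib_left algebra_simps)
    then show "cmod (\<Sum>i\<in>I. r i * (poly q x / (x - z i))) \<le> A * (2 * \<mu>)"
      unfolding norm_mult using A[OF x] pole_sum_bound[OF \<mu> x] A0
      by (simp add: norm_mult mult_mono)
  qed (use A0 \<mu> R in auto)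
  moreover have "(\<Sum>i\<in>I. r i * (2 * of_real pi * \<i> * poly q (z i))) = 2 * of_real pi * \<i> * (\<Sum>i\<in>I. r i * poly q (z i))"
    by (simp add: sum_distrib_left algebra_simps)
  ultimately have "2 * pi * cmod (\<Sum>i\<in>I. r i * poly q (z i)) \<le> 2 * pi * (6 * R * A * \<mu>)"
    by (simp add: norm_mult algebra_simps)
  then show ?thesis by (simp add: mult_ac)
qed

end

text \<open>Otherwise the pole sum with coefficients \<open>cnj (d i)\<close> has real part above
  \<open>y\<close> on all of \<open>E\<close>. The minimum principle makes \<open>y\<close>
  negative, and \<open>weighted_values_bound\<close> with \<open>\<mu> = - y\<close> gives
  \<open>M * (- y) \<le> 6 * R * A * (- y)\<close>, against the choice of \<open>M\<close>.\<close>

lemma descent_direction: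
  assumes I: "finite I" and z: "\<And>i. i \<in> I \<Longrightarrow> z i \<notin> U \<union> E"
    and A: "\<And>x. cmod (x - c) = 3 * R \<Longrightarrow> cmod (poly q x) \<le> A"
    and M: "M > 6 * R * A" "M > 0"
  shows "\<exists>x\<in>E. Re (\<Sum>i\<in>I. cnj (d i) * (1 / (x - z i) - poly q (z i) / M)) \<le> 0"
proof (rule ccontr)
  assume neg: "\<not> ?thesis"
  define r where "r = (\<lambda>i. cnj (d i))"
  define y where "y = Re (\<Sum>i\<in>I. r i * poly q (z i)) / M"
  have split: "Re (\<Sum>i\<in>I. cnj (d i) * (1 / (x - z i) - poly q (z i) / M)) = Re (\<Sum>i\<in>I. r i / (x - z i)) - y" for x
  proof -
    have "(\<Sum>i\<in>I. cnj (d i) * (1 / (x - z i) - poly q (z i) / M))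
        = (\<Sum>i\<in>I. r i / (x - z i)) - (\<Sum>i\<in>I. r i * poly q (z i)) / M"
      by (simp add: r_def right_diff_distrib sum_subtractf sum_divide_distrib)
    then show ?thesis by (simp add: y_def)
  qed
  have gt: "Re (\<Sum>i\<in>I. r i / (x - z i)) > y" if "x \<in> E" for x
    using neg that split by (auto simp: not_le)
  have "continuous_on E (\<lambda>x. Re (\<Sum>i\<in>I. r i / (x - z i)))"
    by (intro continuous_intros) (use z in auto)
  then obtain x0 where x0: "x0 \<in> E"
    "\<And>x. x \<in> E \<Longrightarrow> Re (\<Sum>i\<in>I. r i / (x0 - z i)) \<le> Re (\<Sum>i\<in>I. r i / (x - z i))"
    using continuous_attains_inf[OF compact_E E_ne] by blast
  have "Re (\<Sum>i\<in>I. r i / (x0 - z i)) \<le> 0"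
    using pole_sum_min_principle(1)[OF I z x0(2)] by simp
  then have y0: "y < 0" using gt[OF x0(1)] by simp
  have "cmod (\<Sum>i\<in>I. r i * poly q (z i)) \<le> 6 * R * A * (- y)"
    using y0 gt by (intro weighted_values_bound I z A) (auto intro: less_imp_le)
  then have "- (y * M) \<le> 6 * R * A * (- y)"
    using abs_Re_le_cmod[of "\<Sum>i\<in>I. r i * poly q (z i)"] M(2) unfolding y_def by simp
  then show False using mult_strict_right_mono[OF M(1), of "- y"] y0 by (simp add: algebra_simps)
qed

text \<open>Each new pole is chosen so that the cross term in the squared error is not positive. The
  squared error then grows at most linearly in \<open>n\<close>, so the error of the average is of
  order \<open>1 / sqrt n\<close>.\<close>

lemma greedy_kernel_sums:
  fixes b M :: real and q :: "complex poly"
  assumes I: "finite I" and z: "\<And>i. i \<in> I \<Longrightarrow> z i \<notin> U \<union> E"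
    and A: "\<And>x. cmod (x - c) = 3 * R \<Longrightarrow> cmod (poly q x) \<le> A"
    and M: "M > 6 * R * A" "M > 0"
    and b: "\<And>x i. x \<in> E \<Longrightarrow> i \<in> I \<Longrightarrow> cmod (1 / (x - z i) - poly q (z i) / M) \<le> b"
  shows "\<exists>xs. length xs = n \<and> set xs \<subseteq> E \<and>
     (\<Sum>i\<in>I. (cmod ((\<Sum>x\<leftarrow>xs. 1 / (x - z i)) - n * (poly q (z i) / M)))\<^sup>2) \<le> real n * (real (card I) * b\<^sup>2)"
proof (induction n)
  case (Suc n)
  then obtain xs where xs: "length xs = n" "set xs \<subseteq> E"
    "(\<Sum>i\<in>I. (cmod ((\<Sum>x\<leftarrow>xs. 1 / (x - z i)) - n * (poly q (z i) / M)))\<^sup>2) \<le> real n * (real (card I) * b\<^sup>2)"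
    by blast
  define d where "d = (\<lambda>i. (\<Sum>x\<leftarrow>xs. 1 / (x - z i)) - n * (poly q (z i) / M))"
  obtain x where x: "x \<in> E" "Re (\<Sum>i\<in>I. cnj (d i) * (1 / (x - z i) - poly q (z i) / M)) \<le> 0"
    using descent_direction[of I z q A M d] I z A M by blast
  define e where "e = (\<lambda>i. 1 / (x - z i) - poly q (z i) / M)"
  have sq: "(cmod (d i + e i))\<^sup>2 = (cmod (d i))\<^sup>2 + 2 * Re (cnj (d i) * e i) + (cmod (e i))\<^sup>2" for i
    unfolding cmod_power2 by (simp add: power2_eq_square algebra_simps)
  have "(\<Sum>i\<in>I. (cmod ((\<Sum>x\<leftarrow>x # xs. 1 / (x - z i)) - Suc n * (poly q (z i) / M)))\<^sup>2) = (\<Sum>i\<in>I. (cmod (d i + e i))\<^sup>2)"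
  proof (rule sum.cong)
    fix i
    have "(a + s) - (1 + k) * y = (s - k * y) + (a - y)" for a s k y :: complex
      by (simp add: algebra_simps)
    from this[of "1 / (x - z i)" "\<Sum>x\<leftarrow>xs. 1 / (x - z i)" "of_nat n" "poly q (z i) / M"]
    show "(cmod ((\<Sum>x\<leftarrow>x # xs. 1 / (x - z i)) - Suc n * (poly q (z i) / M)))\<^sup>2 = (cmod (d i + e i))\<^sup>2"
      by (simp only: d_def e_def list.map sum_list.Cons of_nat_Suc)
  qed simp
  also have "\<dots> = (\<Sum>i\<in>I. (cmod (d i))\<^sup>2) + 2 * Re (\<Sum>i\<in>I. cnj (d i) * e i) + (\<Sum>i\<in>I. (cmod (e i))\<^sup>2)"
    unfolding sq by (simp only: sum.distrib Re_sum sum_distrib_left)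
  also have "\<dots> \<le> real n * (real (card I) * b\<^sup>2) + 2 * 0 + (\<Sum>i\<in>I. b\<^sup>2)"
    using xs(3) x b by (intro add_mono mult_left_mono sum_mono power_mono) (auto simp: d_def e_def)
  finally show ?case using xs x(1) by (intro exI[of _ "x # xs"]) (auto simp: algebra_simps)
qed simp

text \<open>The threshold \<open>M0\<close> depends on \<open>q\<close> but neither on
  \<open>K\<close> nor on \<open>\<epsilon>\<close>, and every larger \<open>M\<close> will do; this
  leaves room to take the total weight integral.\<close>

lemma weighted_kernel_approx:
  fixes q :: "complex poly"
  obtains M0 where "M0 > 0"
    "\<And>M K \<epsilon>. \<lbrakk>M \<ge> M0; compact K; K \<inter> (U \<union> E) = {}; \<epsilon> > 0\<rbrakk> \<Longrightarrow>
      \<exists>xs. xs \<noteq> [] \<and> set xs \<subseteq> E \<and>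
        (\<forall>z\<in>K. cmod (M / length xs * (\<Sum>x\<leftarrow>xs. 1 / (x - z)) - poly q z) < \<epsilon>)"
proof -
  have "compact (poly q ` sphere c (3 * R))"
    by (intro compact_continuous_image continuous_intros) auto
  then obtain A where A0: "A > 0" "\<forall>y\<in>poly q ` sphere c (3 * R). cmod y \<le> A"
    by (metis bounded_pos compact_imp_bounded)
  have A: "A > 0" "\<And>x. cmod (x - c) = 3 * R \<Longrightarrow> cmod (poly q x) \<le> A"
    using A0 by (auto simp: dist_norm norm_minus_commute)
  show ?thesis
  proof (rule that[of "6 * R * A + 1"])
    show "6 * R * A + 1 > 0" using A R by (simp add: add_pos_pos)
    fix M :: real and K and \<epsilon> :: real
    assume M: "M \<ge> 6 * R * A + 1" and K: "compact K" "K \<inter> (U \<union> E) = {}" and e: "\<epsilon> > 0"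
    have "0 \<le> 6 * R * A" using A(1) R(1) by simp
    then have M': "M > 6 * R * A" "M > 0" using M by linarith+
    obtain \<delta> where \<delta>: "\<delta> > 0" "\<And>x z. x \<in> E \<Longrightarrow> z \<in> K \<Longrightarrow> cmod (x - z) \<ge> \<delta>"
    proof -
      have "E \<inter> K = {}" using K(2) by blast
      from separate_compact_closed[OF compact_E compact_imp_closed[OF K(1)] this] show ?thesis
        using that unfolding dist_norm by blast
    qed
    have uc: "uniformly_continuous_on K (poly q)"
      by (intro compact_uniformly_continuous continuous_intros K)
    obtain \<tau>0 where \<tau>0: "\<tau>0 > 0" "\<And>z z'. \<lbrakk>z \<in> K; z' \<in> K; dist z' z < \<tau>0\<rbrakk> \<Longrightarrow> dist (poly q z') (poly q z) < \<epsilon>/3"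
      using e by (auto intro: uniformly_continuous_onE[OF uc, of "\<epsilon>/3"])
    \<comment> \<open>Passing to a net point within \<open>\<tau>\<close> changes each kernel by at
      most \<open>\<epsilon> / (3 * M)\<close>, hence the weighted sum by at most
      \<open>\<epsilon>/3\<close>, and \<open>q\<close> by less than
      \<open>\<epsilon>/3\<close>.\<close>
    define \<tau> where "\<tau> = min \<tau>0 (\<epsilon> / (3 * M) * \<delta>\<^sup>2)"
    have \<tau>: "\<tau> > 0" "\<tau> \<le> \<tau>0" "\<tau> / \<delta>\<^sup>2 \<le> \<epsilon> / (3 * M)"
    proof -
      have "0 < \<epsilon> / (3 * M) * \<delta>\<^sup>2" using e M'(2) \<delta>(1) by simp
      then show "\<tau> > 0" using \<tau>0(1) by (simp add: \<tau>_def)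
      show "\<tau> \<le> \<tau>0" by (simp add: \<tau>_def)
      have "\<tau> \<le> \<epsilon> / (3 * M) * \<delta>\<^sup>2" by (simp add: \<tau>_def)
      moreover have "0 < \<delta>\<^sup>2" using \<delta>(1) by simp
      ultimately show "\<tau> / \<delta>\<^sup>2 \<le> \<epsilon> / (3 * M)" by (simp only: pos_divide_le_eq)
    qed
    obtain T where T: "finite T" "T \<subseteq> K" "K \<subseteq> (\<Union>t\<in>T. ball t \<tau>)"
      using compact_finite_net[OF K(1) \<tau>(1)] .
    have "bounded ((\<lambda>z. poly q z / M) ` K)"
      by (intro compact_imp_bounded compact_continuous_image continuous_intros K) (use M' in auto)
    then obtain b0 where b0: "\<And>z. z \<in> K \<Longrightarrow> cmod (poly q z / M) \<le> b0" by (auto simp: bounded_iff)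
    define b where "b = 1 / \<delta> + b0"
    have b: "cmod (1 / (x - t) - poly q t / M) \<le> b" if "x \<in> E" "t \<in> T" for x t
    proof -
      have "cmod (1 / (x - t)) \<le> 1 / \<delta>"
        unfolding norm_divide using \<delta>(1) \<delta>(2)[of x t] that T(2) by (intro frac_le) auto
      then show ?thesis unfolding b_def
        using b0[of t] that T(2) norm_triangle_ineq4[of "1 / (x - t)" "poly q t / M"] \<open>cmod (1 / (x - t)) \<le> 1 / \<delta>\<close>
        by (meson add_mono order_trans subsetD)
    qed
    define \<sigma> where "\<sigma> = \<epsilon> / (3 * M)"
    have \<sigma>: "\<sigma> > 0" using e M' by (simp add: \<sigma>_def)
    \<comment> \<open>For such \<open>n\<close> the greedy error, at most the square root of
      \<open>n * (card T * b\<^sup>2)\<close>, is below \<open>n * \<sigma>\<close> at every net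
      point.\<close>
    obtain n :: nat where n: "card T * b\<^sup>2 / \<sigma>\<^sup>2 < n" using reals_Archimedean2 by blast
    have "0 \<le> card T * b\<^sup>2 / \<sigma>\<^sup>2" by simp
    then have n0: "n > 0" using n by (metis of_nat_0_less_iff order.strict_trans1)
    obtain xs where xs: "length xs = n" "set xs \<subseteq> E"
     "(\<Sum>t\<in>T. (cmod ((\<Sum>x\<leftarrow>xs. 1 / (x - t)) - n * (poly q t / M)))\<^sup>2) \<le> n * (card T * b\<^sup>2)"
      using greedy_kernel_sums[of T "\<lambda>t. t", OF T(1) _ A(2) M' b, of n] T(2) K(2) by auto
    have net: "cmod ((\<Sum>x\<leftarrow>xs. 1 / (x - t)) - n * (poly q t / M)) < n * \<sigma>" if "t \<in> T" for t
    proof -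
      have "(cmod ((\<Sum>x\<leftarrow>xs. 1 / (x - t)) - n * (poly q t / M)))\<^sup>2 \<le> n * (card T * b\<^sup>2)"
        using member_le_sum[of t T "\<lambda>t. (cmod ((\<Sum>x\<leftarrow>xs. 1 / (x - t)) - n * (poly q t / M)))\<^sup>2"] that T(1) xs(3) by auto
      also have "\<dots> < n * (n * \<sigma>\<^sup>2)" using n n0 \<sigma> by (simp add: field_simps)
      also have "\<dots> = (n * \<sigma>)\<^sup>2" by (simp add: power2_eq_square)
      finally show ?thesis by (rule power_less_imp_less_base) (use \<sigma> in simp)
    qed
    show "\<exists>xs. xs \<noteq> [] \<and> set xs \<subseteq> E \<and>
        (\<forall>z\<in>K. cmod (M / length xs * (\<Sum>x\<leftarrow>xs. 1 / (x - z)) - poly q z) < \<epsilon>)"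
    proof (intro exI[of _ xs] conjI ballI)
      show "xs \<noteq> []" using xs(1) n0 by auto
      fix z assume zK: "z \<in> K"
      then obtain t where t: "t \<in> T" "dist t z < \<tau>" using T(3) by auto
      define S where "S = (\<lambda>z. \<Sum>x\<leftarrow>xs. 1 / (x - z))"
      have "S z - S t = (\<Sum>x\<leftarrow>xs. 1 / (x - z) - 1 / (x - t))"
        by (simp add: S_def sum_list_subtractf)
      also have "cmod \<dots> \<le> length xs * (\<epsilon> / (3 * M))"
      proof (rule sum_list_norm_le)
        fix x assume "x \<in> set xs"
        then have "cmod (1 / (x - z) - 1 / (x - t)) \<le> (cmod (x - x) + cmod (z - t)) / \<delta>\<^sup>2"
          using \<delta> xs(2) zK t(1) T(2) by (intro cauchy_kernel_diff_le) auto
        also have "\<dots> \<le> \<tau> / \<delta>\<^sup>2"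
          using t(2) by (intro divide_right_mono) (auto simp: dist_norm norm_minus_commute)
        finally show "cmod (1 / (x - z) - 1 / (x - t)) \<le> \<epsilon> / (3 * M)" using \<tau>(3) by linarith
      qed
      finally have 1: "cmod (S z - S t) \<le> n * \<sigma>" using xs(1) by (simp add: \<sigma>_def)
      have 2: "cmod (S t - n * (poly q t / M)) < n * \<sigma>" using net[OF t(1)] by (simp add: S_def)
      have 3: "cmod (poly q t - poly q z) < \<epsilon>/3"
        using \<tau>0(2)[of z t] zK t T(2) \<tau>(2) by (auto simp: dist_norm)
      have "cmod (S z - n * (poly q t / M)) < 2 * (n * \<sigma>)"
        using norm_triangle_lt[of "S z - S t" "S t - n * (poly q t / M)" "2 * (n * \<sigma>)"] 1 2 by simp
      then have "cmod (M / n) * cmod (S z - n * (poly q t / M)) < cmod (M / n) * (2 * (n * \<sigma>))"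
        using M' n0 by (intro mult_strict_left_mono) auto
      also have "\<dots> = 2 * \<epsilon> / 3" using M' n0 by (simp add: \<sigma>_def norm_divide)
      finally have "cmod (M / n * (S z - n * (poly q t / M))) < 2 * \<epsilon> / 3" by (simp only: norm_mult of_real_divide of_real_of_nat_eq)
      moreover have "M / n * (S z - n * (poly q t / M)) = M / n * S z - poly q t"
        using M' n0 by (simp add: field_simps)
      ultimately have "cmod (M / n * S z - poly q t) < 2 * \<epsilon> / 3" by simp
      then show "cmod (M / length xs * (\<Sum>x\<leftarrow>xs. 1 / (x - z)) - poly q z) < \<epsilon>"
        using norm_triangle_lt[of "M / n * S z - poly q t" "poly q t - poly q z" \<epsilon>] 3 xs(1)
        by (simp add: S_def)
    qed (use xs in auto)
  qed
qed

end

section \<open>Density of sums of Cauchy kernels\<close>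

text \<open>Being joined by a finite chain of steps shorter than \<open>\<eta>\<close> is an
  equivalence relation with open classes, so it relates all points of a connected set. Such chains
  are concatenated to visit a finite \<open>\<eta>\<close>-net point by point.\<close>

lemma connected_finite_walk:
  fixes E :: "'a :: metric_space set"
  assumes conn: "connected E" and E: "compact E" "E \<noteq> {}" and \<eta>: "\<eta> > 0"
  obtains zs where "zs \<noteq> []" "set zs \<subseteq> E" "\<And>k. Suc k < length zs \<Longrightarrow> dist (zs ! k) (zs ! Suc k) < \<eta>"
    "\<And>x. x \<in> E \<Longrightarrow> \<exists>k<length zs. dist x (zs ! k) < \<eta>"
proof -
  define walk where "walk = (\<lambda>zs. zs \<noteq> [] \<and> set zs \<subseteq> E \<and> successively (\<lambda>x y. dist x y < \<eta>) zs)"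
  \<comment> \<open>The common endpoint occurs twice in a row, which is a step of length
    \<open>0 < \<eta>\<close>.\<close>
  have walk_append: "walk (xs @ ys)" if "walk xs" "walk ys" "last xs = hd ys" for xs ys
    using that \<eta> by (auto simp: walk_def successively_append_iff)
  define Rel where "Rel = (\<lambda>a b. \<exists>zs. walk zs \<and> hd zs = a \<and> last zs = b)"
  have Rel: "Rel a b" if "a \<in> E" "b \<in> E" for a b
  proof (rule connected_equivalence_relation[OF conn that])
    fix x y assume "Rel x y"
    then obtain zs where "walk zs" "hd zs = x" "last zs = y" by (auto simp: Rel_def)
    then have "walk (rev zs)" "hd (rev zs) = y" "last (rev zs) = x"
      by (auto simp: walk_def hd_rev last_rev dist_commute)
    then show "Rel y x" unfolding Rel_def by blast
  next
    fix x y z assume "Rel x y" "Rel y z"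
    then obtain xs ys where xs: "walk xs" "hd xs = x" "last xs = y" and ys: "walk ys" "hd ys = y" "last ys = z"
      by (auto simp: Rel_def)
    then have "walk (xs @ ys)" "hd (xs @ ys) = x" "last (xs @ ys) = z"
      using walk_append[of xs ys] by (auto simp: walk_def)
    then show "Rel x z" unfolding Rel_def by blast
  next
    fix a assume a: "a \<in> E"
    show "\<exists>T. openin (top_of_set E) T \<and> a \<in> T \<and> (\<forall>x\<in>T. Rel a x)"
    proof (intro exI[of _ "E \<inter> ball a \<eta>"] conjI ballI)
      fix x assume "x \<in> E \<inter> ball a \<eta>"
      then have "walk [a, x]" using a by (auto simp: walk_def)
      then show "Rel a x" unfolding Rel_def by (intro exI[of _ "[a, x]"]) auto
    qed (use a \<eta> in auto)
  qed
  have cover: "\<exists>zs. walk zs \<and> F \<subseteq> set zs" if "finite F" "F \<subseteq> E" for F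
    using that
  proof (induction F rule: finite_induct)
    case empty
    obtain e where "e \<in> E" using E(2) by auto
    then show ?case by (intro exI[of _ "[e]"]) (auto simp: walk_def)
  next
    case (insert a F)
    then obtain zs where zs: "walk zs" "F \<subseteq> set zs" by auto
    then have "last zs \<in> E" by (auto simp: walk_def)
    then obtain ys where ys: "walk ys" "hd ys = last zs" "last ys = a"
      using Rel[of "last zs" a] insert.prems by (auto simp: Rel_def)
    then have "a \<in> set ys" using last_in_set[of ys] by (auto simp: walk_def)
    then show ?case using walk_append[OF zs(1) ys(1)] ys(2) zs(2)
      by (intro exI[of _ "zs @ ys"]) auto
  qed
  obtain F where F: "finite F" "F \<subseteq> E" "E \<subseteq> (\<Union>x\<in>F. ball x \<eta>)"
    using compact_finite_net[OF E(1) \<eta>] .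
  obtain zs where zs: "walk zs" "F \<subseteq> set zs" using cover[OF F(1,2)] by blast
  show ?thesis
  proof (rule that[of zs])
    fix x assume "x \<in> E"
    then obtain y where "y \<in> F" "dist x y < \<eta>" using F(3) by (auto simp: dist_commute)
    then show "\<exists>k<length zs. dist x (zs ! k) < \<eta>"
      using zs(2) in_set_conv_nth[of y zs] by auto
  qed (use zs(1) in \<open>auto simp: walk_def successively_conv_nth\<close>)
qed

text \<open>Expansion of the kernel in powers of \<open>z - t\<close> about a net point
  \<open>t\<close> within \<open>\<delta>/2\<close> of \<open>z\<close>: the ratio of the geometric
  series is at most \<open>1/2\<close>. The net does not depend on \<open>d\<close>, so
  \<open>card T * d\<close> functions of \<open>x\<close> suffice for all \<open>z\<close> at
  once.\<close>

lemma cauchy_kernel_coordinates: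
  fixes K E :: "complex set"
  assumes K: "compact K" and \<delta>: "\<delta> > 0" "\<And>x z. x \<in> E \<Longrightarrow> z \<in> K \<Longrightarrow> cmod (x - z) \<ge> \<delta>"
  obtains T where "finite T"
    "\<And>z d. z \<in> K \<Longrightarrow> \<exists>\<nu>. \<forall>x\<in>E. cmod (1 / (x - z) - (\<Sum>l\<in>T \<times> {..<d}. \<nu> l * (1 / (x - fst l) ^ Suc (snd l)))) \<le> 1 / \<delta> * (1/2)^d"
proof -
  obtain T where T: "finite T" "T \<subseteq> K" "K \<subseteq> (\<Union>t\<in>T. ball t (\<delta>/2))"
    using compact_finite_net[OF K half_gt_zero[OF \<delta>(1)]] .
  show ?thesis
  proof (rule that[OF T(1)])
    fix z and d :: nat assume z: "z \<in> K"
    then obtain t where t: "t \<in> T" "dist t z < \<delta>/2" using T(3) by auto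
    define \<nu> where "\<nu> = (\<lambda>l. if fst l = t then (z - t) ^ snd l else 0)"
    have "cmod (1 / (x - z) - (\<Sum>l\<in>T \<times> {..<d}. \<nu> l * (1 / (x - fst l) ^ Suc (snd l)))) \<le> 1 / \<delta> * (1/2)^d"
      if x: "x \<in> E" for x
    proof -
      have xt: "cmod (x - t) \<ge> \<delta>" and xz: "cmod (x - z) \<ge> \<delta>" using \<delta>(2) x z t T(2) by auto
      then have ne: "x \<noteq> t" "x \<noteq> z" using \<delta>(1) by auto
      define y where "y = (z - t) / (x - t)"
      have y: "cmod y \<le> 1/2"
        unfolding y_def norm_divide using t(2) xt \<delta>(1)
        by (intro divide_le_eq[THEN iffD2]) (auto simp: dist_norm norm_minus_commute)
      then have y1: "y \<noteq> 1" by auto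
      have "(\<Sum>l\<in>T \<times> {..<d}. \<nu> l * (1 / (x - fst l) ^ Suc (snd l)))
          = (\<Sum>s\<in>T. \<Sum>m<d. if s = t then (z - t) ^ m / (x - t) ^ Suc m else 0)"
        unfolding sum.cartesian_product by (intro sum.cong) (auto simp: \<nu>_def)
      also have "\<dots> = (\<Sum>s\<in>T. if s = t then (\<Sum>m<d. (z - t) ^ m / (x - t) ^ Suc m) else 0)"
        by (intro sum.cong) auto
      also have "\<dots> = (\<Sum>m<d. (z - t) ^ m / (x - t) ^ Suc m)"
        using T(1) t(1) by simp
      also have "\<dots> = (\<Sum>m<d. y ^ m) / (x - t)"
        by (simp add: y_def sum_divide_distrib power_divide mult.commute)
      also have "\<dots> = (1 - y ^ d) / ((1 - y) * (x - t))"
        using y1 by (simp add: sum_gp_strict)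
      also have "(1 - y) * (x - t) = x - z"
        using ne by (simp add: y_def field_simps)
      finally have "1 / (x - z) - (\<Sum>l\<in>T \<times> {..<d}. \<nu> l * (1 / (x - fst l) ^ Suc (snd l))) = y ^ d / (x - z)"
        by (simp add: diff_divide_distrib)
      moreover have "cmod (y ^ d / (x - z)) \<le> (1/2)^d / \<delta>"
        unfolding norm_divide norm_power using y xz \<delta>(1) by (intro frac_le power_mono) auto
      ultimately show ?thesis by simp
    qed
    then show "\<exists>\<nu>. \<forall>x\<in>E. cmod (1 / (x - z) - (\<Sum>l\<in>T \<times> {..<d}. \<nu> l * (1 / (x - fst l) ^ Suc (snd l)))) \<le> 1 / \<delta> * (1/2)^d"
      by blast
  qed
qed

text \<open>Abel summation: cumulative weights \<open>H\<close> become the coefficients of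
  differences of neighbouring values of \<open>\<phi>\<close>.\<close>

lemma summation_by_parts_differences:
  fixes H \<phi> :: "nat \<Rightarrow> 'a :: comm_ring"
  shows "(\<Sum>k\<le>r. (H k - (if k = 0 then 0 else H (k - 1))) * \<phi> k)
    = (\<Sum>k<r. H k * (\<phi> k - \<phi> (Suc k))) + H r * \<phi> r"
  by (induction r) (auto simp: algebra_simps)

lemma sum_list_concat_replicate:
  fixes f :: "'a \<Rightarrow> 'b :: comm_semiring_1"
  shows "(\<Sum>x\<leftarrow>concat (map (\<lambda>i. replicate (m i) (y i)) [0..<n]). f x) = (\<Sum>i<n. of_nat (m i) * f (y i))"
  by (induction n) (auto simp: sum_list_replicate map_replicate)

context exterior_domain begin

lemma kernel_sums_dense:
  assumes conn: "connected E" and K: "compact K" "K \<inter> (U \<union> E) = {}" "E \<subseteq> outside K"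
    and q: "poly_approximable K q" and \<epsilon>: "\<epsilon> > 0"
  shows "\<exists>xs. set xs \<subseteq> E \<and> (\<forall>z\<in>K. cmod ((\<Sum>x\<leftarrow>xs. 1 / (x - z)) - q z) < \<epsilon>)"
proof -
  \<comment> \<open>Six errors, \<open>e1\<close> to \<open>e6\<close> below, share
    \<open>\<epsilon>\<close>.\<close>
  define e where "e = \<epsilon> / 6"
  have e: "e > 0" using \<epsilon> by (simp add: e_def)
  have "E \<inter> K = {}" using K(2) by blast
  then obtain \<delta> where \<delta>: "\<delta> > 0" "\<And>x z. x \<in> E \<Longrightarrow> z \<in> K \<Longrightarrow> cmod (x - z) \<ge> \<delta>"
    using separate_compact_closed[OF compact_E compact_imp_closed[OF K(1)]] unfolding dist_norm by metis
  define \<psi> where "\<psi> = (\<lambda>l (x :: complex). 1 / (x - fst l) ^ Suc (snd l) :: complex)"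
  obtain T where T: "finite T"
    "\<And>z d. z \<in> K \<Longrightarrow> \<exists>\<nu>. \<forall>x\<in>E. cmod (1 / (x - z) - (\<Sum>l\<in>T \<times> {..<d}. \<nu> l * \<psi> l x)) \<le> 1 / \<delta> * (1/2)^d"
    using cauchy_kernel_coordinates[OF K(1) \<delta>] unfolding \<psi>_def by blast
  define L where "L = (\<lambda>d::nat. T \<times> {..<d})"
  have L: "finite (L d)" "card (L d) \<le> Suc (card T) * d" for d
    using T(1) by (auto simp: L_def card_cartesian_product)
  \<comment> \<open>The constant \<open>2 / \<delta>\<close> serves both roundings, since a
    difference of two kernels doubles the error constant \<open>1 / \<delta>\<close>;
    \<open>Suc (card T)\<close> keeps the dimension factor positive.\<close>
  have "2 / \<delta> \<ge> 0" using \<delta> by simp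
  from rounding[where 'i = nat and 'l = "complex \<times> nat", OF zero_less_Suc this e, of "card T"] obtain p where
    p: "\<And>(I :: nat set) (a :: complex \<times> nat \<Rightarrow> nat \<Rightarrow> complex) L G t.
    \<lbrakk>\<And>d. finite (L d); \<And>d. card (L d) \<le> Suc (card T) * d;
     \<And>g d. g \<in> G \<Longrightarrow> \<exists>\<nu>. \<forall>i\<in>I. cmod (g i - (\<Sum>l\<in>L d. \<nu> l * a l i)) \<le> 2 / \<delta> * (1/2)^d;
     finite I; \<And>i. i \<in> I \<Longrightarrow> 0 \<le> t i \<and> t i \<le> 1\<rbrakk>
    \<Longrightarrow> \<exists>t'. (\<forall>i\<in>I. 0 \<le> t' i \<and> t' i \<le> 1) \<and> card {i\<in>I. t' i \<noteq> 0 \<and> t' i \<noteq> 1} \<le> p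
     \<and> (\<Sum>i\<in>I. t' i) = (\<Sum>i\<in>I. t i)
     \<and> (\<forall>g\<in>G. cmod (\<Sum>i\<in>I. of_real (t' i - t i) * g i) \<le> e)"
    by blast
  \<comment> \<open>The step length is chosen after \<open>p\<close>: moving \<open>p\<close>
    weights of size at most \<open>1\<close> by less than \<open>\<eta>\<close> costs at most
    \<open>e\<close>.\<close>
  define \<eta> where "\<eta> = e * \<delta>\<^sup>2 / (real p + 1)"
  have \<eta>: "\<eta> > 0" using e \<delta> by (simp add: \<eta>_def add_nonneg_pos)
  have "\<eta> / \<delta>\<^sup>2 * (real p + 1) = e" using \<delta>(1) by (simp add: \<eta>_def)
  moreover have "\<eta> / \<delta>\<^sup>2 * real p \<le> \<eta> / \<delta>\<^sup>2 * (real p + 1)"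
    using \<eta> by (intro mult_left_mono) auto
  ultimately have p\<eta>: "real p * (\<eta> / \<delta>\<^sup>2) \<le> e" by (simp only: mult.commute)
  have few: "cmod (\<Sum>i\<in>J. of_real (t i) * g i) \<le> e"
    if "card J \<le> p" "\<And>i. i \<in> J \<Longrightarrow> \<bar>t i\<bar> \<le> 1" "\<And>i. i \<in> J \<Longrightarrow> cmod (g i) \<le> \<eta> / \<delta>\<^sup>2"
    for J :: "nat set" and t g
  proof -
    have "cmod (\<Sum>i\<in>J. of_real (t i) * g i) \<le> (\<Sum>i\<in>J. 1 * (\<eta> / \<delta>\<^sup>2))"
      using that(2,3) by (intro sum_norm_le) (simp only: norm_mult norm_of_real, intro mult_mono, auto)
    also have "\<dots> \<le> real p * (\<eta> / \<delta>\<^sup>2)"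
      using that(1) \<eta> by (simp add: mult_right_mono divide_right_mono)
    finally show ?thesis using p\<eta> by linarith
  qed
  have near: "cmod (1 / (x - z) - 1 / (x' - z)) \<le> \<eta> / \<delta>\<^sup>2"
    if "x \<in> E" "x' \<in> E" "z \<in> K" "dist x x' < \<eta>" for x x' z
  proof -
    have "cmod (1 / (x - z) - 1 / (x' - z)) \<le> (cmod (x - x') + cmod (z - z)) / \<delta>\<^sup>2"
      using that \<delta> by (intro cauchy_kernel_diff_le) auto
    also have "\<dots> \<le> \<eta> / \<delta>\<^sup>2" using that(4) by (intro divide_right_mono) (auto simp: dist_norm)
    finally show ?thesis .
  qed
  obtain zs where zs: "zs \<noteq> []" "set zs \<subseteq> E" "\<And>k. Suc k < length zs \<Longrightarrow> dist (zs ! k) (zs ! Suc k) < \<eta>"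
    "\<And>x. x \<in> E \<Longrightarrow> \<exists>k<length zs. dist x (zs ! k) < \<eta>"
    by (rule connected_finite_walk[OF conn compact_E E_ne \<eta>]) (rule that)
  define r where "r = length zs - 1"
  define w where "w = (\<lambda>k. zs ! k)"
  have len: "length zs = Suc r" using zs(1) by (simp add: r_def)
  have wE: "w k \<in> E" if "k \<le> r" for k
    using zs(2) that len by (auto simp: w_def)
  \<comment> \<open>The kernels of the three copies of each point of the walk are subtracted from
    the target in advance. It remains approximable by polynomials because \<open>E\<close> lies
    outside \<open>K\<close>.\<close>
  have "poly_approximable K (\<lambda>z. q z + (-3) * (\<Sum>k\<le>r. 1 / (w k - z)))"
    using wE K(3) by (intro poly_approximable_add q poly_approximable_mult poly_approximable_const
        poly_approximable_sum poly_approximable_pole K(1)) auto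
  then obtain q2 where q2: "\<And>z. z \<in> K \<Longrightarrow> cmod (q z + (-3) * (\<Sum>k\<le>r. 1 / (w k - z)) - poly q2 z) < e"
    using e unfolding poly_approximable_def by blast
  obtain M0 where M0: "M0 > 0"
    "\<And>M K \<epsilon>. \<lbrakk>M \<ge> M0; compact K; K \<inter> (U \<union> E) = {}; \<epsilon> > 0\<rbrakk> \<Longrightarrow>
      \<exists>xs. xs \<noteq> [] \<and> set xs \<subseteq> E \<and>
        (\<forall>z\<in>K. cmod (of_real (M / real (length xs)) * (\<Sum>x\<leftarrow>xs. 1 / (x - z)) - poly q2 z) < \<epsilon>)"
    by (rule weighted_kernel_approx[of q2]) (rule that)
  \<comment> \<open>With \<open>M\<close> integral, the fractional weights \<open>f\<close>
    introduced below have the integral sum \<open>n * f = M mod n\<close>.\<close>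
  obtain M :: nat where M: "real M \<ge> M0" using real_arch_simple by blast
  obtain ys where ys: "ys \<noteq> []" "set ys \<subseteq> E"
    "\<And>z. z \<in> K \<Longrightarrow> cmod (of_real (real M / real (length ys)) * (\<Sum>x\<leftarrow>ys. 1 / (x - z)) - poly q2 z) < e"
    using M0(2)[OF M K(1,2) e] by blast
  define n where "n = length ys"
  have n: "n > 0" using ys(1) by (simp add: n_def)
  define y where "y = (\<lambda>i. ys ! i)"
  have yE: "y i \<in> E" if "i < n" for i using that ys(2) by (auto simp: y_def n_def)
  have ysum: "(\<Sum>x\<leftarrow>ys. f x) = (\<Sum>i<n. f (y i))" for f :: "complex \<Rightarrow> complex"
    by (simp add: sum_list_sum_nth n_def y_def atLeast0LessThan)
  \<comment> \<open>Each of the \<open>n\<close> points carries weight \<open>M / n = b + f\<close>,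
    and only the fraction \<open>f\<close> has to be rounded.\<close>
  define b where "b = M div n"
  define f where "f = real (M mod n) / real n"
  have bf: "real M / real n = real b + f"
    using n by (simp add: b_def f_def field_simps flip: of_nat_mult of_nat_add)
  have f: "0 \<le> f" "f \<le> 1" using n by (auto simp: f_def field_simps intro: less_imp_le)

  have "\<exists>\<nu>. \<forall>i\<in>{..<n}. cmod (g i - (\<Sum>l\<in>L d. \<nu> l * \<psi> l (y i))) \<le> 2 / \<delta> * (1/2)^d"
    if g: "g \<in> (\<lambda>z i. 1 / (y i - z)) ` K" for g d
  proof -
    obtain z where z: "z \<in> K" "g = (\<lambda>i. 1 / (y i - z))" using g by auto
    obtain \<nu> where \<nu>: "\<forall>x\<in>E. cmod (1 / (x - z) - (\<Sum>l\<in>L d. \<nu> l * \<psi> l x)) \<le> 1 / \<delta> * (1/2)^d"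
      using T(2)[OF z(1)] unfolding L_def by blast
    have "1 / \<delta> * (1/2)^d \<le> 2 / \<delta> * (1/2)^d" using \<delta>(1) by (intro mult_right_mono divide_right_mono) auto
    then show ?thesis using \<nu> yE z(2) by (intro exI[of _ \<nu>]) (auto intro: order_trans)
  qed
  from p[of L "(\<lambda>z i. 1 / (y i - z)) ` K" "{..<n}" "\<lambda>l i. \<psi> l (y i)" "\<lambda>_. f", OF L this] f
  obtain t where t: "\<And>i. i < n \<Longrightarrow> 0 \<le> t i \<and> t i \<le> 1" "card {i\<in>{..<n}. t i \<noteq> 0 \<and> t i \<noteq> 1} \<le> p"
     "(\<Sum>i<n. t i) = (\<Sum>i<n. f)"
     "\<And>z. z \<in> K \<Longrightarrow> cmod (\<Sum>i<n. of_real (t i - f) * (1 / (y i - z))) \<le> e"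
    by auto
  \<comment> \<open>\<open>Q\<close> collects the at most \<open>p\<close> points whose fraction the
    first rounding left undecided, and \<open>P\<close> those whose fraction became
    \<open>1\<close>.\<close>
  define Q where "Q = {i\<in>{..<n}. t i \<noteq> 0 \<and> t i \<noteq> 1}"
  define P where "P = {i\<in>{..<n}. t i = 1}"
  have finQ: "finite Q" and Qn: "\<And>i. i \<in> Q \<Longrightarrow> i < n" by (auto simp: Q_def)
  have split: "(\<Sum>i<n. of_real (t i) * h i) = (\<Sum>i<n. (if i \<in> P then 1 else 0) * h i) + (\<Sum>i\<in>Q. of_real (t i) * h i)"
    for h :: "nat \<Rightarrow> complex"
  proof -
    have "(\<Sum>i\<in>Q. of_real (t i) * h i) = (\<Sum>i<n. if i \<in> Q then of_real (t i) * h i else 0)"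
      by (simp add: Q_def sum.If_cases Int_def)
    then show ?thesis
      by (simp add: sum.distrib[symmetric]) (intro sum.cong, auto simp: P_def Q_def)
  qed
  have "of_real (\<Sum>i\<in>Q. t i) = (of_real (\<Sum>i<n. t i) - of_nat (card P) :: complex)"
    using split[of "\<lambda>_. 1"] by (simp add: P_def sum.If_cases Int_def)
  then have "of_real (\<Sum>i\<in>Q. t i) = (of_real (real (M mod n) - real (card P)) :: complex)"
    using t(3) n by (simp add: f_def)
  then have sumQ: "(\<Sum>i\<in>Q. t i) = of_int (int (M mod n) - int (card P))"
    by (simp only: of_real_eq_iff of_int_diff of_int_of_nat_eq)

  have "\<exists>k\<le>r. dist (y i) (w k) < \<eta>" if "i < n" for i
    using zs(4)[OF yE[OF that]] len by (auto simp: w_def less_Suc_eq_le)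
  then obtain \<kappa> where \<kappa>: "\<And>i. i < n \<Longrightarrow> \<kappa> i \<le> r \<and> dist (y i) (w (\<kappa> i)) < \<eta>" by metis
  \<comment> \<open>\<open>G k\<close> is the undecided weight attached to the walk up to index
    \<open>k\<close>; the attachment \<open>\<kappa>\<close> moves each point by less than
    \<open>\<eta>\<close>.\<close>
  define G where "G = (\<lambda>k. \<Sum>i\<in>{i\<in>Q. \<kappa> i \<le> k}. t i)"
  have tQ: "0 \<le> t i" if "i \<in> Q" for i using t(1) Qn that by blast
  have G0: "G k \<ge> 0" for k unfolding G_def using tQ by (intro sum_nonneg) auto
  have Gmono: "G k \<le> G (Suc k)" for k
    unfolding G_def using tQ finQ by (intro sum_mono2) auto
  have Gr: "G r = of_int (int (M mod n) - int (card P))"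
  proof -
    have "{i\<in>Q. \<kappa> i \<le> r} = Q" using \<kappa> Qn by auto
    then show ?thesis by (simp only: G_def sumQ)
  qed
  have Gdiff: "(\<Sum>i\<in>Q. of_real (t i) * h (\<kappa> i)) = (\<Sum>k\<le>r. (of_real (G k) - (if k = 0 then 0 else of_real (G (k - 1)))) * h k)"
    for h :: "nat \<Rightarrow> complex"
  proof -
    have "(\<Sum>i\<in>Q. of_real (t i) * h (\<kappa> i)) = (\<Sum>k\<le>r. \<Sum>i\<in>{i\<in>Q. \<kappa> i = k}. of_real (t i) * h (\<kappa> i))"
      using \<kappa> Qn finQ by (intro sum.group[symmetric]) auto
    also have "\<dots> = (\<Sum>k\<le>r. (of_real (G k) - (if k = 0 then 0 else of_real (G (k - 1)))) * h k)"
    proof (rule sum.cong)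
      fix k
      have "(\<Sum>i\<in>{i\<in>Q. \<kappa> i = k}. t i) = G k - (if k = 0 then 0 else G (k - 1))"
      proof (cases k)
        case (Suc m)
        have "G k = (\<Sum>i\<in>{i\<in>Q. \<kappa> i \<le> m}. t i) + (\<Sum>i\<in>{i\<in>Q. \<kappa> i = k}. t i)"
          unfolding G_def using finQ Suc
          by (subst sum.union_disjoint[symmetric]) (auto intro!: sum.cong)
        then show ?thesis using Suc by (simp add: G_def)
      qed (simp add: G_def)
      then have "(\<Sum>i\<in>{i\<in>Q. \<kappa> i = k}. of_real (t i)) = (of_real (G k) - (if k = 0 then 0 else of_real (G (k - 1))) :: complex)"
        by (simp flip: of_real_sum)
      then show "(\<Sum>i\<in>{i\<in>Q. \<kappa> i = k}. of_real (t i) * h (\<kappa> i)) = (of_real (G k) - (if k = 0 then 0 else of_real (G (k - 1)))) * h k"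
        by (simp flip: sum_distrib_right)
    qed simp
    finally show ?thesis .
  qed

  text \<open>The remaining fractional weights are moved to the walk; \<open>G r\<close> is an integer because rounding
    preserves the total weight.\<close>
  have "\<exists>\<nu>. \<forall>k\<in>{..<r}. cmod (g k - (\<Sum>l\<in>L d. \<nu> l * (\<psi> l (w k) - \<psi> l (w (Suc k))))) \<le> 2 / \<delta> * (1/2)^d"
    if g: "g \<in> (\<lambda>z k. 1 / (w k - z) - 1 / (w (Suc k) - z)) ` K" for g d
  proof -
    obtain z where z: "z \<in> K" "g = (\<lambda>k. 1 / (w k - z) - 1 / (w (Suc k) - z))" using g by auto
    obtain \<nu> where \<nu>: "\<forall>x\<in>E. cmod (1 / (x - z) - (\<Sum>l\<in>L d. \<nu> l * \<psi> l x)) \<le> 1 / \<delta> * (1/2)^d"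
      using T(2)[OF z(1)] unfolding L_def by blast
    have "cmod (g k - (\<Sum>l\<in>L d. \<nu> l * (\<psi> l (w k) - \<psi> l (w (Suc k))))) \<le> 2 / \<delta> * (1/2)^d" if "k < r" for k
    proof -
      have "g k - (\<Sum>l\<in>L d. \<nu> l * (\<psi> l (w k) - \<psi> l (w (Suc k))))
         = (1 / (w k - z) - (\<Sum>l\<in>L d. \<nu> l * \<psi> l (w k))) - (1 / (w (Suc k) - z) - (\<Sum>l\<in>L d. \<nu> l * \<psi> l (w (Suc k))))"
        by (simp add: z(2) right_diff_distrib sum_subtractf)
      also have "cmod \<dots> \<le> 1 / \<delta> * (1/2)^d + 1 / \<delta> * (1/2)^d"
        by (rule norm_triangle_le_diff, rule add_mono) (use \<nu> wE that in auto)
      finally show ?thesis by (simp add: field_simps)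
    qed
    then show ?thesis by blast
  qed
  from p[of L "(\<lambda>z k. 1 / (w k - z) - 1 / (w (Suc k) - z)) ` K" "{..<r}" "\<lambda>l k. \<psi> l (w k) - \<psi> l (w (Suc k))" "\<lambda>k. frac (G k)", OF L this]
  obtain s where s: "\<And>k. k < r \<Longrightarrow> 0 \<le> s k \<and> s k \<le> 1" "card {k\<in>{..<r}. s k \<noteq> 0 \<and> s k \<noteq> 1} \<le> p"
     "\<And>z. z \<in> K \<Longrightarrow> cmod (\<Sum>k<r. of_real (s k - frac (G k)) * (1 / (w k - z) - 1 / (w (Suc k) - z))) \<le> e"
    by (auto simp: frac_ge_0 less_imp_le[OF frac_lt_1])
  \<comment> \<open>\<open>H\<close> rounds \<open>G\<close>: the fractional part becomes
    \<open>0\<close> or \<open>1\<close> as the second rounding decides, and \<open>0\<close> at the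
    at most \<open>p\<close> indices left undecided. At \<open>r\<close> nothing is lost, since
    \<open>G r\<close> is an integer.\<close>
  define H where "H = (\<lambda>k. \<lfloor>G k\<rfloor> + (if k < r \<and> s k = 1 then 1 else 0))"
  have Hr: "of_int (H r) = G r" by (simp add: H_def Gr)
  \<comment> \<open>\<open>v k\<close> is the integral weight that \<open>w k\<close> receives. The
    floor of \<open>G\<close> does not decrease along the walk and the added bits differ by at most
    one, so the three copies in reserve outweigh any negative \<open>v k\<close>.\<close>
  define v where "v = (\<lambda>k. H k - (if k = 0 then 0 else H (k - 1)))"
  have v: "v k \<ge> -2" for k
  proof (cases k)
    case 0
    then show ?thesis using G0[of 0] by (simp add: v_def H_def)
  next
    case (Suc m)
    have "\<lfloor>G m\<rfloor> \<le> \<lfloor>G k\<rfloor>" using Gmono[of m] Suc by (simp add: floor_mono)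
    then show ?thesis using Suc by (auto simp: v_def H_def)
  qed
  define xs where "xs = concat (map (\<lambda>i. replicate (b + (if i \<in> P then 1 else 0)) (y i)) [0..<n])
     @ concat (map (\<lambda>k. replicate (nat (3 + v k)) (w k)) [0..<Suc r])"
  have "set xs \<subseteq> E" using yE wE by (auto simp: xs_def)
  moreover have "cmod ((\<Sum>x\<leftarrow>xs. 1 / (x - z)) - q z) < \<epsilon>" if z: "z \<in> K" for z
  proof -
    define \<phi> where "\<phi> = (\<lambda>x. 1 / (x - z))"
    have S: "(\<Sum>x\<leftarrow>xs. \<phi> x) = (\<Sum>i<n. of_nat (b + (if i \<in> P then 1 else 0)) * \<phi> (y i)) + (\<Sum>k\<le>r. of_nat (nat (3 + v k)) * \<phi> (w k))"
      unfolding xs_def map_append sum_list_append sum_list_concat_replicate lessThan_Suc_atMost ..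
    have S1: "(\<Sum>i<n. of_nat (b + (if i \<in> P then 1 else 0)) * \<phi> (y i))
       = of_nat b * (\<Sum>i<n. \<phi> (y i)) + (\<Sum>i<n. (if i \<in> P then 1 else 0) * \<phi> (y i))"
      unfolding sum_distrib_left sum.distrib[symmetric] by (intro sum.cong) (auto simp: algebra_simps)
    have "of_nat (nat (3 + v k)) = (3 + of_int (v k) :: complex)" for k
    proof -
      have "int (nat (3 + v k)) = 3 + v k" using v[of k] by simp
      then show ?thesis by (metis of_int_add of_int_numeral of_int_of_nat_eq)
    qed
    then have S2: "(\<Sum>k\<le>r. of_nat (nat (3 + v k)) * \<phi> (w k)) = 3 * (\<Sum>k\<le>r. \<phi> (w k)) + (\<Sum>k\<le>r. of_int (v k) * \<phi> (w k))"
      by (simp add: distrib_right sum.distrib sum_distrib_left)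
    have V: "(\<Sum>k\<le>r. of_int (v k) * \<phi> (w k)) = (\<Sum>k<r. of_int (H k) * (\<phi> (w k) - \<phi> (w (Suc k)))) + of_int (H r) * \<phi> (w r)"
      unfolding v_def using summation_by_parts_differences[of "\<lambda>k. of_int (H k)" "\<lambda>k. \<phi> (w k)" r]
      by (simp add: if_distrib[of of_int] cong: if_cong)
    have W: "(\<Sum>i\<in>Q. of_real (t i) * \<phi> (w (\<kappa> i))) = (\<Sum>k<r. of_real (G k) * (\<phi> (w k) - \<phi> (w (Suc k)))) + of_real (G r) * \<phi> (w r)"
      unfolding Gdiff[of "\<lambda>k. \<phi> (w k)"]
      by (rule summation_by_parts_differences[of "\<lambda>k. of_real (G k)" "\<lambda>k. \<phi> (w k)" r])
    have Hr': "of_int (H r) = (of_real (G r) :: complex)" by (metis Hr of_real_of_int_eq)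
    define d where "d = (\<lambda>k. \<phi> (w k) - \<phi> (w (Suc k)))"
    \<comment> \<open>The errors come, in order, from the polynomial approximation of the target,
      the weighted kernel sum, the first rounding, the move to the walk, the second rounding, and
      the fractions that it leaves undecided.\<close>
    define e1 where "e1 = q z + (-3) * (\<Sum>k\<le>r. \<phi> (w k)) - poly q2 z"
    define e2 where "e2 = of_real (real M / real (length ys)) * (\<Sum>x\<leftarrow>ys. \<phi> x) - poly q2 z"
    define e3 where "e3 = (\<Sum>i<n. of_real (t i - f) * \<phi> (y i))"
    define e4 where "e4 = (\<Sum>i\<in>Q. of_real (t i) * (\<phi> (y i) - \<phi> (w (\<kappa> i))))"
    define e5 where "e5 = (\<Sum>k<r. of_real (s k - frac (G k)) * d k)"
    define e6 where "e6 = (\<Sum>k\<in>{k\<in>{..<r}. s k \<noteq> 0 \<and> s k \<noteq> 1}. of_real (s k) * d k)"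
    have E5: "(\<Sum>k<r. of_int (H k) * d k) - (\<Sum>k<r. of_real (G k) * d k) = e5 - e6"
    proof -
      have "e6 = (\<Sum>k<r. if s k \<noteq> 0 \<and> s k \<noteq> 1 then of_real (s k) * d k else 0)"
        unfolding e6_def by (simp add: sum.If_cases Int_def)
      then have "e5 - e6 = (\<Sum>k<r. of_real (s k - frac (G k)) * d k - (if s k \<noteq> 0 \<and> s k \<noteq> 1 then of_real (s k) * d k else 0))"
        by (simp add: e5_def sum_subtractf)
      also have "\<dots> = (\<Sum>k<r. of_int (H k) * d k - of_real (G k) * d k)"
        by (intro sum.cong) (auto simp: H_def frac_def algebra_simps)
      finally show ?thesis by (simp add: sum_subtractf)
    qed
    have E4: "(\<Sum>i\<in>Q. of_real (t i) * \<phi> (y i)) = e4 + (\<Sum>i\<in>Q. of_real (t i) * \<phi> (w (\<kappa> i)))"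
      by (simp add: e4_def right_diff_distrib sum_subtractf)
    have E3: "(\<Sum>i<n. of_real (t i) * \<phi> (y i)) = e3 + of_real f * (\<Sum>i<n. \<phi> (y i))"
      by (simp add: e3_def left_diff_distrib sum_subtractf sum_distrib_left)
    have E2: "of_nat b * (\<Sum>i<n. \<phi> (y i)) + of_real f * (\<Sum>i<n. \<phi> (y i)) = e2 + poly q2 z"
    proof -
      have "of_nat b + of_real f = (of_real (real b + f) :: complex)" by simp
      also have "\<dots> = of_real (real M / real (length ys))" unfolding bf[symmetric] by (simp add: n_def)
      finally show ?thesis by (simp add: e2_def ysum flip: distrib_right)
    qed
    have "(\<Sum>x\<leftarrow>xs. \<phi> x) - q z = - e1 + e2 + e3 - e4 + e5 - e6"
    proof -
      have Vs: "(\<Sum>k\<le>r. of_int (v k) * \<phi> (w k)) = (\<Sum>i\<in>Q. of_real (t i) * \<phi> (w (\<kappa> i))) + e5 - e6"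
        using E5 unfolding V W Hr' d_def by (simp add: algebra_simps)
      have Ps: "(\<Sum>i<n. (if i \<in> P then 1 else 0) * \<phi> (y i))
          = e3 + of_real f * (\<Sum>i<n. \<phi> (y i)) - (e4 + (\<Sum>i\<in>Q. of_real (t i) * \<phi> (w (\<kappa> i))))"
        using split[of "\<lambda>i. \<phi> (y i)"] unfolding E3 E4 eq_diff_eq by (rule sym)
      have Bs: "of_nat b * (\<Sum>i<n. \<phi> (y i)) = e2 + poly q2 z - of_real f * (\<Sum>i<n. \<phi> (y i))"
        using E2 unfolding eq_diff_eq .
      have regroup: "a2 + p - F + (a3 + F - (a4 + w')) + (3 * s + (w' + a5 - a6)) - q'
          = - (q' + (-3) * s - p) + a2 + a3 - a4 + a5 - a6" for a2 p F a3 a4 w' s a5 a6 q' :: complex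
        by (simp add: algebra_simps)
      show ?thesis
        unfolding S S1 S2 Vs Ps Bs e1_def by (rule regroup)
    qed
    moreover have "cmod e1 < e" using q2[OF z] by (simp add: e1_def \<phi>_def)
    moreover have "cmod e2 < e" using ys(3)[OF z] by (simp add: e2_def \<phi>_def)
    moreover have "cmod e3 \<le> e" using t(4)[OF z] by (simp add: e3_def \<phi>_def)
    moreover have "cmod e4 \<le> e"
      unfolding e4_def
    proof (rule few)
      show "card Q \<le> p" using t(2) by (simp only: Q_def)
      fix i assume "i \<in> Q"
      then have i: "i < n" by (rule Qn)
      show "\<bar>t i\<bar> \<le> 1" using t(1)[OF i] by simp
      show "cmod (\<phi> (y i) - \<phi> (w (\<kappa> i))) \<le> \<eta> / \<delta>\<^sup>2"
        unfolding \<phi>_def using \<kappa>[OF i] by (intro near yE wE z i) auto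
    qed
    moreover have "cmod e5 \<le> e" using s(3)[OF z] by (simp add: e5_def d_def \<phi>_def)
    moreover have "cmod e6 \<le> e"
      unfolding e6_def
    proof (rule few[OF s(2)])
      fix k assume "k \<in> {k\<in>{..<r}. s k \<noteq> 0 \<and> s k \<noteq> 1}"
      then have k: "k < r" by simp
      show "\<bar>s k\<bar> \<le> 1" using s(1)[OF k] by simp
      have "dist (w k) (w (Suc k)) < \<eta>" unfolding w_def using zs(3) k len by simp
      then show "cmod (d k) \<le> \<eta> / \<delta>\<^sup>2"
        unfolding d_def \<phi>_def using k by (intro near wE z) auto
    qed
    ultimately have "cmod ((\<Sum>x\<leftarrow>xs. \<phi> x) - q z) < 6 * e"
      using norm_triangle_ineq4[of "- e1 + e2 + e3 - e4 + e5" e6] norm_triangle_ineq[of "- e1 + e2 + e3 - e4" e5]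
        norm_triangle_ineq4[of "- e1 + e2 + e3" e4] norm_triangle_ineq[of "- e1 + e2" e3] norm_triangle_ineq[of "- e1" e2]
      by simp
    then show ?thesis by (simp add: e_def \<phi>_def)
  qed
  ultimately show ?thesis by blast
qed

end

section \<open>Approximation of zero-free functions\<close>

text \<open>The frontier of \<open>C\<close> itself may be disconnected. The frontier of the
  unbounded component of the complement of \<open>closure C\<close> is connected because
  \<open>closure C\<close> is, and this connectedness is what the walk through the poles
  requires.\<close>

lemma outer_frontier_setting:
  assumes \<Gamma>: "bounded \<Gamma>" and C: "C \<in> components (- closure \<Gamma>)" "bounded C"
  defines "U \<equiv> outside (closure C)"
  obtains c R \<rho> where "exterior_domain U (frontier U) c R \<rho>" "connected (frontier U)" "frontier U \<subseteq> closure \<Gamma>"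
    "C \<inter> (U \<union> frontier U) = {}" "\<And>K. K \<subseteq> C \<Longrightarrow> frontier U \<subseteq> outside K"
proof -
  have openC: "open C" using C(1) by (rule open_components[rotated]) auto
  have C\<Gamma>: "C \<inter> closure \<Gamma> = {}" using in_components_subset[OF C(1)] by auto
  have bC: "bounded (closure C)" using C(2) by (rule bounded_closure)
  obtain c where c: "c \<in> C" using in_components_nonempty[OF C(1)] by auto
  have U: "U \<in> components (- closure C)" "\<not> bounded U"
    using bounded_unique_outside[OF bC, of U] by (simp_all add: U_def)
  have US: "U \<inter> closure C = {}" using in_components_subset[OF U(1)] by auto
  have "connected (closure C)" using in_components_connected[OF C(1)] by (rule connected_imp_connected_closure)
  then have connE: "connected (frontier U)" using U(1) by (rule connected_frontier_component_complement)
  have "frontier U \<subseteq> frontier (closure C)"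
    using frontier_of_components_subset[OF U(1)] by (simp add: frontier_complement)
  moreover have "frontier (closure C) \<subseteq> frontier C"
    using closure_subset[of C] interior_mono[of C "closure C"] by (auto simp: frontier_def)
  moreover have "frontier C \<subseteq> closure \<Gamma>"
    using frontier_of_components_closed_complement[OF closed_closure C(1)] .
  ultimately have E: "frontier U \<subseteq> closure \<Gamma>" "frontier U \<subseteq> closure C"
    by (auto simp: frontier_def)
  have disj: "C \<inter> (U \<union> frontier U) = {}"
    using US closure_subset[of C] E(1) C\<Gamma> by blast
  have openU: "open U" unfolding U_def by (rule open_outside) simp
  obtain \<rho> where \<rho>: "\<rho> > 0" "ball c \<rho> \<subseteq> C" using openC c open_contains_ball by blast
  obtain R0 where R0: "closure C \<subseteq> cball c R0" using bC unfolding bounded_any_center[where a = c] by (auto simp: subset_iff)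
  define R where "R = max R0 1"
  have R: "R > 0" "closure C \<subseteq> cball c R" using R0 by (auto simp: R_def)
  have far: "x \<in> U" if "cmod (x - c) > R" for x
  proof -
    have "- cball c R \<subseteq> U" unfolding U_def using R(2) by (intro outside_subset_convex) auto
    then show ?thesis using that by (auto simp: dist_norm norm_minus_commute)
  qed
  have "exterior_domain U (frontier U) c R \<rho>"
  proof
    show "compact (frontier U)"
      using bounded_subset[OF bC E(2)] by (simp add: compact_eq_bounded_closed)
    have "U \<noteq> {}" using U(2) by auto
    moreover have "U \<noteq> UNIV" using c disj by auto
    ultimately show "frontier U \<noteq> {}" by (simp add: frontier_eq_empty)
    show "ball c \<rho> \<inter> (U \<union> frontier U) = {}" using \<rho>(2) disj by blast
  qed (use openU R far \<rho> in auto)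
  moreover have "frontier U \<subseteq> outside K" if K: "K \<subseteq> C" for K
  proof
    fix x assume x: "x \<in> frontier U"
    have sub: "insert x U \<subseteq> - K" using K disj x by blast
    \<comment> \<open>\<open>U\<close> together with one frontier point is a connected unbounded set
      that misses \<open>K\<close>, so the component of \<open>- K\<close> containing that point is
      unbounded.\<close>
    have "connected (insert x U)"
    proof (rule connected_intermediate_closure[OF in_components_connected[OF U(1)]])
      show "insert x U \<subseteq> closure U" using x closure_subset by (auto simp: frontier_def)
    qed auto
    then have "insert x U \<subseteq> connected_component_set (- K) x"
      using sub by (intro connected_component_maximal) auto
    then have "\<not> bounded (connected_component_set (- K) x)"
      using U(2) by (meson bounded_subset subset_insertI order_trans)
    then show "x \<in> outside K" by (simp add: outside)
  qed
  ultimately show ?thesis using that connE E(1) disj by blast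
qed

text \<open>The poles found on the outer frontier lie in \<open>closure \<Gamma>\<close>. They are
  finitely many and stay away from \<open>K\<close>, so each can be replaced by a nearby point of
  \<open>\<Gamma>\<close> at small cost.\<close>

lemma kernel_sums_dense_component:
  assumes \<Gamma>: "bounded \<Gamma>" and C: "C \<in> components (- closure \<Gamma>)" "bounded C"
    and K: "compact K" "K \<subseteq> C" and q: "poly_approximable K q" and \<epsilon>: "\<epsilon> > 0"
  shows "\<exists>xs. set xs \<subseteq> \<Gamma> \<and> (\<forall>z\<in>K. cmod ((\<Sum>x\<leftarrow>xs. 1 / (x - z)) - q z) < \<epsilon>)"
proof -
  define U where "U = outside (closure C)"
  obtain c R \<rho> where ext: "exterior_domain U (frontier U) c R \<rho>" and U: "connected (frontier U)"
    "frontier U \<subseteq> closure \<Gamma>" "C \<inter> (U \<union> frontier U) = {}" "\<And>K. K \<subseteq> C \<Longrightarrow> frontier U \<subseteq> outside K"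
    using outer_frontier_setting[OF \<Gamma> C] unfolding U_def[symmetric] by metis
  have disj: "K \<inter> (U \<union> frontier U) = {}" using U(3) K(2) by blast
  obtain xs where xs: "set xs \<subseteq> frontier U" "\<And>z. z \<in> K \<Longrightarrow> cmod ((\<Sum>x\<leftarrow>xs. 1 / (x - z)) - q z) < \<epsilon>/2"
    using exterior_domain.kernel_sums_dense[OF ext U(1) K(1) disj U(4)[OF K(2)] q half_gt_zero[OF \<epsilon>]] by blast
  have "closure \<Gamma> \<inter> K = {}" using in_components_subset[OF C(1)] K(2) by auto
  then obtain \<delta> where \<delta>: "\<delta> > 0" "\<And>x z. x \<in> closure \<Gamma> \<Longrightarrow> z \<in> K \<Longrightarrow> cmod (x - z) \<ge> \<delta>"
    using separate_compact_closed[of "closure \<Gamma>" K] \<Gamma> K(1) compact_imp_closed[OF K(1)] unfolding dist_norm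
    by (metis compact_closure)
  define m where "m = real (length xs) + 1"
  have m: "m > 0" "real (length xs) \<le> m" by (auto simp: m_def)
  define \<eta> where "\<eta> = \<epsilon> / 2 * \<delta>\<^sup>2 / m"
  have \<eta>: "\<eta> > 0" using \<epsilon> \<delta>(1) m by (simp add: \<eta>_def)
  have "\<exists>y\<in>\<Gamma>. dist y x < \<eta>" if "x \<in> set xs" for x
    using that xs(1) U(2) \<eta> closure_approachable[of x \<Gamma>] by blast
  then obtain g where g: "\<And>x. x \<in> set xs \<Longrightarrow> g x \<in> \<Gamma> \<and> dist (g x) x < \<eta>" by metis
  show ?thesis
  proof (intro exI[of _ "map g xs"] conjI ballI)
    show "set (map g xs) \<subseteq> \<Gamma>" using g by auto
    fix z assume z: "z \<in> K"
    have "(\<Sum>x\<leftarrow>map g xs. 1 / (x - z)) - (\<Sum>x\<leftarrow>xs. 1 / (x - z)) = (\<Sum>x\<leftarrow>xs. 1 / (g x - z) - 1 / (x - z))"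
      by (simp add: sum_list_subtractf o_def)
    also have "cmod \<dots> \<le> real (length xs) * (\<eta> / \<delta>\<^sup>2)"
    proof (rule sum_list_norm_le)
      fix x assume x: "x \<in> set xs"
      have "cmod (1 / (g x - z) - 1 / (x - z)) \<le> (cmod (g x - x) + cmod (z - z)) / \<delta>\<^sup>2"
        using \<delta> g[OF x] x xs(1) U(2) z closure_subset[of \<Gamma>] by (intro cauchy_kernel_diff_le) auto
      also have "\<dots> \<le> \<eta> / \<delta>\<^sup>2" using g[OF x] by (intro divide_right_mono) (auto simp: dist_norm)
      finally show "cmod (1 / (g x - z) - 1 / (x - z)) \<le> \<eta> / \<delta>\<^sup>2" .
    qed
    also have "\<dots> \<le> m * (\<eta> / \<delta>\<^sup>2)" using \<eta> m by (intro mult_right_mono) auto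
    also have "\<dots> = \<epsilon>/2" using \<delta>(1) m by (simp add: \<eta>_def)
    finally have "cmod ((\<Sum>x\<leftarrow>map g xs. 1 / (x - z)) - (\<Sum>x\<leftarrow>xs. 1 / (x - z))) \<le> \<epsilon>/2" .
    then show "cmod ((\<Sum>x\<leftarrow>map g xs. 1 / (x - z)) - q z) < \<epsilon>"
      using xs(2)[OF z] norm_triangle_ineq[of "(\<Sum>x\<leftarrow>map g xs. 1 / (x - z)) - (\<Sum>x\<leftarrow>xs. 1 / (x - z))"
        "(\<Sum>x\<leftarrow>xs. 1 / (x - z)) - q z"] by simp
  qed
qed

section \<open>From logarithmic derivatives to polynomials\<close>

lemma poly_prod_list_linear:
  "poly (\<Prod>x\<leftarrow>xs. [:- x, 1:]) z = (\<Prod>x\<leftarrow>xs. z - x)" for z :: "'a :: comm_ring_1"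
  by (induction xs) (auto simp: algebra_simps)

lemma has_field_derivative_prod_list_linear:
  assumes "\<And>x. x \<in> set xs \<Longrightarrow> z \<noteq> x"
  shows "((\<lambda>z. \<Prod>x\<leftarrow>xs. z - x) has_field_derivative (\<Prod>x\<leftarrow>xs. z - x) * (\<Sum>x\<leftarrow>xs. 1 / (z - x))) (at z)"
  using assms
proof (induction xs)
  case (Cons a xs)
  have "((\<lambda>z. (z - a) * (\<Prod>x\<leftarrow>xs. z - x)) has_field_derivative
      1 * (\<Prod>x\<leftarrow>xs. z - x) + (\<Prod>x\<leftarrow>xs. z - x) * (\<Sum>x\<leftarrow>xs. 1 / (z - x)) * (z - a)) (at z)"
    using Cons by (intro DERIV_mult Cons.IH) (auto intro!: derivative_eq_intros)
  moreover have "1 * (\<Prod>x\<leftarrow>xs. z - x) + (\<Prod>x\<leftarrow>xs. z - x) * (\<Sum>x\<leftarrow>xs. 1 / (z - x)) * (z - a)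
      = (\<Prod>x\<leftarrow>a # xs. z - x) * (\<Sum>x\<leftarrow>a # xs. 1 / (z - x))"
    using Cons.prems by (simp add: distrib_left)
  ultimately show ?case by simp
qed simp

text \<open>Let \<open>f = exp g\<close>, and let \<open>P\<close> be the product of
  \<open>z - x\<close> over a list whose kernel sum is close to \<open>- deriv g\<close>. Then
  \<open>P * exp (- g)\<close> has a logarithm \<open>v\<close> with small derivative, so
  \<open>v\<close> is nearly constant and \<open>exp (- v z0) * P\<close> is close to
  \<open>f\<close>.\<close>

lemma polynomial_approximation_of_component:
  assumes D: "open D" "simply_connected D" "D \<noteq> {}" "bounded D"
    and \<Gamma>: "bounded \<Gamma>" and C: "C \<in> components (- closure \<Gamma>)" "bounded C" "D \<subseteq> C"
  shows "polynomial_approximation_set \<Gamma> D"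
  unfolding polynomial_approximation_set_def approximable_by_E_polynomials_def
proof (intro allI impI)
  fix f K and \<epsilon> :: real
  assume f: "f holomorphic_on D \<and> (\<forall>z\<in>D. f z \<noteq> 0)" and A: "compact K \<and> K \<subseteq> D \<and> \<epsilon> > 0"
  then have K: "compact K" "K \<subseteq> D" and \<epsilon>: "\<epsilon> > 0" by auto
  have DU: "D \<noteq> UNIV" using D(4) not_bounded_UNIV by metis
  have log: "\<exists>g. g holomorphic_on D \<and> (\<forall>z\<in>D. h z = exp (g z))" if "h holomorphic_on D" "\<And>z. z \<in> D \<Longrightarrow> h z \<noteq> 0" for h
    using simply_connected_eq_holomorphic_log[OF D(1)] D(2) that by blast
  obtain g where g: "g holomorphic_on D" "\<And>z. z \<in> D \<Longrightarrow> f z = exp (g z)" using log f by blast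
  have D\<Gamma>: "D \<inter> \<Gamma> = {}" using in_components_subset[OF C(1)] C(3) closure_subset[of \<Gamma>] by auto
  obtain \<phi> \<psi> where \<phi>: "\<phi> holomorphic_on D" and \<psi>: "\<psi> holomorphic_on ball 0 1"
    and \<phi>\<psi>: "\<And>z. z \<in> D \<Longrightarrow> \<phi> z \<in> ball 0 1 \<and> \<psi> (\<phi> z) = z"
    and \<psi>\<phi>: "\<And>z. z \<in> ball 0 1 \<Longrightarrow> \<psi> z \<in> D \<and> \<phi> (\<psi> z) = z"
    using simply_connected_eq_biholomorphic_to_disc[OF D(1)] D(2,3) DU by metis
  have "compact (\<phi> ` K)"
    using K \<phi> by (intro compact_continuous_image holomorphic_on_imp_continuous_on holomorphic_on_subset[OF \<phi>])
  moreover have "\<phi> ` K \<subseteq> ball 0 1" using \<phi>\<psi> K(2) by auto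
  ultimately obtain r where r: "0 < r" "r < 1" "\<phi> ` K \<subseteq> cball 0 r" by (rule compact_subset_unit_ball)
  have cb: "cball 0 r \<subseteq> (ball 0 1 :: complex set)" using r by auto
  \<comment> \<open>\<open>v\<close> is compared with its value at \<open>z0\<close> along segments
    in the disc, so its derivative has to be small on the image of a whole closed disc and not
    merely on \<open>K\<close>.\<close>
  define K' where "K' = \<psi> ` cball 0 r"
  have K': "compact K'" "K' \<subseteq> D"
    using cb \<psi>\<phi> unfolding K'_def
    by (auto intro!: compact_continuous_image holomorphic_on_imp_continuous_on holomorphic_on_subset[OF \<psi>])
  have "compact ((\<lambda>\<xi>. deriv \<psi> \<xi>) ` cball 0 r)"
    using cb by (intro compact_continuous_image holomorphic_on_imp_continuous_on
        holomorphic_on_subset[OF holomorphic_deriv[OF \<psi> open_ball]]) auto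
  then obtain B where B: "B > 0" "\<And>\<xi>. \<xi> \<in> cball 0 r \<Longrightarrow> cmod (deriv \<psi> \<xi>) \<le> B"
    using compact_imp_bounded[of "(\<lambda>\<xi>. deriv \<psi> \<xi>) ` cball 0 r"] unfolding bounded_pos by auto
  have "compact (f ` K)"
    using K f by (intro compact_continuous_image holomorphic_on_imp_continuous_on) (auto intro: holomorphic_on_subset)
  then obtain A where A: "A > 0" "\<And>z. z \<in> K \<Longrightarrow> cmod (f z) \<le> A"
    using compact_imp_bounded[of "f ` K"] unfolding bounded_pos by auto
  have "isCont exp (0::complex)" by (rule isCont_exp)
  then obtain s where s: "s > 0" "\<And>w::complex. cmod w < s \<Longrightarrow> cmod (exp w - 1) < \<epsilon> / A"
    unfolding continuous_at_eps_delta dist_norm using \<epsilon> A(1)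
    by (metis diff_zero divide_pos_pos exp_zero)
  \<comment> \<open>The derivative of \<open>v (\<psi> \<xi>)\<close> will be at most
    \<open>d * B = s/2\<close> on a disc of radius below \<open>1\<close>.\<close>
  define d where "d = s / (2 * B)"
  have d: "d > 0" using s B by (simp add: d_def)
  have "(\<lambda>z. - deriv g z) holomorphic_on D"
    using g(1) D(1) by (intro holomorphic_intros)
  then have "poly_approximable K' (\<lambda>z. - deriv g z)"
    by (intro runge_simply_connected[OF D(1-3) DU _ K'])
  then obtain xs where xs: "set xs \<subseteq> \<Gamma>" "\<And>z. z \<in> K' \<Longrightarrow> cmod ((\<Sum>x\<leftarrow>xs. 1 / (x - z)) - (- deriv g z)) < d"
    using kernel_sums_dense_component[OF \<Gamma> C(1,2) K'(1) _ _ d, of "\<lambda>z. - deriv g z"] K'(2) C(3) by blast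
  define P where "P = (\<lambda>z. \<Prod>x\<leftarrow>xs. z - x)"
  have ne: "z \<noteq> x" if "z \<in> D" "x \<in> set xs" for z x using that xs(1) D\<Gamma> by auto
  define h where "h = (\<lambda>z. P z * exp (- g z))"
  have dg: "(g has_field_derivative deriv g z) (at z)" if "z \<in> D" for z
    using g(1) D(1) that holomorphic_derivI by blast
  have dh: "(h has_field_derivative h z * ((\<Sum>x\<leftarrow>xs. 1 / (z - x)) - deriv g z)) (at z)" if z: "z \<in> D" for z
    unfolding h_def P_def
    by (rule derivative_eq_intros has_field_derivative_prod_list_linear dg ne z refl | assumption)+ (simp add: algebra_simps)
  have "h holomorphic_on D" using dh D(1) by (auto simp: holomorphic_on_open)
  moreover have "h z \<noteq> 0" if "z \<in> D" for z
    using ne[OF that] by (auto simp: h_def P_def prod_list_zero_iff)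
  ultimately obtain v where v: "v holomorphic_on D" "\<And>z. z \<in> D \<Longrightarrow> h z = exp (v z)" using log by blast
  have dv: "(v has_field_derivative ((\<Sum>x\<leftarrow>xs. 1 / (z - x)) - deriv g z)) (at z)" if z: "z \<in> D" for z
  proof -
    have *: "(v has_field_derivative deriv v z) (at z)" using v(1) D(1) z holomorphic_derivI by blast
    have "((\<lambda>z. exp (v z)) has_field_derivative exp (v z) * deriv v z) (at z)"
      by (rule DERIV_fun_exp[OF *])
    then have "(h has_field_derivative exp (v z) * deriv v z) (at z)"
      by (rule has_field_derivative_transform_within_open[OF _ D(1) z]) (use v(2) in auto)
    then have "exp (v z) * deriv v z = h z * ((\<Sum>x\<leftarrow>xs. 1 / (z - x)) - deriv g z)"
      using dh[OF z] by (rule DERIV_unique)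
    then have "deriv v z = (\<Sum>x\<leftarrow>xs. 1 / (z - x)) - deriv g z" using v(2)[OF z] by simp
    then show ?thesis using * by simp
  qed
  define z0 where "z0 = \<psi> 0"
  have small: "cmod (v z - v z0) < s" if z: "z \<in> K" for z
  proof -
    have \<phi>z: "\<phi> z \<in> cball 0 r" "\<psi> (\<phi> z) = z" using r(3) z \<phi>\<psi> K(2) by auto
    have "cmod ((\<lambda>\<xi>. v (\<psi> \<xi>)) (\<phi> z) - (\<lambda>\<xi>. v (\<psi> \<xi>)) 0) \<le> d * B * cmod (\<phi> z - 0)"
    proof (rule field_differentiable_bound[OF convex_cball])
      fix \<xi> :: complex assume \<xi>: "\<xi> \<in> cball 0 r"
      then have D\<xi>: "\<psi> \<xi> \<in> D" "\<psi> \<xi> \<in> K'" using \<psi>\<phi> cb by (auto simp: K'_def)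
      have d\<psi>: "(\<psi> has_field_derivative deriv \<psi> \<xi>) (at \<xi>)"
        using \<psi> \<xi> cb by (intro holomorphic_derivI[OF \<psi> open_ball]) auto
      show "((\<lambda>\<xi>. v (\<psi> \<xi>)) has_field_derivative
          ((\<Sum>x\<leftarrow>xs. 1 / (\<psi> \<xi> - x)) - deriv g (\<psi> \<xi>)) * deriv \<psi> \<xi>) (at \<xi> within cball 0 r)"
        by (rule DERIV_chain2[of v _ \<psi> \<xi>, OF dv[OF D\<xi>(1)] has_field_derivative_at_within[OF d\<psi>]])
      have "(\<Sum>x\<leftarrow>xs. 1 / (\<psi> \<xi> - x)) = - (\<Sum>x\<leftarrow>xs. 1 / (x - \<psi> \<xi>))"
        by (induction xs) (auto simp: minus_divide_right)
      then have "cmod ((\<Sum>x\<leftarrow>xs. 1 / (\<psi> \<xi> - x)) - deriv g (\<psi> \<xi>)) = cmod ((\<Sum>x\<leftarrow>xs. 1 / (x - \<psi> \<xi>)) - (- deriv g (\<psi> \<xi>)))"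
        using norm_minus_cancel[of "(\<Sum>x\<leftarrow>xs. 1 / (x - \<psi> \<xi>)) + deriv g (\<psi> \<xi>)"] by simp
      also have "\<dots> \<le> d" using xs(2)[OF D\<xi>(2)] by simp
      finally show "cmod (((\<Sum>x\<leftarrow>xs. 1 / (\<psi> \<xi> - x)) - deriv g (\<psi> \<xi>)) * deriv \<psi> \<xi>) \<le> d * B"
        unfolding norm_mult using B(2)[OF \<xi>] d by (intro mult_mono) auto
    qed (use \<phi>z r in auto)
    also have "\<dots> \<le> d * B * 1" using \<phi>z(1) r d B by (intro mult_left_mono) auto
    also have "\<dots> < s" using s B by (simp add: d_def)
    finally show ?thesis by (simp add: \<phi>z(2) z0_def)
  qed
  show "\<exists>p. E_polynomial \<Gamma> p \<and> (\<forall>z\<in>K. norm (f z - poly p z) < \<epsilon>)"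
  proof (intro exI[of _ "smult (exp (- v z0)) (\<Prod>x\<leftarrow>xs. [:- x, 1:])"] conjI ballI)
    show "E_polynomial \<Gamma> (smult (exp (- v z0)) (\<Prod>x\<leftarrow>xs. [:- x, 1:]))"
      using xs(1) by (auto simp: E_polynomial_def poly_prod_list_linear prod_list_zero_iff)
    fix z assume z: "z \<in> K"
    then have zD: "z \<in> D" using K by auto
    have "P z = h z * exp (g z)" by (simp add: h_def exp_minus)
    then have "poly (smult (exp (- v z0)) (\<Prod>x\<leftarrow>xs. [:- x, 1:])) z = f z * exp (v z - v z0)"
      using v(2)[OF zD] g(2)[OF zD] by (simp add: poly_prod_list_linear P_def exp_diff exp_minus field_simps)
    then have "f z - poly (smult (exp (- v z0)) (\<Prod>x\<leftarrow>xs. [:- x, 1:])) z = - (f z * (exp (v z - v z0) - 1))"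
      by (simp add: algebra_simps)
    then have "cmod (f z - poly (smult (exp (- v z0)) (\<Prod>x\<leftarrow>xs. [:- x, 1:])) z) = cmod (f z) * cmod (exp (v z - v z0) - 1)"
      by (simp add: norm_mult)
    also have "\<dots> \<le> A * cmod (exp (v z - v z0) - 1)" using A(2)[OF z] by (intro mult_right_mono) auto
    also have "\<dots> < \<epsilon>" using s(2)[OF small[OF z]] A(1) by (simp add: field_simps)
    finally show "norm (f z - poly (smult (exp (- v z0)) (\<Prod>x\<leftarrow>xs. [:- x, 1:])) z) < \<epsilon>" .
  qed
qed

section \<open>Neutral families\<close>

text \<open>An exhaustion of \<open>D\<close> by compact sets, with tolerances tending to
  \<open>0\<close>, yields a sequence of lists. Repetition makes a list as long as desired, so the
  lengths can be taken strictly increasing.\<close>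

lemma neutral_family_from_lists:
  assumes D: "open D"
    and lists: "\<And>K \<epsilon>. \<lbrakk>compact K; K \<subseteq> D; \<epsilon> > 0\<rbrakk> \<Longrightarrow>
      \<exists>xs. xs \<noteq> [] \<and> set xs \<subseteq> E \<and> (\<forall>z\<in>K. cmod (\<Sum>x\<leftarrow>xs. 1 / (x - z) ^ N) < \<epsilon>)"
  shows "contains_asymptotically_neutral_family N E D"
proof -
  obtain C :: "nat \<Rightarrow> complex set" where C: "\<And>n. compact (C n)" "\<And>n. C n \<subseteq> D" "\<And>K. \<lbrakk>compact K; K \<subseteq> D\<rbrakk> \<Longrightarrow> \<exists>m. \<forall>n\<ge>m. K \<subseteq> C n"
  proof (rule open_Union_compact_subsets[OF D])
    fix C :: "nat \<Rightarrow> complex set"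
    assume "\<And>n. compact (C n)" "\<And>n. C n \<subseteq> D" "\<And>K. \<lbrakk>compact K; K \<subseteq> D\<rbrakk> \<Longrightarrow> \<exists>m. \<forall>n\<ge>m. K \<subseteq> C n"
    then show thesis using that[of C] by blast
  qed
  define good where "good = (\<lambda>j xs. set xs \<subseteq> E \<and> (\<forall>z\<in>C j. cmod (\<Sum>x\<leftarrow>xs. 1 / (x - z) ^ N) < 1 / real (Suc j)))"
  have long: "\<exists>xs. good j xs \<and> m < length xs" for j m
  proof -
    \<comment> \<open>The list will be repeated \<open>Suc m\<close> times, so the tolerance is
      divided by this factor in advance.\<close>
    have pos: "1 / (real (Suc j) * real (Suc m)) > 0" by simp
    obtain xs where xs: "xs \<noteq> []" "set xs \<subseteq> E"
      "\<And>z. z \<in> C j \<Longrightarrow> cmod (\<Sum>x\<leftarrow>xs. 1 / (x - z) ^ N) < 1 / (real (Suc j) * real (Suc m))"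
      using lists[OF C(1)[of j] C(2)[of j] pos] by auto
    define ys where "ys = concat (replicate (Suc m) xs)"
    have sum: "(\<Sum>x\<leftarrow>concat (replicate k xs). f x) = of_nat k * (\<Sum>x\<leftarrow>xs. f x)" for f :: "complex \<Rightarrow> complex" and k
      by (induction k) (auto simp: algebra_simps)
    have "length (concat (replicate k xs)) = k * length xs" for k by (induction k) auto
    then have "length ys = Suc m * length xs" unfolding ys_def .
    moreover have "length xs \<ge> 1" using xs(1) by (cases xs) auto
    ultimately have "length ys > m" by (metis Suc_le_eq mult_le_mono2 nat_mult_1_right)
    moreover have "cmod (\<Sum>x\<leftarrow>ys. 1 / (x - z) ^ N) < 1 / real (Suc j)" if "z \<in> C j" for z
    proof -
      have "cmod (\<Sum>x\<leftarrow>ys. 1 / (x - z) ^ N) = real (Suc m) * cmod (\<Sum>x\<leftarrow>xs. 1 / (x - z) ^ N)"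
        unfolding ys_def sum norm_mult by (simp only: norm_of_nat)
      also have "\<dots> < real (Suc m) * (1 / (real (Suc j) * real (Suc m)))"
        using xs(3)[OF that] by (intro mult_strict_left_mono) auto
      finally show ?thesis by simp
    qed
    moreover have "set ys \<subseteq> E" using xs(2) by (auto simp: ys_def)
    ultimately show ?thesis by (auto simp: good_def)
  qed
  have "\<exists>X. \<forall>j. good j (X j) \<and> length (X j) < length (X (Suc j))"
    using long by (intro dependent_nat_choice) blast+
  then obtain X where X: "\<And>j. good j (X j)" "\<And>j. length (X j) < length (X (Suc j))" by blast
  define nn where "nn = (\<lambda>j. length (X j))"
  have mono: "strict_mono nn" unfolding nn_def using X(2) by (simp add: strict_mono_Suc_iff)
  \<comment> \<open>A family is indexed by the length \<open>n\<close> and not by \<open>j\<close>;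
    the lengths \<open>nn j\<close> are distinct, so \<open>n\<close> determines
    \<open>j\<close>.\<close>
  define \<zeta> where "\<zeta> = (\<lambda>n k. X (inv nn n) ! k)"
  have \<zeta>: "\<zeta> (nn j) k = X j ! k" for j k
    using strict_mono_imp_inj_on[OF mono] by (simp add: \<zeta>_def)
  have sum: "(\<Sum>k<nn j. 1 / (\<zeta> (nn j) k - z) ^ N) = (\<Sum>x\<leftarrow>X j. 1 / (x - z) ^ N)" for j z
  proof -
    have len: "length (X j) = nn j" by (simp add: nn_def)
    show ?thesis by (simp add: \<zeta> sum_list_sum_nth atLeast0LessThan len)
  qed
  have "asymptotically_neutral N D nn \<zeta>"
    unfolding asymptotically_neutral_def sum
  proof (intro conjI allI impI)
    show "filterlim nn sequentially sequentially" using mono by (rule filterlim_subseq)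
    fix K assume "compact K \<and> K \<subseteq> D"
    then obtain m where m: "\<And>n. n \<ge> m \<Longrightarrow> K \<subseteq> C n" using C(3) by blast
    show "uniform_limit K (\<lambda>j z. \<Sum>x\<leftarrow>X j. 1 / (x - z) ^ N) (\<lambda>z. 0) sequentially"
    proof (rule uniform_limitI)
      fix e :: real assume "e > 0"
      then obtain l where l: "1 / real (Suc l) < e" using nat_approx_posE by blast
      have "\<forall>z\<in>K. dist (\<Sum>x\<leftarrow>X j. 1 / (x - z) ^ N) 0 < e" if j: "j \<ge> max m l" for j
      proof
        fix z assume "z \<in> K"
        then have "z \<in> C j" using m j by auto
        then have "cmod (\<Sum>x\<leftarrow>X j. 1 / (x - z) ^ N) < 1 / real (Suc j)" using X(1)[of j] by (auto simp: good_def)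
        also have "\<dots> \<le> 1 / real (Suc l)" using j by (intro divide_left_mono) auto
        finally show "dist (\<Sum>x\<leftarrow>X j. 1 / (x - z) ^ N) 0 < e" using l by simp
      qed
      then show "\<forall>\<^sub>F j in sequentially. \<forall>z\<in>K. dist (\<Sum>x\<leftarrow>X j. 1 / (x - z) ^ N) 0 < e"
        unfolding eventually_sequentially by blast
    qed
  qed
  moreover have "\<forall>j. \<forall>k<nn j. \<zeta> (nn j) k \<in> E"
  proof (intro allI impI)
    fix j k assume "k < nn j"
    then have "X j ! k \<in> set (X j)" by (simp add: nn_def)
    then show "\<zeta> (nn j) k \<in> E" using X(1)[of j] by (auto simp: \<zeta> good_def)
  qed
  ultimately show ?thesis unfolding contains_asymptotically_neutral_family_def by blast
qed

section \<open>Power sums of zeros as derivatives of a logarithm\<close>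

lemma has_field_derivative_sum_list:
  assumes "\<And>x. x \<in> set xs \<Longrightarrow> (f x has_field_derivative f' x) (at w within S)"
  shows "((\<lambda>w. \<Sum>x\<leftarrow>xs. f x w) has_field_derivative (\<Sum>x\<leftarrow>xs. f' x)) (at w within S)"
  using assms
proof (induction xs)
  case (Cons a xs)
  then have "((\<lambda>w. f a w + (\<Sum>x\<leftarrow>xs. f x w)) has_field_derivative f' a + (\<Sum>x\<leftarrow>xs. f' x)) (at w within S)"
    by (intro DERIV_add) auto
  then show ?case by simp
qed simp

lemma higher_deriv_sum_list_reciprocal:
  fixes F :: "complex \<Rightarrow> complex"
  assumes S: "open S" and eq: "\<And>w. w \<in> S \<Longrightarrow> F w = (\<Sum>x\<leftarrow>xs. 1 / (w - x))"
    and ne: "S \<inter> set xs = {}" and w: "w \<in> S"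
  shows "(deriv ^^ n) F w = (-1) ^ n * fact n * (\<Sum>x\<leftarrow>xs. 1 / (w - x) ^ Suc n)"
  using w
proof (induction n arbitrary: w)
  case (Suc n)
  have "((\<lambda>w. \<Sum>x\<leftarrow>xs. 1 / (w - x) ^ Suc n) has_field_derivative (\<Sum>x\<leftarrow>xs. - of_nat (Suc n) / (w - x) ^ Suc (Suc n))) (at w)"
  proof (rule has_field_derivative_sum_list)
    fix x assume "x \<in> set xs"
    then have "w - x \<noteq> 0" using ne Suc.prems by auto
    then have "((\<lambda>w. inverse (w - x)) has_field_derivative - (inverse (w - x) ^ 2)) (at w)"
      by (auto intro!: derivative_eq_intros simp: power2_eq_square)
    from DERIV_power_Suc[OF this, of n] show "((\<lambda>w. 1 / (w - x) ^ Suc n) has_field_derivative - of_nat (Suc n) / (w - x) ^ Suc (Suc n)) (at w)"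
      by (simp add: power_inverse divide_inverse power2_eq_square mult_ac ring_distribs flip: inverse_mult_distrib)
  qed
  then have "((\<lambda>w. (-1) ^ n * fact n * (\<Sum>x\<leftarrow>xs. 1 / (w - x) ^ Suc n)) has_field_derivative
      (-1) ^ n * fact n * (\<Sum>x\<leftarrow>xs. - of_nat (Suc n) / (w - x) ^ Suc (Suc n))) (at w)"
    by (rule DERIV_cmult)
  then have "((deriv ^^ n) F has_field_derivative
      (-1) ^ n * fact n * (\<Sum>x\<leftarrow>xs. - of_nat (Suc n) / (w - x) ^ Suc (Suc n))) (at w)"
    by (rule has_field_derivative_transform_within_open[OF _ S Suc.prems]) (use Suc.IH in auto)
  moreover have "(\<Sum>x\<leftarrow>xs. - of_nat (Suc n) / (w - x) ^ Suc (Suc n)) = - of_nat (Suc n) * (\<Sum>x\<leftarrow>xs. 1 / (w - x) ^ Suc (Suc n))"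
    by (subst sum_list_const_mult[symmetric]) simp
  ultimately have "deriv ((deriv ^^ n) F) w = (-1) ^ n * fact n * (- of_nat (Suc n) * (\<Sum>x\<leftarrow>xs. 1 / (w - x) ^ Suc (Suc n)))"
    by (simp only: DERIV_imp_deriv)
  then show ?case by (simp add: algebra_simps del: of_nat_Suc)
qed (use eq in simp)

lemma zero_list_polynomial:
  fixes p :: "complex poly"
  assumes "p \<noteq> 0"
  obtains c xs where "c \<noteq> 0" "\<And>z. poly p z = c * (\<Prod>x\<leftarrow>xs. z - x)" "\<And>x. x \<in> set xs \<Longrightarrow> poly p x = 0"
proof -
  obtain root where root: "smult (lead_coeff p) (\<Prod>i<degree p. [:- root i, 1:]) = p"
    using complex_poly_decompose' by blast
  have eq: "poly p z = lead_coeff p * (\<Prod>x\<leftarrow>map root [0..<degree p]. z - x)" for z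
    by (subst root[symmetric]) (simp add: poly_prod prod.list_conv_set_nth atLeast0LessThan)
  show ?thesis
  proof (rule that[of "lead_coeff p" "map root [0..<degree p]"])
    fix x assume "x \<in> set (map root [0..<degree p])"
    then show "poly p x = 0" by (subst eq) (force simp: prod_list_zero_iff)
  qed (use assms eq in auto)
qed

lemma power_sum_small_from_approximation:
  assumes D: "open D" and E: "E \<inter> D = {}" and \<zeta>: "\<zeta> \<in> E" and N: "N \<ge> 1"
    and approx: "approximable_by_E_polynomials E D (\<lambda>z. 1 / (\<zeta> - z) ^ N)"
    and K: "compact K" "K \<subseteq> D" and \<epsilon>: "\<epsilon> > 0"
  shows "\<exists>xs. xs \<noteq> [] \<and> set xs \<subseteq> E \<and> (\<forall>z\<in>K. cmod (\<Sum>x\<leftarrow>xs. 1 / (x - z) ^ N) < \<epsilon>)"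
proof (cases "K = {}")
  case True
  then show ?thesis using \<zeta> by (intro exI[of _ "[\<zeta>]"]) auto
next
  case False
  obtain d where d: "d > 0" "(\<Union>x\<in>K. cball x d) \<subseteq> D"
    using compact_subset_open_imp_cball_epsilon_subset[OF K(1) D K(2)] by blast
  \<comment> \<open>The enlargement leaves a disc of radius \<open>d\<close> around each point of
    \<open>K\<close>, as the Cauchy estimate requires.\<close>
  define K' where "K' = (\<Union>x\<in>K. cball x d)"
  have K': "compact K'" "K' \<subseteq> D" using compact_minkowski_sum_cball[OF K(1)] d(2) by (auto simp: K'_def)
  \<comment> \<open>If the logarithm is bounded by \<open>B\<close>, the Cauchy estimate bounds its
    \<open>N\<close>-th derivative by \<open>fact N * B / d ^ N = \<epsilon>/2\<close>.\<close>
  define B where "B = \<epsilon> * d ^ N / (2 * fact N)"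
  have B: "B > 0" using \<epsilon> d(1) by (simp add: B_def)
  have "isCont Ln 1" by (intro continuous_at_Ln) auto
  then obtain s0 where s0: "s0 > 0" "\<And>w. cmod (w - 1) < s0 \<Longrightarrow> cmod (Ln w) < B"
    unfolding continuous_at_eps_delta dist_norm using B by (metis Ln_1 diff_zero)
  \<comment> \<open>The bound \<open>1/2\<close> keeps \<open>k * P\<close> in the right half-plane,
    where \<open>Ln\<close> is holomorphic.\<close>
  define s where "s = min s0 (1/2)"
  have s: "s > 0" "s \<le> s0" "s \<le> 1/2" using s0 by (auto simp: s_def)
  have "compact ((\<lambda>z. (\<zeta> - z) ^ N) ` K')"
    by (intro compact_continuous_image continuous_intros K')
  then obtain A where A: "A > 0" "\<And>z. z \<in> K' \<Longrightarrow> cmod ((\<zeta> - z) ^ N) \<le> A"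
    using compact_imp_bounded[of "(\<lambda>z. (\<zeta> - z) ^ N) ` K'"] unfolding bounded_pos by auto
  have "s / A > 0" using s A by simp
  then obtain p where p: "E_polynomial E p" "\<And>z. z \<in> K' \<Longrightarrow> cmod (1 / (\<zeta> - z) ^ N - poly p z) < s / A"
    using approx[unfolded approximable_by_E_polynomials_def, rule_format, of K' "s / A"] K' by auto
  \<comment> \<open>The zero polynomial vanishes on all of \<open>D\<close>, which is disjoint from
    \<open>E\<close> and nonempty because \<open>K\<close> is.\<close>
  have "p \<noteq> 0"
  proof
    assume "p = 0"
    then have "D \<subseteq> E" using p(1) by (auto simp: E_polynomial_def)
    then show False using E False K(2) by auto
  qed
  then obtain c xs0 where c: "c \<noteq> 0" "\<And>z. poly p z = c * (\<Prod>x\<leftarrow>xs0. z - x)" "\<And>x. x \<in> set xs0 \<Longrightarrow> poly p x = 0"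
    by (rule zero_list_polynomial) (rule that; blast)
  \<comment> \<open>The \<open>N\<close> copies of \<open>\<zeta>\<close> are the zeros of the
    factor \<open>(\<zeta> - z) ^ N\<close> that multiplies \<open>p\<close>; they also make the
    list nonempty.\<close>
  define xs where "xs = xs0 @ replicate N \<zeta>"
  have xsE: "set xs \<subseteq> E" using c(3) p(1) \<zeta> by (auto simp: xs_def E_polynomial_def)
  define P where "P = (\<lambda>z. \<Prod>x\<leftarrow>xs. z - x)"
  define k where "k = c * (-1) ^ N"
  have near1: "cmod (k * P z - 1) < s" if z: "z \<in> K'" for z
  proof -
    have ne: "\<zeta> - z \<noteq> 0" using z K'(2) \<zeta> E by auto
    have "(\<zeta> - z) ^ N = (-1) ^ N * (z - \<zeta>) ^ N" by (simp flip: power_mult_distrib)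
    then have "k * P z = poly p z * (\<zeta> - z) ^ N"
      by (simp add: k_def P_def xs_def c(2) map_replicate prod_list_replicate)
    then have "k * P z - 1 = (\<zeta> - z) ^ N * (poly p z - 1 / (\<zeta> - z) ^ N)"
      using ne by (simp add: right_diff_distrib)
    then have "cmod (k * P z - 1) = cmod ((\<zeta> - z) ^ N) * cmod (1 / (\<zeta> - z) ^ N - poly p z)"
      by (simp add: norm_mult norm_minus_commute)
    also have "\<dots> \<le> A * cmod (1 / (\<zeta> - z) ^ N - poly p z)" using A(2)[OF z] by (intro mult_right_mono) auto
    also have "\<dots> < s" using p(2)[OF z] A(1) by (simp add: field_simps)
    finally show ?thesis .
  qed
  show ?thesis
  proof (intro exI[of _ xs] conjI ballI xsE)
    show "xs \<noteq> []" using N by (auto simp: xs_def)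
    fix z assume z: "z \<in> K"
    define S where "S = ball z d"
    have SK': "cball z d \<subseteq> K'" using z by (auto simp: K'_def)
    have pos: "Re (k * P w) > 0" if "w \<in> cball z d" for w
      using near1[of w] SK' that s(3) abs_Re_le_cmod[of "k * P w - 1"] by auto
    have ne: "w \<noteq> x" if "w \<in> cball z d" "x \<in> set xs" for w x
      using that SK' K'(2) xsE E by blast
    define F where "F = (\<lambda>w. Ln (k * P w))"
    have dF: "(F has_field_derivative (\<Sum>x\<leftarrow>xs. 1 / (w - x))) (at w)" if w: "w \<in> cball z d" for w
    proof -
      have nz: "k * P w \<noteq> 0" "k * P w \<notin> \<real>\<^sub>\<le>\<^sub>0" using pos[OF w] by (auto simp: complex_nonpos_Reals_iff)
      have "(P has_field_derivative P w * (\<Sum>x\<leftarrow>xs. 1 / (w - x))) (at w)"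
        unfolding P_def using ne[OF w] by (intro has_field_derivative_prod_list_linear)
      then have "((\<lambda>w. k * P w) has_field_derivative k * (P w * (\<Sum>x\<leftarrow>xs. 1 / (w - x)))) (at w)"
        by (rule DERIV_cmult)
      then have "(F has_field_derivative inverse (k * P w) * (k * (P w * (\<Sum>x\<leftarrow>xs. 1 / (w - x))))) (at w)"
        unfolding F_def by (rule DERIV_chain2[of Ln _ "\<lambda>w. k * P w" w, OF has_field_derivative_Ln[OF nz(2)]])
      moreover have "inverse (k * P w) * (k * (P w * (\<Sum>x\<leftarrow>xs. 1 / (w - x)))) = (\<Sum>x\<leftarrow>xs. 1 / (w - x))"
        using nz(1) by (simp add: field_simps)
      ultimately show ?thesis by (simp only:)
    qed
    have "F holomorphic_on ball z d"
      using dF ball_subset_cball by (force simp: holomorphic_on_open)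
    moreover have "continuous_on (cball z d) F"
      using dF by (auto intro!: continuous_at_imp_continuous_on DERIV_isCont)
    moreover have "F w \<in> ball 0 B" if "w \<in> ball z d" for w
      using s0(2)[of "k * P w"] near1[of w] that SK' s(2) by (force simp: F_def)
    ultimately have bound: "cmod ((deriv ^^ N) F z) \<le> fact N * B / d ^ N"
      using d(1) N by (intro Cauchy_higher_deriv_bound[of F z d 0 B N]) auto
    obtain n where n: "N = Suc n" using N by (cases N) auto
    \<comment> \<open>One derivative turns \<open>Ln\<close> into the sum of the
      \<open>1 / (w - x)\<close>; the other \<open>n = N - 1\<close> produce the \<open>N\<close>-th
      powers and a factor \<open>fact n \<ge> 1\<close>.\<close>
    have "(deriv ^^ N) F z = (deriv ^^ n) (deriv F) z"
      by (simp add: n funpow_swap1)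
    also have "\<dots> = (-1) ^ n * fact n * (\<Sum>x\<leftarrow>xs. 1 / (z - x) ^ N)"
      unfolding n
    proof (rule higher_deriv_sum_list_reciprocal[of "ball z d"])
      show "deriv F w = (\<Sum>x\<leftarrow>xs. 1 / (w - x))" if "w \<in> ball z d" for w
        using dF[of w] that by (intro DERIV_imp_deriv) auto
      show "ball z d \<inter> set xs = {}" using ne ball_subset_cball by blast
    qed (use d in auto)
    finally have "cmod ((deriv ^^ N) F z) = fact n * cmod (\<Sum>x\<leftarrow>xs. 1 / (z - x) ^ N)"
      by (simp add: norm_mult norm_power)
    moreover have "(\<Sum>x\<leftarrow>xs. 1 / (x - z) ^ N) = (-1) ^ N * (\<Sum>x\<leftarrow>xs. 1 / (z - x) ^ N)"
    proof -
      have "1 / (x - z) ^ N = (-1) ^ N * (1 / (z - x) ^ N)" for x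
      proof -
        have "(x - z) ^ N = (-1) ^ N * (z - x) ^ N" by (simp flip: power_mult_distrib)
        then show ?thesis by (cases "even N") auto
      qed
      then have "map (\<lambda>x. 1 / (x - z) ^ N) xs = map (\<lambda>x. (-1) ^ N * (1 / (z - x) ^ N)) xs"
        by (intro map_cong) auto
      then show ?thesis by (simp only: sum_list_const_mult)
    qed
    ultimately have "fact n * cmod (\<Sum>x\<leftarrow>xs. 1 / (x - z) ^ N) \<le> fact N * B / d ^ N"
      using bound by (simp add: norm_mult norm_power)
    also have "fact N * B / d ^ N < \<epsilon>" using d(1) \<epsilon> by (simp add: B_def)
    finally have "fact n * cmod (\<Sum>x\<leftarrow>xs. 1 / (x - z) ^ N) < \<epsilon>" .
    moreover have "1 * cmod (\<Sum>x\<leftarrow>xs. 1 / (x - z) ^ N) \<le> fact n * cmod (\<Sum>x\<leftarrow>xs. 1 / (x - z) ^ N)"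
      by (intro mult_right_mono fact_ge_1 norm_ge_zero)
    ultimately show "cmod (\<Sum>x\<leftarrow>xs. 1 / (x - z) ^ N) < \<epsilon>" unfolding mult_1 by (rule le_less_trans[rotated])
  qed
qed

text \<open>Neutrality is known on \<open>D\<close> only. By Montel's theorem and the identity
  theorem a limit of the averages vanishes on all of \<open>C\<close>; if \<open>C\<close> were
  unbounded, this would include points far from \<open>E\<close>, where the averages are visibly not
  small.\<close>

lemma bounded_component_of_neutral_family:
  assumes D: "open D" "D \<noteq> {}" and E: "bounded E"
    and C: "C \<in> components (- closure E)" "D \<subseteq> C"
    and \<zeta>: "\<And>j k. k < nn j \<Longrightarrow> \<zeta> (nn j) k \<in> E" and neutral: "asymptotically_neutral N D nn \<zeta>"
  shows "bounded C"
proof (rule ccontr)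
  assume unb: "\<not> bounded C"
  have openC: "open C" using C(1) by (rule open_components[rotated]) auto
  have connC: "connected C" using C(1) by (rule in_components_connected)
  \<comment> \<open>The averages, unlike the sums, are bounded uniformly in \<open>j\<close> on
    compact subsets of \<open>C\<close>. For \<open>nn j = 0\<close> the quotient is
    \<open>0\<close> by convention.\<close>
  define f where "f = (\<lambda>j z. (\<Sum>k<nn j. 1 / (\<zeta> (nn j) k - z) ^ N) / nn j)"
  have CE: "x \<noteq> z" if "x \<in> E" "z \<in> C" for x z
    using that in_components_subset[OF C(1)] closure_subset[of E] by auto
  have hol: "f j holomorphic_on C" for j
    unfolding f_def
  proof (cases "nn j = 0")
    case False
    then show "(\<lambda>z. (\<Sum>k<nn j. 1 / (\<zeta> (nn j) k - z) ^ N) / nn j) holomorphic_on C"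
      using CE[OF \<zeta>] by (intro holomorphic_intros) auto
  qed simp
  have bnd: "\<exists>B. \<forall>h\<in>range f. \<forall>z\<in>K. cmod (h z) \<le> B" if K: "compact K" "K \<subseteq> C" for K
  proof -
    have "closure E \<inter> K = {}" using in_components_subset[OF C(1)] K(2) by auto
    then obtain \<delta> where \<delta>: "\<delta> > 0" "\<And>x z. x \<in> closure E \<Longrightarrow> z \<in> K \<Longrightarrow> cmod (x - z) \<ge> \<delta>"
      using separate_compact_closed[of "closure E" K] E K(1) compact_imp_closed[OF K(1)] unfolding dist_norm
      by (metis compact_closure)
    have "cmod (f j z) \<le> 1 / \<delta> ^ N" if z: "z \<in> K" for j z
    proof -
      have "cmod (\<Sum>k<nn j. 1 / (\<zeta> (nn j) k - z) ^ N) \<le> (\<Sum>k<nn j. 1 / \<delta> ^ N)"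
      proof (rule sum_norm_le)
        fix k assume "k \<in> {..<nn j}"
        then have "\<zeta> (nn j) k \<in> closure E" using \<zeta>[of k j] closure_subset[of E] by auto
        then have "cmod (\<zeta> (nn j) k - z) \<ge> \<delta>" using z by (rule \<delta>(2))
        then show "cmod (1 / (\<zeta> (nn j) k - z) ^ N) \<le> 1 / \<delta> ^ N"
          unfolding norm_divide norm_power using \<delta>(1) by (intro frac_le power_mono) auto
      qed
      then show ?thesis using \<delta>(1) by (cases "nn j = 0") (auto simp: f_def norm_divide divide_simps)
    qed
    then show ?thesis by blast
  qed
  obtain g r where g: "g holomorphic_on C" "strict_mono r" "\<And>z. z \<in> C \<Longrightarrow> (\<lambda>n. f (r n) z) \<longlonglongrightarrow> g z"
    by (rule Montel[OF openC, of "range f" f]) (use hol bnd in auto)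
  have nn: "filterlim nn at_top sequentially" using neutral by (simp add: asymptotically_neutral_def)
  have nnr: "filterlim (\<lambda>n. nn (r n)) at_top sequentially"
    using filterlim_compose[OF nn filterlim_subseq[OF g(2)]] .
  have gD: "g z = 0" if z: "z \<in> D" for z
  proof -
    have "compact {z} \<and> {z} \<subseteq> D" using z by simp
    then have "uniform_limit {z} (\<lambda>j z. \<Sum>k<nn j. 1 / (\<zeta> (nn j) k - z) ^ N) (\<lambda>z. 0) sequentially"
      using neutral unfolding asymptotically_neutral_def by blast
    then have "(\<lambda>j. \<Sum>k<nn j. 1 / (\<zeta> (nn j) k - z) ^ N) \<longlonglongrightarrow> 0"
      by (rule tendsto_uniform_limitI) simp
    then have "(\<lambda>j. f j z) \<longlonglongrightarrow> 0"
    proof (rule Lim_null_comparison[rotated, OF tendsto_norm_zero])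
      show "\<forall>\<^sub>F j in sequentially. norm (f j z) \<le> cmod (\<Sum>k<nn j. 1 / (\<zeta> (nn j) k - z) ^ N)"
      proof (intro always_eventually allI)
        fix j
        show "norm (f j z) \<le> cmod (\<Sum>k<nn j. 1 / (\<zeta> (nn j) k - z) ^ N)"
        proof (cases "nn j = 0")
          case False
          then have "real (nn j) \<ge> 1" by simp
          then show ?thesis using mult_left_mono[of 1 "real (nn j)" "cmod (\<Sum>k<nn j. 1 / (\<zeta> (nn j) k - z) ^ N)"]
            by (simp add: f_def norm_divide divide_simps)
        qed (simp add: f_def)
      qed
    qed
    then have "(\<lambda>n. f (r n) z) \<longlonglongrightarrow> 0" using LIMSEQ_subseq_LIMSEQ[OF _ g(2)] by (auto simp: o_def)
    then show ?thesis using g(3)[of z] z C(2) LIMSEQ_unique by blast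
  qed
  have gC: "g z = 0" if z: "z \<in> C" for z
    using analytic_continuation_open[OF D(1) openC D(2) connC C(2) g(1) holomorphic_on_const gD z] .
  \<comment> \<open>If \<open>cmod z > B / s\<close>, every quotient of a point of \<open>E\<close>
    by \<open>z\<close> has modulus below \<open>s\<close>, so each summand times
    \<open>(- z) ^ N\<close> is within \<open>1/2\<close> of \<open>1\<close>. The same holds for
    the averages and their limit, which therefore is not \<open>0\<close>.\<close>
  have "isCont (\<lambda>u::complex. 1 / (1 - u) ^ N) 0" by (intro continuous_intros) auto
  then obtain s where s: "s > 0" "\<And>u::complex. cmod u < s \<Longrightarrow> cmod (1 / (1 - u) ^ N - 1) < 1/2"
    unfolding continuous_at_eps_delta dist_norm
    by (metis diff_zero div_by_1 half_gt_zero_iff power_one zero_less_one)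
  obtain B where B: "B > 0" "\<And>x. x \<in> E \<Longrightarrow> cmod x \<le> B" using E unfolding bounded_pos by blast
  obtain z where z: "z \<in> C" "cmod z > B / s" using unb unfolding bounded_iff by (meson not_le)
  have "B / s > 0" using B s by simp
  then have z0: "z \<noteq> 0" using z(2) by auto
  have one: "cmod ((- z) ^ N * f j z - 1) \<le> 1/2" if j: "nn j > 0" for j
  proof -
    define w where "w = (\<lambda>k. \<zeta> (nn j) k / z)"
    have "(- z) ^ N * f j z - 1 = (\<Sum>k<nn j. (- z) ^ N * (1 / (\<zeta> (nn j) k - z) ^ N) - 1) / nn j"
      using j by (simp add: f_def sum_subtractf sum_distrib_left diff_divide_distrib)
    also have "cmod \<dots> \<le> (\<Sum>k<nn j. 1/2) / nn j"
      unfolding norm_divide norm_of_nat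
    proof (intro divide_right_mono sum_norm_le)
      fix k assume "k \<in> {..<nn j}"
      then have k: "\<zeta> (nn j) k \<in> E" using \<zeta> by auto
      have "cmod (w k) \<le> B / cmod z" unfolding w_def norm_divide using B(2)[OF k] by (intro divide_right_mono) auto
      also have "\<dots> < s" using z(2) s(1) z0 by (simp add: field_simps)
      finally have "cmod (1 / (1 - w k) ^ N - 1) < 1/2" by (rule s(2))
      moreover have "(- z) ^ N * (1 / (\<zeta> (nn j) k - z) ^ N) = 1 / (1 - w k) ^ N"
      proof -
        have "\<zeta> (nn j) k - z = (- z) * (1 - w k)" using z0 by (simp add: w_def field_simps)
        then have "(\<zeta> (nn j) k - z) ^ N = (- z) ^ N * (1 - w k) ^ N" by (simp only: power_mult_distrib)
        then show ?thesis using z0 by simp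
      qed
      ultimately show "cmod ((- z) ^ N * (1 / (\<zeta> (nn j) k - z) ^ N) - 1) \<le> 1 / 2" by simp
    qed auto
    also have "\<dots> = 1/2" using j by simp
    finally show ?thesis .
  qed
  have "(\<lambda>n. cmod ((- z) ^ N * f (r n) z - 1)) \<longlonglongrightarrow> cmod ((- z) ^ N * g z - 1)"
    by (intro tendsto_intros g(3) z)
  then have "cmod ((- z) ^ N * g z - 1) \<le> 1/2"
  proof (rule tendsto_upperbound)
    show "\<forall>\<^sub>F n in sequentially. cmod ((- z) ^ N * f (r n) z - 1) \<le> 1 / 2"
      using filterlim_at_top[THEN iffD1, OF nnr, rule_format, of 1] by eventually_elim (rule one, simp)
  qed simp
  then show False using gC[OF z(1)] by simp
qed

theorem theorem1p2:
  fixes D \<Gamma> :: "complex set" and N :: nat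
  assumes "open D" and "connected D" and "D \<noteq> {}"
    and "simply_connected D" and "bounded D"
    and "bounded \<Gamma>" and "\<Gamma> \<noteq> {}" and "\<Gamma> \<inter> D = {}"
    and "N \<ge> 1"
  shows "(polynomial_approximation_set \<Gamma> D \<longleftrightarrow>
            (\<forall>\<zeta>\<in>\<Gamma>. approximable_by_E_polynomials \<Gamma> D (\<lambda>z. 1 / (\<zeta> - z) ^ N)))
       \<and> ((\<forall>\<zeta>\<in>\<Gamma>. approximable_by_E_polynomials \<Gamma> D (\<lambda>z. 1 / (\<zeta> - z) ^ N)) \<longleftrightarrow>
            contains_asymptotically_neutral_family N \<Gamma> D)
       \<and> (contains_asymptotically_neutral_family N \<Gamma> D \<longleftrightarrow>
            divides_plane (closure \<Gamma>) \<and>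
            (\<exists>C \<in> components (- closure \<Gamma>). bounded C \<and> D \<subseteq> C))"
proof -
  define ii where "ii \<longleftrightarrow> (\<forall>\<zeta>\<in>\<Gamma>. approximable_by_E_polynomials \<Gamma> D (\<lambda>z. 1 / (\<zeta> - z) ^ N))"
  define iv where "iv \<longleftrightarrow> divides_plane (closure \<Gamma>) \<and> (\<exists>C \<in> components (- closure \<Gamma>). bounded C \<and> D \<subseteq> C)"
  have i_ii: "ii" if "polynomial_approximation_set \<Gamma> D"
    unfolding ii_def
  proof
    fix \<zeta> assume "\<zeta> \<in> \<Gamma>"
    then have "\<zeta> - z \<noteq> 0" if "z \<in> D" for z using that assms(8) by auto
    then have "(\<lambda>z. 1 / (\<zeta> - z) ^ N) holomorphic_on D \<and> (\<forall>z\<in>D. 1 / (\<zeta> - z) ^ N \<noteq> 0)"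
      by (intro conjI holomorphic_intros) auto
    then show "approximable_by_E_polynomials \<Gamma> D (\<lambda>z. 1 / (\<zeta> - z) ^ N)"
      using that unfolding polynomial_approximation_set_def by blast
  qed
  have ii_iii: "contains_asymptotically_neutral_family N \<Gamma> D" if ii
  proof -
    \<comment> \<open>One point is enough: the approximation of a single kernel already produces the
      whole family.\<close>
    obtain \<zeta> where \<zeta>: "\<zeta> \<in> \<Gamma>" using assms(7) by auto
    then have "approximable_by_E_polynomials \<Gamma> D (\<lambda>z. 1 / (\<zeta> - z) ^ N)" using that by (simp add: ii_def)
    from power_sum_small_from_approximation[OF assms(1,8) \<zeta> assms(9) this]
    show ?thesis by (intro neutral_family_from_lists assms(1)) blast
  qed
  have iii_iv: iv if "contains_asymptotically_neutral_family N \<Gamma> D"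
  proof -
    from that[unfolded contains_asymptotically_neutral_family_def] obtain nn where
      "\<exists>\<zeta>. (\<forall>j. \<forall>k<nn j. \<zeta> (nn j) k \<in> \<Gamma>) \<and> asymptotically_neutral N D nn \<zeta>" ..
    then obtain \<zeta> where *: "(\<forall>j. \<forall>k<nn j. \<zeta> (nn j) k \<in> \<Gamma>) \<and> asymptotically_neutral N D nn \<zeta>" ..
    then have neutral: "asymptotically_neutral N D nn \<zeta>" ..
    from * have \<zeta>: "\<zeta> (nn j) k \<in> \<Gamma>" if "k < nn j" for j k using that by simp
    have "D \<inter> closure \<Gamma> = {}"
      using assms(1,8) by (simp add: open_Int_closure_eq_empty Int_commute)
    then have sub: "D \<subseteq> - closure \<Gamma>" by auto
    then have "- closure \<Gamma> \<noteq> {}" using assms(3) by auto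
    from exists_component_superset[OF sub this assms(2)]
    obtain C where C: "C \<in> components (- closure \<Gamma>)" "D \<subseteq> C" by auto
    have bC: "bounded C"
      using bounded_component_of_neutral_family[OF assms(1,3,6) C \<zeta> neutral] .
    \<comment> \<open>Were the complement connected, it would coincide with \<open>C\<close> and be
      bounded, although it is the complement of a bounded set.\<close>
    moreover have "\<not> connected (- closure \<Gamma>)"
    proof
      assume "connected (- closure \<Gamma>)"
      then have "C = - closure \<Gamma>"
        using C(1) \<open>- closure \<Gamma> \<noteq> {}\<close> unfolding in_components_maximal by auto
      then show False
        using bC assms(6) cobounded_imp_unbounded[of "closure \<Gamma>"] bounded_closure by auto
    qed
    ultimately show ?thesis using C unfolding iv_def divides_plane_def by blast
  qed
  have iv_i: "polynomial_approximation_set \<Gamma> D" if iv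
    using that polynomial_approximation_of_component[OF assms(1,4,3,5,6)] unfolding iv_def by blast
  show ?thesis
    unfolding ii_def[symmetric] iv_def[symmetric] using i_ii ii_iii iii_iv iv_i by blast
qed

end
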